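(* Let $B^{me}$ be the standard Brownian meander on $[0,1]$, and let $0<s<t\le 1$ and $c>0$. The first and second moments of $B^{me}(s)$ conditional on $B^{me}(t)=c$, $$M_k(s,t,c)=\int_0^\infty x^k\,p\big(B^{me}(s)=x\,\big|\,B^{me}(t)=c\big)\,dx,\qquad k=1,2,$$ are given by $$M_1(s,t,c)=\frac{1}{c}\Big[t-s+\frac{s c^2}{t}\Big]\,\mathrm{erf}\!\left(\frac{c\sqrt{s}}{\sqrt{2t(t-s)}}\right)+\frac{\sqrt{2s(t-s)}}{\sqrt{\pi t}}\,\exp\!\left(-\frac{s c^2}{2t(t-s)}\right),$$ $$M_2(s,t,c)=\frac{3s(t-s)}{t}+\frac{c^2s^2}{t^2}.$$
   Context: Brownian meander: let $B$ be a standard Brownian motion on $[0,1]$ with $B(0)=0$, $\tau_1=\sup\{t\in[0,1]: B(t)=0\}$ and $\Delta_1=1-\tau_1$. The Brownian meander is $B^{me}(t)=|B(\tau_1+t\Delta_1)|/\sqrt{\Delta_1}$, $t\in[0,1]$. Notation: $\phi_\sigma(x)=(2\pi \sigma)^{-1/2}e^{-x^2/(2\sigma)}$ is the centered Gaussian density of variance $\sigma$, and $g_\sigma(x,y)=\phi_\sigma(y-x)-\phi_\sigma(y+x)$. $p(B^{me}(s)=x\mid B^{me}(t)=c)$ denotes the conditional density in $x>0$ of $B^{me}(s)$ given $B^{me}(t)=c$. It is known that for $0<s<t\le1$ and $x,c>0$, $$p(B^{me}(s)=x\mid B^{me}(t)=c)=g_{t-s}(x,c)\,\frac{x\,t^{3/2}}{c\,s^{3/2}}\,e^{-x^2/(2s)}\,e^{c^2/(2t)}.$$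 $\mathrm{erf}(z)=\frac{2}{\sqrt\pi}\int_0^z e^{-u^2}du$. *)

theory Defs
  imports "HOL-Probability.Probability"
begin

definition erf :: "real \<Rightarrow> real" where
  "erf z = 2 / sqrt pi * (LBINT u=0..z. exp (- u\<^sup>2))"

(* Standard Brownian motion on [0, 1].  The last clause is the independence of the
   increment B u - B r from the natural filtration at time r, which is the sigma-algebra
   generated by the path (B v) for v in [0, r] as a random element of the product space.
   Paths start at 0 and are continuous surely, so that the last zero below is a random
   variable whether or not M is complete.
   The second argument of normal_density is the standard deviation. *)
definition brownian_motion :: "'a measure \<Rightarrow> (real \<Rightarrow> 'a \<Rightarrow> real) \<Rightarrow> bool" where
  "brownian_motion M B \<longleftrightarrow>
     prob_space M \<and>
     (\<forall>r\<in>{0..1}. B r \<in> borel_measurable M) \<and>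
     (\<forall>\<omega>\<in>space M. B 0 \<omega> = 0) \<and>
     (\<forall>\<omega>\<in>space M. continuous_on {0..1} (\<lambda>r. B r \<omega>)) \<and>
     (\<forall>r u. 0 \<le> r \<and> r < u \<and> u \<le> 1 \<longrightarrow>
        distributed M lborel (\<lambda>\<omega>. B u \<omega> - B r \<omega>) (normal_density 0 (sqrt (u - r)))) \<and>
     (\<forall>r u. 0 \<le> r \<and> r < u \<and> u \<le> 1 \<longrightarrow>
        prob_space.indep_set M
          (sets (vimage_algebra (space M) (\<lambda>\<omega>. \<lambda>v\<in>{0..r}. B v \<omega>) (Pi\<^sub>M {0..r} (\<lambda>_. borel))))
          (sets (vimage_algebra (space M) (\<lambda>\<omega>. B u \<omega> - B r \<omega>) borel)))"

definition last_zero :: "(real \<Rightarrow> 'a \<Rightarrow> real) \<Rightarrow> 'a \<Rightarrow> real" where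
  "last_zero B \<omega> = Sup {t \<in> {0..1}. B t \<omega> = 0}"

(* On the null event that B 1 = 0 the denominator vanishes and the value is 0. *)
definition meander :: "(real \<Rightarrow> 'a \<Rightarrow> real) \<Rightarrow> real \<Rightarrow> 'a \<Rightarrow> real" where
  "meander B t \<omega> =
     (let \<tau> = last_zero B \<omega>; \<Delta> = 1 - \<tau> in \<bar>B (\<tau> + t * \<Delta>) \<omega>\<bar> / sqrt \<Delta>)"

(* p x c is a (Lebesgue) density in x of the conditional law of X given Y = c:
   the joint law of (X, Y) disintegrates as p x c dx P(Y in dc).  This determines
   p only up to null sets. *)
definition conditional_density ::
  "'a measure \<Rightarrow> ('a \<Rightarrow> real) \<Rightarrow> ('a \<Rightarrow> real) \<Rightarrow> (real \<Rightarrow> real \<Rightarrow> real) \<Rightarrow> bool" where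
  "conditional_density M X Y p \<longleftrightarrow>
     (\<lambda>(x, c). p x c) \<in> borel_measurable (borel \<Otimes>\<^sub>M borel) \<and>
     (\<forall>x c. 0 \<le> p x c) \<and>
     (\<forall>A\<in>sets borel. \<forall>C\<in>sets borel.
        emeasure M {\<omega> \<in> space M. X \<omega> \<in> A \<and> Y \<omega> \<in> C} =
          (\<integral>\<^sup>+c\<in>C. (\<integral>\<^sup>+x\<in>A. ennreal (p x c) \<partial>lborel) \<partial>distr M borel Y))"

(* Conditioning on the null event that the meander takes the value c at time t is
   meaningful for every c > 0 because the conditional density has a version that is
   continuous on the open quadrant x, c > 0; it is unique there, the meander at time t
   having a positive density on (0, infinity). *)
definition meander_conditional_density ::
  "'a measure \<Rightarrow> (real \<Rightarrow> 'a \<Rightarrow> real) \<Rightarrow> real \<Rightarrow> real \<Rightarrow> (real \<Rightarrow> real \<Rightarrow> real) \<Rightarrow> bool" where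
  "meander_conditional_density M B s t p \<longleftrightarrow>
     conditional_density M (meander B s) (meander B t) p \<and>
     continuous_on ({0<..} \<times> {0<..}) (\<lambda>(x, c). p x c)"

definition conditional_moment :: "nat \<Rightarrow> (real \<Rightarrow> real \<Rightarrow> real) \<Rightarrow> real \<Rightarrow> real" where
  "conditional_moment k p c = (LBINT x:{0<..}. x ^ k * p x c)"

end

(* Cut [0, 1] into n cells. If the last zero of B lies in the cell ending at time a, the path after a
   is a Brownian motion that avoids 0 up to time 1, started from B a, which is close to 0.
   For even f1, f2 and an odd payoff at time 1, paths that hit 0 contribute nothing (reflection),
   so the killed expectation of f1, f2 is the unkilled one with the extra factor sgn (B a) * sgn (B 1).
   Brownian scaling turns it into K (B a / sqrt (1 - a)) for a fixed odd function K, and dividing by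
   the K obtained from f1 = f2 = 1 conditions on the cell. As n grows the argument tends to 0, so the
   expectation of f1, f2 for the meander is the quotient of the derivatives K'(0). This identifies
   the joint density at two times, hence the conditional density first almost everywhere and then,
   by continuity, everywhere on the open quadrant; its moments are elementary integrals. *)
theory Submission
  imports Defs "HOL-Real_Asymp.Real_Asymp"
begin

section \<open>The Gaussian semigroup on odd functions\<close>

text \<open>The last zero is not a stopping time, so the Markov property cannot be applied at it. At
  the right end \<open>a\<close> of its cell the event splits into a zero in the cell, known at time
  \<open>a\<close>, and no zero from \<open>a\<close> to 1. The comparison with the conditioned
  kernel is then an identity of expectations for every grid, because the quotient of kernels depends
  only on \<open>B a\<close> and joins the past factor; refining the grid only sends the start value
  to 0. Hitting times are avoided too: the killing is removed by discretising the first zero and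
  using that an odd payoff is small near 0.

  One formula carries the analysis: on odd functions the Gaussian semigroup acts through the kernel
  sinh, in which positivity, comparison and the derivative at the origin are all visible.

  The closed form of the conditional density is derived, not assumed. Its parameters are the mean c
  s / t and the variance s (t - s) / t at time s of a Brownian bridge from 0 to c over
  [0, t].\<close>

text \<open>Standardised, so that \<open>heat 0 f = f\<close> (whereas \<^term>\<open>normal_density 0 0\<close> is identically zero).\<close>

definition heat :: "real \<Rightarrow> (real \<Rightarrow> real) \<Rightarrow> real \<Rightarrow> real" where
  "heat h f y = (LINT w|lborel. f (y + sqrt h * w) * std_normal_density w)"

text \<open>The Lipschitz bound makes an odd payoff small near 0, at a rate that \<open>heat\<close>
  does not worsen; the uniform bound gives integrability. The class is closed under products and
  \<open>heat\<close>, so it survives backward conditioning over several times.\<close>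

definition bounded_lipschitz :: "(real \<Rightarrow> real) \<Rightarrow> bool" where
  "bounded_lipschitz f \<longleftrightarrow> (\<exists>L. (\<forall>x y. \<bar>f x - f y\<bar> \<le> L * \<bar>x - y\<bar>) \<and> (\<forall>x. \<bar>f x\<bar> \<le> L))"

definition odd_fun :: "(real \<Rightarrow> real) \<Rightarrow> bool" where
  "odd_fun f \<longleftrightarrow> (\<forall>x. f (- x) = - f x)"

lemma borel_measurable_sinh [measurable]:
  assumes "f \<in> borel_measurable M" shows "(\<lambda>x. sinh (f x :: real)) \<in> borel_measurable M"
  by (rule measurable_compose[OF assms borel_measurable_continuous_onI]) (intro continuous_intros)

lemma integrable_std_normal: "integrable lborel std_normal_density"
  by (rule integrable_normal_density) simp

lemma integral_std_normal: "(LINT w|lborel. std_normal_density w) = 1"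
  by (rule integral_normal_density) simp

lemma integrable_bounded_mult_normal:
  assumes [measurable]: "g \<in> borel_measurable borel" and "\<And>x. \<bar>g x\<bar> \<le> C"
  shows "integrable lborel (\<lambda>w. g w * std_normal_density w)"
proof (rule Bochner_Integration.integrable_bound[OF integrable_mult_right[OF integrable_std_normal, of C]])
  show "AE x in lborel. norm (g x * std_normal_density x) \<le> norm (C * std_normal_density x)"
    using assms(2) by (intro AE_I2) (auto simp: abs_mult intro!: mult_right_mono order_trans[OF _ abs_ge_self])
qed measurable

lemma integrable_heat:
  assumes [measurable]: "f \<in> borel_measurable borel" and "\<And>x. \<bar>f x\<bar> \<le> C"
  shows "integrable lborel (\<lambda>w. f (y + sqrt h * w) * std_normal_density w)"
  using assms(2) by (intro integrable_bounded_mult_normal) auto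

lemma heat_0 [simp]: "heat 0 f = f"
  by (rule ext) (simp add: heat_def integral_std_normal)

lemma borel_measurable_heat [measurable]:
  assumes [measurable]: "f \<in> borel_measurable borel"
  shows "heat h f \<in> borel_measurable borel"
  unfolding heat_def by measurable

lemma heat_le:
  assumes [measurable]: "f \<in> borel_measurable borel" and "\<And>x. \<bar>f x\<bar> \<le> C"
  shows "\<bar>heat h f y\<bar> \<le> C"
proof -
  have "\<bar>heat h f y\<bar> \<le> (LINT w|lborel. C * std_normal_density w)"
    unfolding heat_def
    using assms(2)
    by (intro integral_abs_bound[THEN order_trans] integral_mono integrable_abs integrable_heat[OF assms]
        integrable_mult_right integrable_std_normal)
      (auto simp: abs_mult intro!: mult_right_mono)
  then show ?thesis by (simp add: integral_std_normal)
qed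

lemma odd_fun_mult: "(\<And>x. f (- x) = f x) \<Longrightarrow> odd_fun g \<Longrightarrow> odd_fun (\<lambda>x. f x * g x)"
  unfolding odd_fun_def by simp

lemma odd_heat:
  assumes "odd_fun f" shows "odd_fun (heat h f)"
  unfolding odd_fun_def
proof
  fix y
  have "heat h f (- y) = (LINT w|lborel. f (- y + sqrt h * (- w)) * std_normal_density (- w))"
    unfolding heat_def
    by (subst lborel_integral_real_affine[where c = "-1" and t = 0]) auto
  also have "\<dots> = (LINT w|lborel. - (f (y + sqrt h * w) * std_normal_density w))"
  proof (rule Bochner_Integration.integral_cong[OF refl])
    fix w
    have "f (- y + sqrt h * (- w)) = - f (y + sqrt h * w)"
      using assms[unfolded odd_fun_def, rule_format, of "y + sqrt h * w"] by simp
    then show "f (- y + sqrt h * (- w)) * std_normal_density (- w) = - (f (y + sqrt h * w) * std_normal_density w)"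
      by (simp add: std_normal_density_def)
  qed
  finally show "heat h f (- y) = - heat h f y" by (simp add: heat_def)
qed

lemma bounded_lipschitz_continuous_on:
  assumes "bounded_lipschitz f" shows "continuous_on UNIV f"
proof -
  obtain L where L: "\<And>x y. \<bar>f x - f y\<bar> \<le> L * \<bar>x - y\<bar>" "\<And>x. \<bar>f x\<bar> \<le> L"
    using assms unfolding bounded_lipschitz_def by blast
  have "L-lipschitz_on UNIV f"
    using L(1) order_trans[OF abs_ge_zero L(2)] by (auto intro!: lipschitz_onI simp: dist_real_def)
  then show ?thesis by (rule lipschitz_on_continuous_on)
qed

lemma bounded_lipschitz_isCont: "bounded_lipschitz f \<Longrightarrow> isCont f x"
  using bounded_lipschitz_continuous_on by (simp add: continuous_on_eq_continuous_at)

lemma bounded_lipschitz_measurable: "bounded_lipschitz f \<Longrightarrow> f \<in> borel_measurable borel"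
  by (intro borel_measurable_continuous_onI bounded_lipschitz_continuous_on)

lemma bounded_lipschitz_mult:
  assumes "bounded_lipschitz f" "bounded_lipschitz g"
  shows "bounded_lipschitz (\<lambda>x. f x * g x)"
proof -
  obtain L where L: "\<And>x y. \<bar>f x - f y\<bar> \<le> L * \<bar>x - y\<bar>" "\<And>x. \<bar>f x\<bar> \<le> L"
    using assms(1) unfolding bounded_lipschitz_def by blast
  obtain K where K: "\<And>x y. \<bar>g x - g y\<bar> \<le> K * \<bar>x - y\<bar>" "\<And>x. \<bar>g x\<bar> \<le> K"
    using assms(2) unfolding bounded_lipschitz_def by blast
  have nn: "0 \<le> L" "0 \<le> K" using order_trans[OF abs_ge_zero L(2)] order_trans[OF abs_ge_zero K(2)] by auto
  have a: "\<bar>f x * g x - f y * g y\<bar> \<le> 2 * L * K * \<bar>x - y\<bar>" for x y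
  proof -
    have "f x * g x - f y * g y = f x * (g x - g y) + g y * (f x - f y)" by (simp add: algebra_simps)
    then have "\<bar>f x * g x - f y * g y\<bar> \<le> \<bar>f x\<bar> * \<bar>g x - g y\<bar> + \<bar>g y\<bar> * \<bar>f x - f y\<bar>"
      by (metis abs_mult abs_triangle_ineq)
    also have "\<dots> \<le> L * (K * \<bar>x - y\<bar>) + K * (L * \<bar>x - y\<bar>)"
      by (intro add_mono mult_mono L K) (use nn in auto)
    finally show ?thesis by (simp add: algebra_simps)
  qed
  have b: "\<bar>f x * g x\<bar> \<le> 2 * L * K" for x
  proof -
    have "\<bar>f x * g x\<bar> \<le> L * K" unfolding abs_mult by (intro mult_mono L K) (use nn in auto)
    then show ?thesis using mult_nonneg_nonneg[OF nn] by linarith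
  qed
  show ?thesis unfolding bounded_lipschitz_def using a b by blast
qed

lemma heat_lipschitz:
  assumes [measurable]: "f \<in> borel_measurable borel"
    and L: "\<And>x y. \<bar>f x - f y\<bar> \<le> L * \<bar>x - y\<bar>" and C: "\<And>x. \<bar>f x\<bar> \<le> C"
  shows "\<bar>heat h f x - heat h f y\<bar> \<le> L * \<bar>x - y\<bar>"
proof -
  have "heat h f x - heat h f y = (LINT w|lborel. (f (x + sqrt h * w) - f (y + sqrt h * w)) * std_normal_density w)"
    unfolding heat_def left_diff_distrib
    by (rule Bochner_Integration.integral_diff[symmetric]; rule integrable_heat[OF assms(1) C])
  also have "\<bar>\<dots>\<bar> \<le> (LINT w|lborel. L * \<bar>x - y\<bar> * std_normal_density w)"
  proof (intro integral_abs_bound[THEN order_trans] integral_mono integrable_abs)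
    show "integrable lborel (\<lambda>w. (f (x + sqrt h * w) - f (y + sqrt h * w)) * std_normal_density w)"
      unfolding left_diff_distrib by (intro Bochner_Integration.integrable_diff integrable_heat[OF assms(1) C])
    show "integrable lborel (\<lambda>w. L * \<bar>x - y\<bar> * std_normal_density w)"
      by (intro integrable_mult_right integrable_std_normal)
    fix w 
    show "\<bar>(f (x + sqrt h * w) - f (y + sqrt h * w)) * std_normal_density w\<bar> \<le> L * \<bar>x - y\<bar> * std_normal_density w"
      using L[of "x + sqrt h * w" "y + sqrt h * w"] by (auto simp: abs_mult intro!: mult_right_mono)
  qed
  finally show ?thesis by (simp add: integral_std_normal)
qed

lemma bounded_lipschitz_heat:
  assumes "bounded_lipschitz f" shows "bounded_lipschitz (heat h f)"
proof -
  obtain L where L: "\<And>x y. \<bar>f x - f y\<bar> \<le> L * \<bar>x - y\<bar>" "\<And>x. \<bar>f x\<bar> \<le> L"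
    using assms unfolding bounded_lipschitz_def by blast
  show ?thesis unfolding bounded_lipschitz_def
    using heat_lipschitz[OF bounded_lipschitz_measurable[OF assms] L]
      heat_le[OF bounded_lipschitz_measurable[OF assms] L(2)] by blast
qed

text \<open>Brownian scaling in semigroup form; it later normalises the remaining time
  \<open>1 - a\<close> to 1.\<close>

lemma heat_scale:
  assumes "0 < D" 
  shows "heat (h * D) (\<lambda>x. f (x / sqrt D)) y = heat h f (y / sqrt D)"
  using assms by (simp add: heat_def real_sqrt_mult add_divide_distrib)

lemma integral_normal_density_eq_heat:
  assumes "0 < h"
  shows "(LINT w|lborel. f (y + w) * normal_density 0 (sqrt h) w) = heat h f y"
proof -
  have "(LINT w|lborel. f (y + w) * normal_density 0 (sqrt h) w)
    = \<bar>sqrt h\<bar> *\<^sub>R (LINT w|lborel. f (y + (0 + sqrt h * w)) * normal_density 0 (sqrt h) (0 + sqrt h * w))"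
    using assms by (intro lborel_integral_real_affine) auto
  also have "\<dots> = (LINT w|lborel. sqrt h * (f (y + sqrt h * w) * normal_density 0 (sqrt h) (sqrt h * w)))"
    using assms by simp
  also have "\<dots> = heat h f y" unfolding heat_def
    using assms by (intro Bochner_Integration.integral_cong refl)
     (simp add: normal_density_def real_sqrt_mult power_mult_distrib field_simps)
  finally show ?thesis .
qed

section \<open>The hyperbolic sine kernel on odd functions\<close>

lemma integrable_normal_exp_abs:
  "integrable lborel (\<lambda>v. std_normal_density v * exp (a * \<bar>v\<bar>))"
proof -
  \<comment> \<open>Completing the square: exponential tilting shifts the mean of the Gaussian to
    \<open>b\<close>.\<close>
  have e: "std_normal_density v * exp (b * v) = exp (b\<^sup>2 / 2) * normal_density b 1 v" for b v :: real
    unfolding normal_density_def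
    by (simp add: mult_exp_exp[symmetric] exp_add[symmetric] power2_eq_square field_simps flip: exp_add)
  have i: "integrable lborel (\<lambda>v. std_normal_density v * exp (b * v))" for b :: real
    unfolding e by (intro integrable_mult_right integrable_normal_density) simp
  show ?thesis
  proof (rule Bochner_Integration.integrable_bound[OF Bochner_Integration.integrable_add[OF i[of a] i[of "-a"]]])
    show "AE x in lborel. norm (std_normal_density x * exp (a * \<bar>x\<bar>))
      \<le> norm (std_normal_density x * exp (a * x) + std_normal_density x * exp (- a * x))"
    proof (rule AE_I2)
      fix x :: real
      have "a * \<bar>x\<bar> = a * x \<or> a * \<bar>x\<bar> = - a * x" by (auto simp: abs_if)
      then have "exp (a * \<bar>x\<bar>) \<le> exp (a * x) + exp (- a * x)" by (auto simp: add_increasing add_increasing2)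
      then have "std_normal_density x * exp (a * \<bar>x\<bar>) \<le> std_normal_density x * (exp (a * x) + exp (- a * x))"
        by (rule mult_left_mono) simp
      then show "norm (std_normal_density x * exp (a * \<bar>x\<bar>))
        \<le> norm (std_normal_density x * exp (a * x) + std_normal_density x * exp (- a * x))"
        by (simp add: distrib_left abs_mult)
    qed
  qed measurable
qed

text \<open>Shifting the variable by \<open>y / sqrt h\<close> and completing the square moves
  \<open>y\<close> into a factor exp(v z); antisymmetrising in \<open>y\<close>, which oddness of
  \<open>f\<close> permits, turns it into sinh. Afterwards \<open>y\<close> no longer occurs inside
  \<open>f\<close>, and for \<open>y > 0\<close> the kernel has the sign of
  \<open>v\<close>.\<close>

lemma heat_sinh:
  assumes [measurable]: "f \<in> borel_measurable borel" and C: "\<And>x. \<bar>f x\<bar> \<le> C" 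
    and "odd_fun f" "0 < h"
  shows "heat h f y = exp (- (y / sqrt h)\<^sup>2 / 2) * 
     (LINT v|lborel. f (sqrt h * v) * sinh (v * (y / sqrt h)) * std_normal_density v)"
proof -
  define z where "z = y / sqrt h"
  have e: "std_normal_density (v - z) = exp (- z\<^sup>2 / 2) * (exp (v * z) * std_normal_density v)" for v z :: real
    unfolding std_normal_density_def
    by (simp add: exp_add[symmetric] power2_eq_square field_simps flip: exp_add)
  have i: "integrable lborel (\<lambda>v. f (sqrt h * v) * (exp (v * z) * std_normal_density v))" for z
  proof (rule Bochner_Integration.integrable_bound[OF integrable_mult_right[OF integrable_normal_exp_abs[of "\<bar>z\<bar>"], of C]])
    show "AE x in lborel. norm (f (sqrt h * x) * (exp (x * z) * std_normal_density x))
       \<le> norm (C * (std_normal_density x * exp (\<bar>z\<bar> * \<bar>x\<bar>)))"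
    proof (rule AE_I2)
      fix x
      have "x * z \<le> \<bar>z\<bar> * \<bar>x\<bar>" by (metis abs_ge_self abs_mult mult.commute)
      then have "\<bar>f (sqrt h * x)\<bar> * (exp (x * z) * std_normal_density x) \<le> C * (exp (\<bar>z\<bar> * \<bar>x\<bar>) * std_normal_density x)"
        using C[of "sqrt h * x"] by (intro mult_mono) auto
      then show "norm (f (sqrt h * x) * (exp (x * z) * std_normal_density x))
       \<le> norm (C * (std_normal_density x * exp (\<bar>z\<bar> * \<bar>x\<bar>)))"
        using C[of 0] by (simp add: abs_mult mult.commute mult.left_commute)
    qed
  qed measurable
  have h1: "heat h f y = exp (- z\<^sup>2 / 2) * (LINT v|lborel. f (sqrt h * v) * (exp (v * z) * std_normal_density v))" 
    if "y = sqrt h * z" for y z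
  proof -
    have "heat h f y = (LINT v|lborel. f (y + sqrt h * (- z + 1 * v)) * std_normal_density (- z + 1 * v))"
      unfolding heat_def by (subst lborel_integral_real_affine[where c = "1" and t = "- z"]) auto
    also have "\<dots> = (LINT v|lborel. exp (- z\<^sup>2 / 2) * (f (sqrt h * v) * (exp (v * z) * std_normal_density v)))"
      using e[of _ z] by (intro Bochner_Integration.integral_cong refl) (simp add: that algebra_simps)
    finally show ?thesis by simp
  qed
  have y: "y = sqrt h * z" using \<open>0 < h\<close> by (simp add: z_def)
  have "heat h f y = (heat h f y - heat h f (- y)) / 2"
    using odd_heat[OF \<open>odd_fun f\<close>, of h] by (simp add: odd_fun_def)
  also have "\<dots> = exp (- z\<^sup>2 / 2) * (((LINT v|lborel. f (sqrt h * v) * (exp (v * z) * std_normal_density v)) -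
     (LINT v|lborel. f (sqrt h * v) * (exp (v * (- z)) * std_normal_density v))) / 2)"
    using h1[OF y] h1[of "- y" "- z"] y by (simp add: algebra_simps diff_divide_distrib)
  also have "((LINT v|lborel. f (sqrt h * v) * (exp (v * z) * std_normal_density v)) -
     (LINT v|lborel. f (sqrt h * v) * (exp (v * (- z)) * std_normal_density v))) / 2 
    = (LINT v|lborel. f (sqrt h * v) * sinh (v * z) * std_normal_density v)"
    by (subst Bochner_Integration.integral_diff[symmetric, OF i i], subst integral_divide_zero[symmetric])
     (auto intro!: Bochner_Integration.integral_cong simp: sinh_def field_simps)
  finally show ?thesis unfolding z_def .
qed

lemma integrable_heat_sinh:
  assumes [measurable]: "f \<in> borel_measurable borel" and C: "\<And>x. \<bar>f x\<bar> \<le> C" 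
  shows "integrable lborel (\<lambda>v. f v * sinh (v * z) * std_normal_density v)"
proof (rule Bochner_Integration.integrable_bound[OF integrable_mult_right[OF integrable_normal_exp_abs[of "\<bar>z\<bar>"], of C]])
  show "AE x in lborel. norm (f x * sinh (x * z) * std_normal_density x)
       \<le> norm (C * (std_normal_density x * exp (\<bar>z\<bar> * \<bar>x\<bar>)))"
  proof (rule AE_I2)
    fix x
    have "\<bar>sinh (x * z)\<bar> = sinh (\<bar>z\<bar> * \<bar>x\<bar>)" by (simp add: abs_mult mult.commute flip: sinh_real_abs)
    also have "\<dots> \<le> exp (\<bar>z\<bar> * \<bar>x\<bar>)" by (simp add: sinh_def) (smt (verit) exp_gt_zero)
    finally have "\<bar>f x\<bar> * \<bar>sinh (x * z)\<bar> * std_normal_density x \<le> C * exp (\<bar>z\<bar> * \<bar>x\<bar>) * std_normal_density x"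
      using C[of x] by (intro mult_mono) auto
    then show "norm (f x * sinh (x * z) * std_normal_density x)
       \<le> norm (C * (std_normal_density x * exp (\<bar>z\<bar> * \<bar>x\<bar>)))"
      using C[of 0] by (simp add: abs_mult mult.commute mult.left_commute)
  qed
qed measurable

section \<open>Killed Brownian motion\<close>

locale brownian = prob_space M for M :: "'a measure" +
  fixes B :: "real \<Rightarrow> 'a \<Rightarrow> real"
  assumes brownian: "brownian_motion M B"
begin

definition past :: "real \<Rightarrow> 'a measure" where
  "past r = vimage_algebra (space M) (\<lambda>\<omega>. \<lambda>v\<in>{0..r}. B v \<omega>) (Pi\<^sub>M {0..r} (\<lambda>_. borel))"

lemma B_measurable [measurable]: "0 \<le> r \<Longrightarrow> r \<le> 1 \<Longrightarrow> B r \<in> borel_measurable M"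
  using brownian unfolding brownian_motion_def by auto

lemma B_0: "\<omega> \<in> space M \<Longrightarrow> B 0 \<omega> = 0"
  using brownian unfolding brownian_motion_def by auto

lemma B_continuous: "\<omega> \<in> space M \<Longrightarrow> continuous_on {0..1} (\<lambda>r. B r \<omega>)"
  using brownian unfolding brownian_motion_def by auto

lemma space_past [simp]: "space (past r) = space M"
  by (simp add: past_def)

lemma path_measurable: "r \<le> 1 \<Longrightarrow> (\<lambda>\<omega>. \<lambda>v\<in>{0..r}. B v \<omega>) \<in> measurable M (Pi\<^sub>M {0..r} (\<lambda>_. borel))"
  by (intro measurable_restrict B_measurable) auto

lemma B_past: "0 \<le> v \<Longrightarrow> v \<le> r \<Longrightarrow> B v \<in> borel_measurable (past r)"
proof -
  assume v: "0 \<le> v" "v \<le> r"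
  have "(\<lambda>x. x v) \<circ> (\<lambda>\<omega>. \<lambda>v\<in>{0..r}. B v \<omega>) \<in> borel_measurable (past r)"
    unfolding past_def
    by (rule measurable_comp[OF measurable_vimage_algebra1 measurable_component_singleton]) (use v in \<open>auto simp: space_PiM\<close>)
  then show ?thesis using v by (simp add: o_def)
qed

lemma past_mono:
  assumes "r \<le> u" "f \<in> measurable (past r) N" shows "f \<in> measurable (past u) N"
proof -
  have "(\<lambda>\<omega>. \<omega>) \<in> measurable (past u) (past r)"
    unfolding past_def[of r]
    by (rule measurable_vimage_algebra2) (use assms(1) in \<open>auto intro!: measurable_restrict B_past\<close>)
  from measurable_compose[OF this assms(2)] show ?thesis .
qed

lemma past_measurable:
  assumes "r \<le> 1" "f \<in> measurable (past r) N" shows "f \<in> measurable M N"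
proof -
  have "(\<lambda>\<omega>. \<omega>) \<in> measurable M (past r)"
    unfolding past_def
    by (rule measurable_vimage_algebra2[OF _ path_measurable[OF assms(1)]]) auto
  from measurable_compose[OF this assms(2)] show ?thesis .
qed

text \<open>Independence of sigma-algebras becomes a product law. The target \<open>N\<close> is
  arbitrary because \<open>markov\<close> needs it for a pair: a bounded weight from the past
  together with the present position.\<close>

lemma distr_past_increment:
  assumes r: "0 \<le> r" "r < u" "u \<le> 1" and Z: "Z \<in> measurable (past r) N"
  shows "distr M N Z \<Otimes>\<^sub>M distr M borel (\<lambda>\<omega>. B u \<omega> - B r \<omega>)
    = distr M (N \<Otimes>\<^sub>M borel) (\<lambda>\<omega>. (Z \<omega>, B u \<omega> - B r \<omega>))"
proof -
  define I where "I = (\<lambda>\<omega>. B u \<omega> - B r \<omega>)"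
  have i: "indep_set (sets (past r)) (sets (vimage_algebra (space M) I borel))"
    using brownian r unfolding brownian_motion_def past_def I_def by blast
  have ZM [measurable]: "Z \<in> measurable M N" using past_measurable[OF _ Z] r by auto
  have IM [measurable]: "I \<in> borel_measurable M" using r by (auto simp: I_def)
  interpret PZ: prob_space "distr M N Z" by (rule prob_space_distr) measurable
  interpret PI: prob_space "distr M borel I" by (rule prob_space_distr) measurable
  have "distr M N Z \<Otimes>\<^sub>M distr M borel I = distr M (N \<Otimes>\<^sub>M borel) (\<lambda>\<omega>. (Z \<omega>, I \<omega>))"
  proof (rule pair_measure_eqI)
    fix A C assume "A \<in> sets (distr M N Z)" "C \<in> sets (distr M borel I)"
    then have [measurable]: "A \<in> sets N" "C \<in> sets borel" by auto
    have "prob ((Z -` A \<inter> space M) \<inter> (I -` C \<inter> space M)) = prob (Z -` A \<inter> space M) * prob (I -` C \<inter> space M)"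
    proof (rule indep_setD[OF i])
      show "Z -` A \<inter> space M \<in> sets (past r)" using measurable_sets[OF Z, of A] by simp
      show "I -` C \<inter> space M \<in> sets (vimage_algebra (space M) I borel)"
        by (rule in_vimage_algebra) measurable
    qed
    moreover have "(\<lambda>\<omega>. (Z \<omega>, I \<omega>)) -` (A \<times> C) \<inter> space M = (Z -` A \<inter> space M) \<inter> (I -` C \<inter> space M)" by auto
    ultimately show "emeasure (distr M N Z) A * emeasure (distr M borel I) C =
      emeasure (distr M (N \<Otimes>\<^sub>M borel) (\<lambda>\<omega>. (Z \<omega>, I \<omega>))) (A \<times> C)"
      by (simp add: emeasure_distr emeasure_eq_measure ennreal_mult)
  qed (auto simp: PZ.sigma_finite_measure_axioms PI.sigma_finite_measure_axioms cong: sets_pair_measure_cong)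
  then show ?thesis unfolding I_def .
qed

lemma markov:
  assumes r: "0 \<le> r" "r \<le> u" "u \<le> 1"
    and X: "X \<in> borel_measurable (past r)" "\<And>\<omega>. \<bar>X \<omega>\<bar> \<le> C"
    and f [measurable]: "f \<in> borel_measurable borel" and fC: "\<And>x. \<bar>f x\<bar> \<le> D"
  shows "expectation (\<lambda>\<omega>. X \<omega> * f (B u \<omega>)) = expectation (\<lambda>\<omega>. X \<omega> * heat (u - r) f (B r \<omega>))"
proof (cases "r = u")
  case False
  then have ru: "r < u" using r by auto
  define Z where "Z = (\<lambda>\<omega>. (X \<omega>, B r \<omega>))"
  define I where "I = (\<lambda>\<omega>. B u \<omega> - B r \<omega>)"
  have Z: "Z \<in> measurable (past r) (borel \<Otimes>\<^sub>M borel)"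
    unfolding Z_def using X(1) B_past[OF r(1) order_refl] by simp
  have ZM [measurable]: "Z \<in> measurable M (borel \<Otimes>\<^sub>M borel)" using past_measurable[OF _ Z] r by auto
  have IM [measurable]: "I \<in> borel_measurable M" unfolding I_def using r by simp
  have jd: "distr M (borel \<Otimes>\<^sub>M borel) Z \<Otimes>\<^sub>M distr M borel I
     = distr M ((borel \<Otimes>\<^sub>M borel) \<Otimes>\<^sub>M borel) (\<lambda>x. (Z x, I x))"
    unfolding I_def by (rule distr_past_increment[OF r(1) ru r(3) Z])
  have "distributed M lborel I (normal_density 0 (sqrt (u - r)))"
    using brownian r ru unfolding brownian_motion_def I_def by auto
  then have dI: "distr M borel I = density lborel (normal_density 0 (sqrt (u - r)))"
    using distributed_distr_eq_density by (metis distr_cong sets_lborel)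
  interpret PZ: prob_space "distr M (borel \<Otimes>\<^sub>M borel) Z" by (rule prob_space_distr) measurable
  interpret PI: prob_space "distr M borel I" by (rule prob_space_distr) measurable
  interpret P: pair_prob_space "distr M (borel \<Otimes>\<^sub>M borel) Z" "distr M borel I" ..
  \<comment> \<open>Clamping the first coordinate at \<open>C\<close> makes \<open>G\<close> bounded
    on the whole product space; at the values of \<open>X\<close> it changes nothing.\<close>
  define G where "G = (\<lambda>p. max (- C) (min C (fst (fst p))) * f (snd (fst p) + snd p :: real))"
  have G [measurable]: "G \<in> borel_measurable ((borel \<Otimes>\<^sub>M borel) \<Otimes>\<^sub>M borel)"
    unfolding G_def by measurable
  have C0: "0 \<le> C" using X(2)[of undefined] by linarith
  have Gb: "\<bar>G p\<bar> \<le> C * D" for p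
  proof -
    obtain x y w where p: "p = ((x, y), w)" by (metis surj_pair)
    have "\<bar>max (- C) (min C x)\<bar> * \<bar>f (y + w)\<bar> \<le> C * D"
      by (rule mult_mono) (use C0 fC in auto)
    then show ?thesis by (simp add: G_def p abs_mult)
  qed
  have Xc: "max (- C) (min C (X \<omega>)) = X \<omega>" for \<omega> using X(2)[of \<omega>] by auto
  have "expectation (\<lambda>\<omega>. X \<omega> * f (B u \<omega>)) = expectation (\<lambda>\<omega>. G (Z \<omega>, I \<omega>))"
    by (simp add: G_def Z_def I_def Xc)
  also have "\<dots> = integral\<^sup>L (distr M (borel \<Otimes>\<^sub>M borel) Z \<Otimes>\<^sub>M distr M borel I) G"
    unfolding jd by (subst integral_distr) auto
  also have "\<dots> = (LINT z|distr M (borel \<Otimes>\<^sub>M borel) Z. LINT w|distr M borel I. G (z, w))"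
    by (rule P.integral_fst'[symmetric], rule P.P.integrable_const_bound[of _ "C * D"]) (use Gb in auto)
  also have "\<dots> = expectation (\<lambda>\<omega>. LINT w|distr M borel I. G (Z \<omega>, w))"
    by (subst integral_distr) auto
  also have "\<dots> = expectation (\<lambda>\<omega>. X \<omega> * heat (u - r) f (B r \<omega>))"
  proof (rule Bochner_Integration.integral_cong[OF refl])
    fix \<omega>
    have "(LINT w|distr M borel I. G (Z \<omega>, w)) = (LINT w|lborel. normal_density 0 (sqrt (u - r)) w *\<^sub>R G (Z \<omega>, w))"
      unfolding dI by (rule integral_density) (auto simp: Z_def)
    also have "\<dots> = (LINT w|lborel. X \<omega> * (f (B r \<omega> + w) * normal_density 0 (sqrt (u - r)) w))"
      by (rule Bochner_Integration.integral_cong) (auto simp: G_def Z_def Xc)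
    also have "\<dots> = X \<omega> * heat (u - r) f (B r \<omega>)"
      using integral_normal_density_eq_heat[of "u - r" f "B r \<omega>"] ru by simp
    finally show "(LINT w|distr M borel I. G (Z \<omega>, w)) = X \<omega> * heat (u - r) f (B r \<omega>)" .
  qed
  finally show ?thesis .
qed simp

section \<open>Zeros of the path on an interval\<close>

definition hits :: "real \<Rightarrow> real \<Rightarrow> 'a set" where
  "hits a b = {\<omega>\<in>space M. \<exists>v\<in>{a..b}. B v \<omega> = 0}"

text \<open>This replaces an uncountable union by countable operations. By continuity a zero inside
  the interval is approached by rationals; conversely the absolute value of the path attains its
  minimum on a compact interval, so arbitrarily small values force a zero. The end points are
  adjoined because the interval may reduce to one irrational point and the zero may sit at an
  end.\<close>

lemma hits_approx:
  assumes "0 \<le> a" "a \<le> b" "b \<le> 1" "\<omega> \<in> space M"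
  shows "\<omega> \<in> hits a b \<longleftrightarrow> (\<forall>m::nat. \<exists>q\<in>insert a (insert b (\<rat> \<inter> {a..b})). \<bar>B q \<omega>\<bar> < 1 / Suc m)"
proof
  assume "\<omega> \<in> hits a b"
  then obtain v where v: "v \<in> {a..b}" "B v \<omega> = 0" unfolding hits_def by auto
  show "\<forall>m::nat. \<exists>q\<in>insert a (insert b (\<rat> \<inter> {a..b})). \<bar>B q \<omega>\<bar> < 1 / Suc m"
  proof
    fix m :: nat
    show "\<exists>q\<in>insert a (insert b (\<rat> \<inter> {a..b})). \<bar>B q \<omega>\<bar> < 1 / Suc m"
    proof (cases "v = a \<or> v = b")
      case True then show ?thesis using v by auto
    next
      case False
      then have v': "a < v" "v < b" using v by auto
      have "continuous_on {0<..<1} (\<lambda>r. B r \<omega>)"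
        using B_continuous[OF assms(4)] by (rule continuous_on_subset) auto
      then have "isCont (\<lambda>r. B r \<omega>) v"
        using v' assms by (simp add: continuous_on_eq_continuous_at)
      then obtain d where d: "d > 0" "\<And>x. \<bar>x - v\<bar> < d \<Longrightarrow> \<bar>B x \<omega> - B v \<omega>\<bar> < 1 / Suc m"
        unfolding continuous_at_eps_delta dist_real_def by (meson divide_pos_pos of_nat_0_less_iff zero_less_Suc zero_less_one)
      obtain q where q: "q \<in> \<rat>" "v < q" "q < min b (v + d)"
        using Rats_dense_in_real[of v "min b (v + d)"] v' d(1) by auto
      then show ?thesis using d(2)[of q] v v' by (intro bexI[of _ q]) auto
    qed
  qed
next
  assume R: "\<forall>m::nat. \<exists>q\<in>insert a (insert b (\<rat> \<inter> {a..b})). \<bar>B q \<omega>\<bar> < 1 / Suc m"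
  have c: "continuous_on {a..b} (\<lambda>r. \<bar>B r \<omega>\<bar>)"
    using B_continuous[OF assms(4)] assms by (intro continuous_on_rabs) (auto elim: continuous_on_subset)
  obtain v where v: "v \<in> {a..b}" "\<And>x. x \<in> {a..b} \<Longrightarrow> \<bar>B v \<omega>\<bar> \<le> \<bar>B x \<omega>\<bar>"
    using continuous_attains_inf[OF _ _ c] assms(2) by auto
  have "B v \<omega> = 0"
  proof (rule ccontr)
    assume "B v \<omega> \<noteq> 0"
    then obtain m :: nat where m: "1 / Suc m < \<bar>B v \<omega>\<bar>"
      using reals_Archimedean[of "\<bar>B v \<omega>\<bar>"] by (auto simp: inverse_eq_divide)
    obtain q where "q \<in> insert a (insert b (\<rat> \<inter> {a..b}))" "\<bar>B q \<omega>\<bar> < 1 / Suc m" using R by blast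
    then show False using v(2)[of q] m assms(2) by auto
  qed
  then show "\<omega> \<in> hits a b" using v(1) assms(4) unfolding hits_def by auto
qed

lemma hits_past:
  assumes "0 \<le> a" "a \<le> b" "b \<le> 1"
  shows "hits a b \<in> sets (past b)"
proof -
  define Q where "Q = insert a (insert b (\<rat> \<inter> {a..b}))"
  have Q: "countable Q" unfolding Q_def using countable_rat by auto
  have "hits a b = {\<omega>\<in>space (past b). \<forall>m::nat. \<exists>q\<in>Q. \<bar>B q \<omega>\<bar> < 1 / Suc m}"
    unfolding Q_def using hits_approx[OF assms] hits_def by auto
  also have "\<dots> = (\<Inter>m::nat. \<Union>q\<in>Q. {\<omega>\<in>space (past b). \<bar>B q \<omega>\<bar> < 1 / Suc m})" by auto
  also have "\<dots> \<in> sets (past b)"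
  proof (rule sets.countable_INT', safe)
    fix m :: nat
    show "(\<Union>q\<in>Q. {\<omega> \<in> space (past b). \<bar>B q \<omega>\<bar> < 1 / real (Suc m)}) \<in> sets (past b)"
    proof (intro sets.countable_UN'' Q)
    fix q assume "q \<in> Q"
    then have [measurable]: "B q \<in> borel_measurable (past b)" 
      using assms by (intro B_past) (auto simp: Q_def)
    show "{\<omega> \<in> space (past b). \<bar>B q \<omega>\<bar> < 1 / real (Suc m)} \<in> sets (past b)" by measurable
  qed
  qed auto
  finally show ?thesis .
qed

lemma hits_measurable [measurable]:
  assumes "0 \<le> a" "a \<le> b" "b \<le> 1" shows "hits a b \<in> sets M"
proof -
  have "(\<lambda>\<omega>. indicator (hits a b) \<omega> :: real) \<in> borel_measurable (past b)"
    using hits_past[OF assms] by (rule borel_measurable_indicator)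
  then have "(\<lambda>\<omega>. indicator (hits a b) \<omega> :: real) \<in> borel_measurable M"
    using past_measurable assms by blast
  then show ?thesis by (subst (asm) borel_measurable_indicator_iff) (simp_all add: hits_def Int_def conj_comms)
qed

lemma integrable_bounded:
  assumes "f \<in> borel_measurable M" "\<And>\<omega>. \<omega> \<in> space M \<Longrightarrow> \<bar>f \<omega>\<bar> \<le> (C::real)"
  shows "integrable M f"
  using assms by (intro integrable_const_bound[of _ C]) auto

abbreviation avoids :: "real \<Rightarrow> real \<Rightarrow> 'a \<Rightarrow> real" where
  "avoids a b \<omega> \<equiv> 1 - indicator (hits a b) \<omega>"

text \<open>An odd payoff has value zero once the path has visited 0. Conditioning at the end of the first
  cell of a grid that contains a zero, the path is still near 0 there, so the conditional expectation
  is small by oddness and the Lipschitz bound.\<close>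

lemma integral_hits_eq_0:
  assumes ab: "0 \<le> a" "a \<le> b" "b \<le> 1"
    and X: "X \<in> borel_measurable (past a)" "\<And>\<omega>. \<bar>X \<omega>\<bar> \<le> C"
    and f: "bounded_lipschitz f" "odd_fun f"
  shows "expectation (\<lambda>\<omega>. X \<omega> * f (B b \<omega>) * indicator (hits a b) \<omega>) = 0"
proof -
  obtain L where L: "\<And>x y. \<bar>f x - f y\<bar> \<le> L * \<bar>x - y\<bar>" "\<And>x. \<bar>f x\<bar> \<le> L"
    using f(1) unfolding bounded_lipschitz_def by blast
  note fm [measurable] = bounded_lipschitz_measurable[OF f(1)]
  have nn: "0 \<le> L" "0 \<le> C" using order_trans[OF abs_ge_zero L(2)] order_trans[OF abs_ge_zero X(2)] by auto
  define T where "T n k = a + real k / real (Suc n) * (b - a)" for n k :: nat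
  have T0: "T n 0 = a" and Tn: "T n (Suc n) = b" for n by (auto simp: T_def)
  have Tmono: "T n k \<le> T n l" if "k \<le> l" for n k l
    unfolding T_def using that ab by (intro add_left_mono mult_right_mono divide_right_mono) auto
  have Ta: "a \<le> T n k" for n k using Tmono[of 0 k n] by (simp add: T0)
  have Tb: "T n k \<le> b" if "k \<le> Suc n" for n k using Tmono[OF that, of n] by (simp only: Tn)
  have Tbd: "0 \<le> T n k" "k \<le> Suc n \<Longrightarrow> T n k \<le> 1" for n k using Ta[of n k] Tb[of k n] ab by auto
  \<comment> \<open>Increments of an increasing family of indicators: \<open>S n k\<close> marks the
    event that cell \<open>k\<close> is the first to contain a zero, \<open>k = 0\<close> standing
    for a zero at \<open>a\<close> itself. Each is known at time \<open>T n k\<close>, and they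
    partition \<open>hits a b\<close>.\<close>
  define S where "S n k \<omega> = (indicator (hits a (T n k)) \<omega> - (if k = 0 then 0 else indicator (hits a (T n (k - 1))) \<omega>) :: real)"
    for n k \<omega>
  have Ssum: "(\<Sum>k\<le>m. S n k \<omega>) = indicator (hits a (T n m)) \<omega>" for n m \<omega>
    by (induction m) (auto simp: S_def)
  have hmono: "hits a (T n (k - 1)) \<subseteq> hits a (T n k)" for n k
    using Tmono[of "k - 1" k n] unfolding hits_def by force
  have S01: "0 \<le> S n k \<omega>" "S n k \<omega> \<le> 1" for n k \<omega>
    using hmono[of n k] unfolding S_def by (auto split: split_indicator)
  have Spast: "S n k \<in> borel_measurable (past (T n k))" if "k \<le> Suc n" for n k
  proof -
    have "(\<lambda>\<omega>. indicator (hits a (T n l)) \<omega> :: real) \<in> borel_measurable (past (T n k))" if "l \<le> k" for l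
      using Ta[of n l] Tbd(2)[of l n] \<open>k \<le> Suc n\<close> that ab
      by (intro past_mono[OF Tmono[OF that]] borel_measurable_indicator hits_past) auto
    from this[of k] this[of "k - 1"] show ?thesis unfolding S_def by (cases "k = 0") auto
  qed
  have Xpast: "X \<in> borel_measurable (past (T n k))" for n k by (rule past_mono[OF Ta X(1)])
  have SXb: "\<bar>S n k \<omega> * X \<omega>\<bar> \<le> C" for n k \<omega>
    using mult_mono[of "\<bar>S n k \<omega>\<bar>" 1 "\<bar>X \<omega>\<bar>" C] S01[of n k \<omega>] X(2)[of \<omega>] by (simp add: abs_mult)
  define H where "H n k \<omega> = heat (b - T n k) f (B (T n k) \<omega>)" for n k \<omega>
  \<comment> \<open>Oddness enters here: the conditional payoff vanishes at 0, so the Lipschitz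
    bound controls it by the distance of the path from 0.\<close>
  have Hb: "\<bar>H n k \<omega>\<bar> \<le> L" "\<bar>H n k \<omega>\<bar> \<le> L * \<bar>B (T n k) \<omega>\<bar>" for n k \<omega>
  proof -
    show "\<bar>H n k \<omega>\<bar> \<le> L" unfolding H_def by (rule heat_le[OF fm L(2)])
    have "heat (b - T n k) f 0 = 0"
      using odd_heat[OF f(2), of "b - T n k"] unfolding odd_fun_def by (metis add.inverse_neutral equal_neg_zero)
    then show "\<bar>H n k \<omega>\<bar> \<le> L * \<bar>B (T n k) \<omega>\<bar>"
      using heat_lipschitz[OF fm L, of "b - T n k" "B (T n k) \<omega>" 0] by (simp add: H_def)
  qed
  have SM [measurable]: "S n k \<in> borel_measurable M" if "k \<le> Suc n" for n k
    using past_measurable[OF Tbd(2)[OF that] Spast[OF that]] .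
  have XM [measurable]: "X \<in> borel_measurable M" by (rule past_measurable[OF _ X(1)]) (use ab in auto)
  have BT [measurable]: "B (T n k) \<in> borel_measurable M" if "k \<le> Suc n" for n k
    using that Tbd by auto
  have HM [measurable]: "H n k \<in> borel_measurable M" if "k \<le> Suc n" for n k
    unfolding H_def using that by measurable
  have Bb [measurable]: "B b \<in> borel_measurable M" using ab by auto
  define \<Psi> where "\<Psi> n \<omega> = (\<Sum>k\<le>Suc n. S n k \<omega> * X \<omega> * H n k \<omega>)" for n \<omega>
  let ?E = "expectation (\<lambda>\<omega>. X \<omega> * f (B b \<omega>) * indicator (hits a b) \<omega>)"
  have bm: "\<bar>S n k \<omega> * X \<omega> * y\<bar> \<le> C * L" if "\<bar>y\<bar> \<le> L" for n k \<omega> y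
    unfolding abs_mult[of _ y] by (intro mult_mono SXb that) (use nn in auto)
  have E: "?E = expectation (\<Psi> n)" for n
  proof -
    have "?E = expectation (\<lambda>\<omega>. \<Sum>k\<le>Suc n. S n k \<omega> * X \<omega> * f (B b \<omega>))"
      by (simp only: sum_distrib_right[symmetric] Ssum Tn mult.assoc[of _ "X _" "f _"] mult.commute[of "indicator _ _"])
    also have "\<dots> = (\<Sum>k\<le>Suc n. expectation (\<lambda>\<omega>. S n k \<omega> * X \<omega> * f (B b \<omega>)))"
      by (intro Bochner_Integration.integral_sum integrable_bounded[where C = "C * L"] bm L(2)) auto
    also have "\<dots> = (\<Sum>k\<le>Suc n. expectation (\<lambda>\<omega>. S n k \<omega> * X \<omega> * H n k \<omega>))"
    proof (rule sum.cong[OF refl])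
      fix k assume "k \<in> {..Suc n}"
      then have k: "k \<le> Suc n" by auto
      show "expectation (\<lambda>\<omega>. S n k \<omega> * X \<omega> * f (B b \<omega>)) = expectation (\<lambda>\<omega>. S n k \<omega> * X \<omega> * H n k \<omega>)"
        unfolding H_def
        by (rule markov[OF Tbd(1) Tb[OF k] ab(3) borel_measurable_times[OF Spast[OF k] Xpast] SXb fm L(2)])
    qed
    also have "\<dots> = expectation (\<Psi> n)"
      unfolding \<Psi>_def
      by (intro Bochner_Integration.integral_sum[symmetric] integrable_bounded[where C = "C * L"] bm Hb) auto
    finally show ?thesis .
  qed
  \<comment> \<open>At most one \<open>S n k\<close> is nonzero, so a bound on \<open>H\<close>
    where \<open>S\<close> is nonzero bounds the whole sum.\<close>
  have \<Psi>b: "\<bar>\<Psi> n \<omega>\<bar> \<le> C * D" if "\<And>k. k \<le> Suc n \<Longrightarrow> S n k \<omega> \<noteq> 0 \<Longrightarrow> \<bar>H n k \<omega>\<bar> \<le> D" "0 \<le> D" for n \<omega> D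
  proof -
    have "\<bar>\<Psi> n \<omega>\<bar> \<le> (\<Sum>k\<le>Suc n. \<bar>S n k \<omega> * X \<omega> * H n k \<omega>\<bar>)" unfolding \<Psi>_def by (rule sum_abs)
    also have "\<dots> \<le> (\<Sum>k\<le>Suc n. S n k \<omega> * (C * D))"
    proof (rule sum_mono)
      fix k assume "k \<in> {..Suc n}"
      then have "S n k \<omega> = 0 \<or> \<bar>H n k \<omega>\<bar> \<le> D" using that(1)[of k] by auto
      then show "\<bar>S n k \<omega> * X \<omega> * H n k \<omega>\<bar> \<le> S n k \<omega> * (C * D)"
      proof
        assume "\<bar>H n k \<omega>\<bar> \<le> D"
        then have "\<bar>X \<omega>\<bar> * \<bar>H n k \<omega>\<bar> \<le> C * D" by (intro mult_mono X) (use nn in auto)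
        then show ?thesis using S01[of n k \<omega>] by (simp add: abs_mult mult.assoc mult_left_mono)
      qed simp
    qed
    also have "\<dots> = indicator (hits a b) \<omega> * (C * D)" by (simp only: sum_distrib_right[symmetric] Ssum Tn)
    also have "\<dots> \<le> C * D" using nn that(2) by (auto split: split_indicator)
    finally show ?thesis .
  qed
  have lim: "(\<lambda>n. \<Psi> n \<omega>) \<longlonglongrightarrow> 0" if \<omega>: "\<omega> \<in> space M" for \<omega>
  proof (rule LIMSEQ_I)
    fix r :: real assume r: "0 < r"
    \<comment> \<open>The summands 1 keep the denominators positive when \<open>C\<close> or
      \<open>L\<close> is 0.\<close>
    define e where "e = r / 2 / (C + 1) / (L + 1)"
    have e: "e > 0" using r nn by (simp add: e_def)
    have CLe: "C * (L * e) < r"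
    proof -
      have "C * (L * e) \<le> (C + 1) * ((L + 1) * e)" by (intro mult_mono) (use nn e in auto)
      also have "\<dots> = r / 2"
      proof -
        have "p * (q * (r / 2 / p / q)) = r / 2" if "p \<noteq> 0" "q \<noteq> 0" for p q using that by simp
        from this[of "C + 1" "L + 1"] show ?thesis using nn unfolding e_def by simp
      qed
      finally show ?thesis using r by simp
    qed
    have "uniformly_continuous_on {0..1} (\<lambda>r. B r \<omega>)"
      by (rule compact_uniformly_continuous[OF B_continuous[OF \<omega>]]) simp
    then obtain d where d: "d > 0" "\<And>x y. x \<in> {0..1} \<Longrightarrow> y \<in> {0..1} \<Longrightarrow> \<bar>x - y\<bar> < d \<Longrightarrow> \<bar>B x \<omega> - B y \<omega>\<bar> < e"
      unfolding uniformly_continuous_on_def dist_real_def using e by (metis (no_types, lifting))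
    obtain N :: nat where N: "1 / real (Suc N) < d" using d(1) reals_Archimedean[of d] by (auto simp: inverse_eq_divide)
    show "\<exists>no. \<forall>n\<ge>no. norm (\<Psi> n \<omega> - 0) < r"
    proof (intro exI[of _ N] allI impI)
      fix n assume n: "N \<le> n"
      have "\<bar>\<Psi> n \<omega>\<bar> \<le> C * (L * e)"
      proof (rule \<Psi>b)
        fix k assume k: "k \<le> Suc n" "S n k \<omega> \<noteq> 0"
        \<comment> \<open>The end of the first cell with a zero is within one mesh width of that
          zero; for \<open>k = 0\<close> the zero is \<open>a\<close>.\<close>
        have "\<exists>v\<in>{0..1}. \<bar>T n k - v\<bar> < d \<and> B v \<omega> = 0"
        proof (cases "k = 0")
          case True
          then have "\<omega> \<in> hits a a" using k by (auto simp: S_def T0 indicator_def split: if_splits)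
          then have "B a \<omega> = 0" by (auto simp: hits_def)
          then show ?thesis using True d(1) ab by (intro bexI[of _ a]) (auto simp: T0)
        next
          case False
          then have "\<omega> \<in> hits a (T n k)" "\<omega> \<notin> hits a (T n (k - 1))"
            using k hmono[of n k]
            by (cases "\<omega> \<in> hits a (T n k)"; cases "\<omega> \<in> hits a (T n (k - 1))"; force simp: S_def)+
          then obtain v where v: "v \<in> {a..T n k}" "B v \<omega> = 0" "\<not> v \<le> T n (k - 1)"
            by (auto simp: hits_def)
          have "T n k - T n (k - 1) = (b - a) / Suc n"
            using False by (cases k) (simp_all add: T_def add_divide_distrib distrib_right)
          also have "\<dots> \<le> 1 / Suc n" using ab by (intro divide_right_mono) auto
          also have "\<dots> \<le> 1 / Suc N" using n by (intro divide_left_mono) auto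
          finally have "T n k - T n (k - 1) < d" using N by simp
          then show ?thesis using v Tbd(2)[OF k(1)] ab by (intro bexI[of _ v]) auto
        qed
        then obtain v where "v \<in> {0..1}" "\<bar>T n k - v\<bar> < d" "B v \<omega> = 0" by auto
        then have "\<bar>B (T n k) \<omega>\<bar> \<le> e" using d(2)[of "T n k" v] Tbd(1) Tbd(2)[OF k(1)] by auto
        then have "L * \<bar>B (T n k) \<omega>\<bar> \<le> L * e" using nn(1) by (rule mult_left_mono)
        then show "\<bar>H n k \<omega>\<bar> \<le> L * e" using Hb(2)[of n k \<omega>] by linarith
      qed (use nn e in simp)
      then show "norm (\<Psi> n \<omega> - 0) < r" using CLe by simp
    qed
  qed
  have "(\<lambda>n. expectation (\<Psi> n)) \<longlonglongrightarrow> expectation (\<lambda>\<omega>. 0)"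
  proof (rule integral_dominated_convergence[where w = "\<lambda>_. C * L"])
    show "\<Psi> n \<in> borel_measurable M" for n unfolding \<Psi>_def by (intro borel_measurable_sum borel_measurable_times) auto
    show "AE \<omega> in M. norm (\<Psi> n \<omega>) \<le> C * L" for n using \<Psi>b[of n _ L] Hb(1) nn by (intro AE_I2) auto
    show "AE \<omega> in M. (\<lambda>n. \<Psi> n \<omega>) \<longlonglongrightarrow> 0" using lim by (intro AE_I2) auto
  qed auto
  then show ?thesis unfolding E[symmetric] by (simp add: LIMSEQ_const_iff)
qed

lemma avoids_past: "0 \<le> a \<Longrightarrow> a \<le> b \<Longrightarrow> b \<le> 1 \<Longrightarrow> avoids a b \<in> borel_measurable (past b)"
  by (intro borel_measurable_diff borel_measurable_const borel_measurable_indicator hits_past)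

text \<open>The part of the expectation carried by paths with a zero vanishes, so an odd payoff does
  not see the killing. This is the reflection principle, obtained without a hitting time.\<close>

lemma killed_markov:
  assumes ab: "0 \<le> a" "a \<le> b" "b \<le> 1"
    and X: "X \<in> borel_measurable (past a)" "\<And>\<omega>. \<bar>X \<omega>\<bar> \<le> C"
    and f: "bounded_lipschitz f" "odd_fun f"
  shows "expectation (\<lambda>\<omega>. X \<omega> * f (B b \<omega>) * avoids a b \<omega>) = expectation (\<lambda>\<omega>. X \<omega> * heat (b - a) f (B a \<omega>))"
proof -
  obtain L where L: "\<And>x. \<bar>f x\<bar> \<le> L"
    using f(1) unfolding bounded_lipschitz_def by blast
  note fm [measurable] = bounded_lipschitz_measurable[OF f(1)]
  have [measurable]: "X \<in> borel_measurable M" "B b \<in> borel_measurable M" "hits a b \<in> sets M"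
    using past_measurable[OF _ X(1)] ab by auto
  have b: "\<bar>X \<omega> * f (B b \<omega>)\<bar> \<le> C * L" for \<omega>
    unfolding abs_mult using X(2)[of \<omega>] L[of "B b \<omega>"] by (intro mult_mono) auto
  have "expectation (\<lambda>\<omega>. X \<omega> * f (B b \<omega>) * avoids a b \<omega>)
    = expectation (\<lambda>\<omega>. X \<omega> * f (B b \<omega>)) - expectation (\<lambda>\<omega>. X \<omega> * f (B b \<omega>) * indicator (hits a b) \<omega>)"
    unfolding right_diff_distrib mult_1_right
    by (intro Bochner_Integration.integral_diff integrable_bounded[where C = "C * L"])
      (use b order_trans[OF abs_ge_zero b] in \<open>auto split: split_indicator\<close>)
  then show ?thesis
    using integral_hits_eq_0[OF assms] markov[OF ab X fm L] by simp
qed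

lemma markov3:
  assumes r: "0 \<le> a" "a \<le> r1" "r1 \<le> r2" "r2 \<le> 1"
    and X: "X \<in> borel_measurable (past a)" "\<And>\<omega>. \<bar>X \<omega>\<bar> \<le> C"
    and [measurable]: "f1 \<in> borel_measurable borel" "f2 \<in> borel_measurable borel" "f3 \<in> borel_measurable borel"
    and b: "\<And>x. \<bar>f1 x\<bar> \<le> L1" "\<And>x. \<bar>f2 x\<bar> \<le> L2" "\<And>x. \<bar>f3 x\<bar> \<le> L3"
  shows "expectation (\<lambda>\<omega>. X \<omega> * f1 (B r1 \<omega>) * f2 (B r2 \<omega>) * f3 (B 1 \<omega>)) =
    expectation (\<lambda>\<omega>. X \<omega> * heat (r1 - a) (\<lambda>x. f1 x * heat (r2 - r1) (\<lambda>x. f2 x * heat (1 - r2) f3 x) x) (B a \<omega>))"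
proof -
  have X1: "X \<in> borel_measurable (past r1)" "X \<in> borel_measurable (past r2)"
    using past_mono[OF _ X(1)] r by auto
  have [measurable]: "B r1 \<in> borel_measurable (past r1)" "B r1 \<in> borel_measurable (past r2)" "B r2 \<in> borel_measurable (past r2)"
    using r by (auto intro: B_past)
  have nn: "0 \<le> C" "0 \<le> L1" "0 \<le> L2" 
    using order_trans[OF abs_ge_zero X(2)] order_trans[OF abs_ge_zero b(1)] order_trans[OF abs_ge_zero b(2)] by auto
  have p1: "\<bar>X \<omega> * f1 (B r1 \<omega>)\<bar> \<le> C * L1" for \<omega>
    unfolding abs_mult by (intro mult_mono X b) (use nn in auto)
  have p2: "\<bar>X \<omega> * f1 (B r1 \<omega>) * f2 (B r2 \<omega>)\<bar> \<le> C * L1 * L2" for \<omega>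
    unfolding abs_mult[of _ "f2 _"] by (intro mult_mono p1 b) (use nn in auto)
  have h2: "\<bar>f2 x * heat (1 - r2) f3 x\<bar> \<le> L2 * L3" for x
    unfolding abs_mult by (intro mult_mono b heat_le) (use nn in auto)
  have h1: "\<bar>f1 x * heat (r2 - r1) (\<lambda>x. f2 x * heat (1 - r2) f3 x) x\<bar> \<le> L1 * (L2 * L3)" for x
    unfolding abs_mult by (intro mult_mono b heat_le h2) (use nn in auto)
  have "expectation (\<lambda>\<omega>. X \<omega> * f1 (B r1 \<omega>) * f2 (B r2 \<omega>) * f3 (B 1 \<omega>))
    = expectation (\<lambda>\<omega>. X \<omega> * f1 (B r1 \<omega>) * f2 (B r2 \<omega>) * heat (1 - r2) f3 (B r2 \<omega>))"
    using r X1 by (intro markov[OF _ _ _ _ p2 _ b(3)]) auto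
  also have "\<dots> = expectation (\<lambda>\<omega>. X \<omega> * f1 (B r1 \<omega>) * heat (r2 - r1) (\<lambda>x. f2 x * heat (1 - r2) f3 x) (B r1 \<omega>))"
    using markov[where X = "\<lambda>\<omega>. X \<omega> * f1 (B r1 \<omega>)" and f = "\<lambda>x. f2 x * heat (1 - r2) f3 x" and r = r1 and u = r2, OF _ _ _ _ p1 _ h2]
      r X1 by (simp add: mult.assoc)
  also have "\<dots> = expectation (\<lambda>\<omega>. X \<omega> * heat (r1 - a) (\<lambda>x. f1 x * heat (r2 - r1) (\<lambda>x. f2 x * heat (1 - r2) f3 x) x) (B a \<omega>))"
    using markov[where f = "\<lambda>x. f1 x * heat (r2 - r1) (\<lambda>x. f2 x * heat (1 - r2) f3 x) x", OF _ _ _ X _ h1, of r1] r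
    by (simp add: mult.assoc)
  finally show ?thesis .
qed

lemma avoids_split:
  assumes "a \<le> r" "r \<le> b" shows "avoids a b \<omega> = avoids a r \<omega> * avoids r b \<omega>"
proof -
  have "hits a b = hits a r \<union> hits r b" unfolding hits_def using assms by force
  then show ?thesis by (auto split: split_indicator)
qed

text \<open>Backward over \<open>[r2, 1]\<close>, \<open>[r1, r2]\<close> and
  \<open>[a, r1]\<close>: \<open>heat\<close> keeps the payoff odd and so does an even factor, hence
  the reflection step applies on each piece, the earlier avoidance indicators being part of the past
  weight.\<close>

lemma killed_markov3:
  assumes r: "0 \<le> a" "a \<le> r1" "r1 \<le> r2" "r2 \<le> 1"
    and X: "X \<in> borel_measurable (past a)" "\<And>\<omega>. \<bar>X \<omega>\<bar> \<le> C"
    and f: "bounded_lipschitz f1" "bounded_lipschitz f2" "bounded_lipschitz f3"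
    and even: "\<And>x. f1 (- x) = f1 x" "\<And>x. f2 (- x) = f2 x" and odd: "odd_fun f3"
  shows "expectation (\<lambda>\<omega>. X \<omega> * f1 (B r1 \<omega>) * f2 (B r2 \<omega>) * f3 (B 1 \<omega>) * avoids a 1 \<omega>) =
    expectation (\<lambda>\<omega>. X \<omega> * f1 (B r1 \<omega>) * f2 (B r2 \<omega>) * f3 (B 1 \<omega>))"
proof -
  obtain L1 where b1: "\<And>x. \<bar>f1 x\<bar> \<le> L1" using f unfolding bounded_lipschitz_def by blast
  obtain L2 where b2: "\<And>x. \<bar>f2 x\<bar> \<le> L2" using f unfolding bounded_lipschitz_def by blast
  obtain L3 where b3: "\<And>x. \<bar>f3 x\<bar> \<le> L3" using f unfolding bounded_lipschitz_def by blast
  note fm [measurable] = f[THEN bounded_lipschitz_measurable]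
  have X1: "X \<in> borel_measurable (past r1)" "X \<in> borel_measurable (past r2)"
    using past_mono[OF _ X(1)] r by auto
  have [measurable]: "B r1 \<in> borel_measurable (past r1)" "B r1 \<in> borel_measurable (past r2)" "B r2 \<in> borel_measurable (past r2)"
    using r by (auto intro: B_past)
  have a: "avoids a r1 \<in> borel_measurable (past r1)" "avoids r1 r2 \<in> borel_measurable (past r2)"
    using r by (intro avoids_past; linarith)+
  note a = this past_mono[OF r(3) this(1)]
  have nn: "0 \<le> C" "0 \<le> L1" "0 \<le> L2" 
    using order_trans[OF abs_ge_zero X(2)] order_trans[OF abs_ge_zero b1] order_trans[OF abs_ge_zero b2] by auto
  have ab: "\<bar>avoids u v \<omega>\<bar> \<le> 1" for u v \<omega> by (simp split: split_indicator)
  have p1: "\<bar>X \<omega> * f1 (B r1 \<omega>) * avoids a r1 \<omega>\<bar> \<le> C * L1 * 1" for \<omega>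
    unfolding abs_mult by (intro mult_mono X b1 ab) (use nn in auto)
  have p2: "\<bar>X \<omega> * f1 (B r1 \<omega>) * f2 (B r2 \<omega>) * avoids a r1 \<omega> * avoids r1 r2 \<omega>\<bar> \<le> C * L1 * L2 * 1 * 1" for \<omega>
    unfolding abs_mult by (intro mult_mono X b1 b2 ab) (use nn in auto)
  let ?q3 = "heat (1 - r2) f3"
  let ?q2 = "heat (r2 - r1) (\<lambda>x. f2 x * ?q3 x)"
  note q3 = bounded_lipschitz_mult[OF f(2) bounded_lipschitz_heat[OF f(3)]]
    odd_fun_mult[of f2 ?q3, OF even(2) odd_heat[OF odd]]
  note q2 = bounded_lipschitz_mult[OF f(1) bounded_lipschitz_heat[OF q3(1)]]
    odd_fun_mult[of f1 ?q2, OF even(1) odd_heat[OF q3(2)]]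
  have "expectation (\<lambda>\<omega>. X \<omega> * f1 (B r1 \<omega>) * f2 (B r2 \<omega>) * f3 (B 1 \<omega>) * avoids a 1 \<omega>)
    = expectation (\<lambda>\<omega>. (X \<omega> * f1 (B r1 \<omega>) * f2 (B r2 \<omega>) * avoids a r1 \<omega> * avoids r1 r2 \<omega>) * f3 (B 1 \<omega>) * avoids r2 1 \<omega>)"
  proof (rule Bochner_Integration.integral_cong[OF refl])
    fix \<omega>
    have "avoids a 1 \<omega> = avoids a r1 \<omega> * avoids r1 r2 \<omega> * avoids r2 1 \<omega>"
      using avoids_split[of a r1 1 \<omega>] avoids_split[of r1 r2 1 \<omega>] r by (simp only: mult.assoc)
    then show "X \<omega> * f1 (B r1 \<omega>) * f2 (B r2 \<omega>) * f3 (B 1 \<omega>) * avoids a 1 \<omega> =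
      (X \<omega> * f1 (B r1 \<omega>) * f2 (B r2 \<omega>) * avoids a r1 \<omega> * avoids r1 r2 \<omega>) * f3 (B 1 \<omega>) * avoids r2 1 \<omega>"
      by (simp only: mult.assoc mult.commute mult.left_commute)
  qed
  also have "\<dots> = expectation (\<lambda>\<omega>. (X \<omega> * f1 (B r1 \<omega>) * f2 (B r2 \<omega>) * avoids a r1 \<omega> * avoids r1 r2 \<omega>) * ?q3 (B r2 \<omega>))"
    using r X1 by (intro killed_markov[OF _ _ _ _ p2 f(3) odd] borel_measurable_times a) auto
  also have "\<dots> = expectation (\<lambda>\<omega>. (X \<omega> * f1 (B r1 \<omega>) * avoids a r1 \<omega>) * (f2 (B r2 \<omega>) * ?q3 (B r2 \<omega>)) * avoids r1 r2 \<omega>)"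
    by (simp only: mult.assoc mult.commute mult.left_commute)
  also have "\<dots> = expectation (\<lambda>\<omega>. (X \<omega> * f1 (B r1 \<omega>) * avoids a r1 \<omega>) * ?q2 (B r1 \<omega>))"
    using r X1 by (intro killed_markov[OF _ _ _ _ p1 q3] borel_measurable_times a) auto
  also have "\<dots> = expectation (\<lambda>\<omega>. X \<omega> * (f1 (B r1 \<omega>) * ?q2 (B r1 \<omega>)) * avoids a r1 \<omega>)"
    by (simp only: mult.assoc mult.commute mult.left_commute)
  also have "\<dots> = expectation (\<lambda>\<omega>. X \<omega> * heat (r1 - a) (\<lambda>x. f1 x * ?q2 x) (B a \<omega>))"
    using r by (intro killed_markov[OF _ _ _ X q2]) auto
  also have "\<dots> = expectation (\<lambda>\<omega>. X \<omega> * f1 (B r1 \<omega>) * f2 (B r2 \<omega>) * f3 (B 1 \<omega>))"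
    by (rule markov3[OF r X fm b1 b2 b3, symmetric])
  finally show ?thesis .
qed

end

section \<open>Positivity and behaviour near the origin\<close>

lemma odd_fun_sgn: "odd_fun sgn" by (simp add: odd_fun_def sgn_minus)

lemma abs_sgn_le: "\<bar>sgn (x::real)\<bar> \<le> 1" by (simp add: abs_sgn_eq)

lemma odd_fun_0: "odd_fun f \<Longrightarrow> f 0 = 0"
  unfolding odd_fun_def by (metis add.inverse_neutral equal_neg_zero)

lemma odd_fun_mult_sgn: "odd_fun f \<Longrightarrow> f x = sgn x * f \<bar>x\<bar>"
  using odd_fun_0[of f] unfolding odd_fun_def by (cases "x = 0") (auto simp: sgn_if abs_if)

text \<open>A Lipschitz substitute for \<open>sgn\<close>, whose jump at 0 puts it outside the reach
  of the reflection step.\<close>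

lemma bounded_lipschitz_clamp: "bounded_lipschitz (\<lambda>x. max (- 1) (min 1 (real m * x)))"
proof -
  have "\<bar>max (- 1) (min 1 (real m * x)) - max (- 1) (min 1 (real m * y))\<bar> \<le> (real m + 1) * \<bar>x - y\<bar>" for x y
  proof -
    have "\<bar>max (- 1) (min 1 (real m * x)) - max (- 1) (min 1 (real m * y))\<bar> \<le> \<bar>real m * x - real m * y\<bar>"
    proof -
      have "\<bar>max (- 1) (min 1 u) - max (- 1) (min 1 v)\<bar> \<le> \<bar>u - v\<bar>" for u v :: real
        by (auto simp: max_def min_def abs_if)
      then show ?thesis .
    qed
    also have "\<dots> = real m * \<bar>x - y\<bar>" by (metis abs_mult abs_of_nat right_diff_distrib)
    finally show ?thesis using abs_ge_zero[of "x - y"] unfolding distrib_right mult_1 by linarith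
  qed
  moreover have "\<bar>max (- 1) (min 1 (real m * x))\<bar> \<le> real m + 1" for x by auto
  ultimately show ?thesis unfolding bounded_lipschitz_def by blast
qed

lemma clamp_tendsto_sgn: "(\<lambda>m. max (- 1) (min 1 (real m * x))) \<longlonglongrightarrow> sgn x"
proof (cases "x = 0")
  case False
  obtain N where N: "1 / \<bar>x\<bar> < real N" using reals_Archimedean2 by blast
  have "max (- 1) (min 1 (real m * x)) = sgn x" if "N \<le> m" for m
  proof -
    have "1 / \<bar>x\<bar> < real m" using N that by linarith
    then have "1 < real m * \<bar>x\<bar>" using False by (simp add: field_simps)
    then show ?thesis by (auto simp: sgn_if abs_if split: if_splits)
  qed
  then show ?thesis by (intro tendsto_eventually) (auto simp: eventually_sequentially)
qed simp

text \<open>For \<open>v < 0\<close> an odd function and sinh both change sign, so their product is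
  even in \<open>v\<close> and a comparison on the positive half-line is enough.\<close>

lemma heat_mono_odd:
  assumes [measurable]: "f \<in> borel_measurable borel" "g \<in> borel_measurable borel" 
    and C: "\<And>x. \<bar>f x\<bar> \<le> C" "\<And>x. \<bar>g x\<bar> \<le> D"
    and odd: "odd_fun f" "odd_fun g" and h: "0 \<le> h"
    and le: "\<And>x. 0 \<le> x \<Longrightarrow> f x \<le> g x" and y: "0 \<le> y"
  shows "heat h f y \<le> heat h g y"
proof (cases "h = 0")
  case False
  then have h: "0 < h" using h by auto
  have "(LINT v|lborel. f (sqrt h * v) * sinh (v * (y / sqrt h)) * std_normal_density v) \<le>
    (LINT v|lborel. g (sqrt h * v) * sinh (v * (y / sqrt h)) * std_normal_density v)"
  proof (intro integral_mono integrable_heat_sinh)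
    fix v
    have "f (sqrt h * v) * sinh (v * (y / sqrt h)) \<le> g (sqrt h * v) * sinh (v * (y / sqrt h))"
    proof (cases "0 \<le> v")
      case True then show ?thesis using le[of "sqrt h * v"] h y by (intro mult_right_mono) auto
    next
      case False
      have "f (sqrt h * - v) * sinh (- v * (y / sqrt h)) \<le> g (sqrt h * - v) * sinh (- v * (y / sqrt h))"
      proof (rule mult_right_mono)
        show "f (sqrt h * - v) \<le> g (sqrt h * - v)" using False h by (intro le mult_nonneg_nonneg) auto
        have "0 \<le> - v * (y / sqrt h)" using False h y by (intro mult_nonneg_nonneg) auto
        then show "0 \<le> sinh (- v * (y / sqrt h))" by (simp only: sinh_real_nonneg_iff)
      qed
      then show ?thesis using odd by (simp add: odd_fun_def)
    qed
    then show "f (sqrt h * v) * sinh (v * (y / sqrt h)) * std_normal_density v \<le>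
      g (sqrt h * v) * sinh (v * (y / sqrt h)) * std_normal_density v" by (rule mult_right_mono) simp
  qed (use C in auto)
  then show ?thesis
    unfolding heat_sinh[OF assms(1) C(1) odd(1) h] heat_sinh[OF assms(2) C(2) odd(2) h] by (rule mult_left_mono) simp
qed (use le y in simp)

lemma integral_pos_of_pos:
  fixes f :: "real \<Rightarrow> real"
  assumes i: "integrable lborel f" and "\<And>v. v \<noteq> 0 \<Longrightarrow> 0 < f v" "f 0 = (0::real)"
  shows "0 < (LINT v|lborel. f v)"
proof -
  have nn: "0 \<le> f v" for v using assms(2)[of v] assms(3) by (cases "v = 0") auto
  have "(LINT v|lborel. f v) \<noteq> 0"
  proof
    assume "(LINT v|lborel. f v) = 0"
    then have "AE v in lborel. f v = 0" using integral_nonneg_eq_0_iff_AE[OF i] nn by auto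
    then have "AE v in (lborel :: real measure). False"
      using AE_lborel_singleton[of "0::real"] by (rule eventually_elim2) (use assms(2) in force)
    then show False by (simp add: AE_iff_measurable[where N = UNIV])
  qed
  moreover have "0 \<le> (LINT v|lborel. f v)" using nn by (intro integral_nonneg_AE) auto
  ultimately show ?thesis by linarith
qed

lemma mult_sinh_pos:
  assumes "odd_fun f" "\<And>x. 0 < x \<Longrightarrow> 0 < f x" "0 < z" "v \<noteq> 0" shows "0 < f v * sinh (v * z)"
proof (cases "0 < v")
  case True then show ?thesis using assms by simp
next
  case False
  then have v: "0 < - v" using assms(4) by simp
  then have "0 < - v * z" using assms(3) by (rule mult_pos_pos)
  then have "0 < f (- v) * sinh (- v * z)" using assms(2)[OF v] by (intro mult_pos_pos) (simp_all only: sinh_real_pos_iff)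
  then show ?thesis using assms(1) by (simp add: odd_fun_def)
qed

lemma odd_fun_scale: "odd_fun f \<Longrightarrow> odd_fun (\<lambda>v. f (c * v))"
  by (simp add: odd_fun_def)

lemma heat_pos:
  assumes f [measurable]: "f \<in> borel_measurable borel" and C: "\<And>x. \<bar>f x\<bar> \<le> C" 
    and odd: "odd_fun f" and h: "0 \<le> h" and pos: "\<And>x. 0 < x \<Longrightarrow> 0 < f x" and y: "0 < y"
  shows "0 < heat h f y"
proof (cases "h = 0")
  case False
  then have h: "0 < h" using h by auto
  have "0 < (LINT v|lborel. f (sqrt h * v) * sinh (v * (y / sqrt h)) * std_normal_density v)"
  proof (rule integral_pos_of_pos)
    fix v :: real assume v: "v \<noteq> 0"
    have "0 < f (sqrt h * v) * sinh (v * (y / sqrt h))"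
      using h y v pos by (intro mult_sinh_pos[OF odd_fun_scale[OF odd]]) auto
    then show "0 < f (sqrt h * v) * sinh (v * (y / sqrt h)) * std_normal_density v"
      by (rule mult_pos_pos) (simp add: normal_density_pos)
  next
    show "integrable lborel (\<lambda>v. f (sqrt h * v) * sinh (v * (y / sqrt h)) * std_normal_density v)"
      by (rule integrable_heat_sinh[where C = C]) (auto intro: C)
  qed simp
  then show ?thesis unfolding heat_sinh[OF f C odd h] by simp
qed (use pos y in simp)

lemma abs_sinh_le: "\<bar>sinh x\<bar> \<le> \<bar>x\<bar> * exp \<bar>x :: real\<bar>"
proof -
  have p: "sinh x \<le> x * exp x" if "0 \<le> x" for x :: real
  proof -
    have "sinh x = exp x * ((1 - exp (- 2 * x)) / 2)" by (simp add: sinh_def field_simps flip: exp_add)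
    also have "\<dots> \<le> exp x * x" using exp_ge_add_one_self[of "- 2 * x"] by (intro mult_left_mono) auto
    finally show ?thesis by (simp add: mult.commute)
  qed
  have "\<bar>sinh x\<bar> = sinh \<bar>x\<bar>" by simp
  then show ?thesis using p[of "\<bar>x\<bar>"] by simp
qed

lemma sinh_quotient_tendsto:
  assumes "z \<longlonglongrightarrow> 0" "\<And>n. z n \<noteq> 0"
  shows "(\<lambda>n. sinh (v * z n) / z n) \<longlonglongrightarrow> (v :: real)"
proof -
  have "((\<lambda>z. sinh (v * z)) has_field_derivative v) (at 0)"
    by (auto intro!: derivative_eq_intros)
  then have "((\<lambda>z. sinh (v * z) / z) \<longlongrightarrow> v) (at 0)"
    by (simp add: has_field_derivative_iff)
  then show ?thesis using assms by (auto simp: tendsto_at_iff_sequentially o_def)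
qed

text \<open>Differentiation at the origin along a sequence, under the integral sign: sinh(v z) / z
  tends to v. All dependence on the start point sits in the smooth kernel, so a bounded measurable
  \<open>f\<close> will do.\<close>

lemma heat_quotient_tendsto:
  assumes f [measurable]: "f \<in> borel_measurable borel" and C: "\<And>x. \<bar>f x\<bar> \<le> C" 
    and odd: "odd_fun f" and h: "0 < h" and z: "z \<longlonglongrightarrow> 0" "\<And>n. z n \<noteq> 0"
  shows "(\<lambda>n. heat h f (sqrt h * z n) / z n) \<longlonglongrightarrow> (LINT v|lborel. f (sqrt h * v) * v * std_normal_density v)"
proof -
  obtain Z where Z: "\<And>n. \<bar>z n\<bar> \<le> Z"
    using convergent_imp_Bseq[OF convergentI[OF z(1)]] by (auto simp: Bseq_def)
  have C0: "0 \<le> C" using order_trans[OF abs_ge_zero C] .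
  have lim: "(\<lambda>n. exp (- (z n)\<^sup>2 / 2) * (LINT v|lborel. f (sqrt h * v) * (sinh (v * z n) / z n) * std_normal_density v))
     \<longlonglongrightarrow> exp (- 0\<^sup>2 / 2) * (LINT v|lborel. f (sqrt h * v) * v * std_normal_density v)"
  proof (intro tendsto_mult tendsto_exp tendsto_divide tendsto_minus tendsto_power z(1) tendsto_const
      integral_dominated_convergence[where w = "\<lambda>v. C * (std_normal_density v * exp ((Z + 1) * \<bar>v\<bar>))"])
    show "AE v in lborel. (\<lambda>n. f (sqrt h * v) * (sinh (v * z n) / z n) * std_normal_density v) \<longlonglongrightarrow> f (sqrt h * v) * v * std_normal_density v"
      by (intro AE_I2 tendsto_intros sinh_quotient_tendsto z)
    fix n
    show "AE v in lborel. norm (f (sqrt h * v) * (sinh (v * z n) / z n) * std_normal_density v)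
      \<le> C * (std_normal_density v * exp ((Z + 1) * \<bar>v\<bar>))"
    proof (rule AE_I2)
      fix v
      have "\<bar>sinh (v * z n) / z n\<bar> \<le> \<bar>v\<bar> * exp (\<bar>v * z n\<bar>)"
        using abs_sinh_le[of "v * z n"] z(2)[of n] by (simp add: abs_mult field_simps)
      \<comment> \<open>The factor \<bar>v\<bar> is absorbed by one more exponential, which explains
        \<open>Z + 1\<close> in the dominating function.\<close>
      also have "\<dots> \<le> exp \<bar>v\<bar> * exp (\<bar>v\<bar> * Z)"
        using exp_ge_add_one_self[of "\<bar>v\<bar>"] Z[of n] by (intro mult_mono) (auto simp: abs_mult mult_left_mono simp del: exp_ge_add_one_self)
      also have "\<dots> = exp ((Z + 1) * \<bar>v\<bar>)" by (simp add: algebra_simps flip: exp_add)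
      finally have "\<bar>f (sqrt h * v)\<bar> * \<bar>sinh (v * z n) / z n\<bar> * std_normal_density v \<le> C * exp ((Z + 1) * \<bar>v\<bar>) * std_normal_density v"
        using C0 C by (intro mult_mono) auto
      then show "norm (f (sqrt h * v) * (sinh (v * z n) / z n) * std_normal_density v)
        \<le> C * (std_normal_density v * exp ((Z + 1) * \<bar>v\<bar>))"
        by (simp add: abs_mult mult.commute mult.left_commute)
    qed
  qed (auto intro!: integrable_mult_right integrable_normal_exp_abs)
  have eq: "exp (- (z n)\<^sup>2 / 2) * (LINT v|lborel. f (sqrt h * v) * (sinh (v * z n) / z n) * std_normal_density v)
     = heat h f (sqrt h * z n) / z n" for n
  proof -
    have "(LINT v|lborel. f (sqrt h * v) * (sinh (v * z n) / z n) * std_normal_density v)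
      = (LINT v|lborel. f (sqrt h * v) * sinh (v * z n) * std_normal_density v) / z n"
      unfolding integral_divide_zero[symmetric] by simp
    then show ?thesis using h by (simp add: heat_sinh[OF f C odd h])
  qed
  show ?thesis using lim unfolding eq by simp
qed

text \<open>Evenness lets the absolute value in the meander be dropped; values in [0, 1] keep every
  kernel below the one for the constant 1. The class still contains enough cutoffs to determine a
  law on the quadrant.\<close>

definition test_fun :: "(real \<Rightarrow> real) \<Rightarrow> bool" where
  "test_fun f \<longleftrightarrow> bounded_lipschitz f \<and> (\<forall>x. f (- x) = f x) \<and> (\<forall>x. 0 \<le> f x \<and> f x \<le> 1)"

lemma test_funD:
  assumes "test_fun f"
  shows "bounded_lipschitz f" "f (- x) = f x" "0 \<le> f x" "f x \<le> 1" "\<bar>f x\<bar> \<le> 1" "f \<in> borel_measurable borel"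
  using assms bounded_lipschitz_measurable by (auto simp: test_fun_def)

lemma test_fun_1: "test_fun (\<lambda>_. 1)"
  unfolding test_fun_def bounded_lipschitz_def by (auto intro!: exI[of _ 1])

text \<open>For \<open>y > 0\<close>, \<open>kern s t f1 f2 y\<close> is the integral of \<open>f1\<close> at time \<open>s\<close> times \<open>f2\<close> at time \<open>t\<close> for a
  Brownian motion from \<open>y\<close> killed at 0 before time 1: the factor \<open>sgn\<close> at time 1 makes the payoff odd, so
  that the unkilled motion can be used instead. \<open>entrance\<close> is, up to a factor, its derivative at \<open>y = 0\<close>.\<close>

definition kern2 :: "real \<Rightarrow> real \<Rightarrow> (real \<Rightarrow> real) \<Rightarrow> real \<Rightarrow> real" where
  "kern2 s t f2 = heat (t - s) (\<lambda>x. f2 x * heat (1 - t) sgn x)"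

definition kern :: "real \<Rightarrow> real \<Rightarrow> (real \<Rightarrow> real) \<Rightarrow> (real \<Rightarrow> real) \<Rightarrow> real \<Rightarrow> real" where
  "kern s t f1 f2 = heat s (\<lambda>x. f1 x * kern2 s t f2 x)"

definition entrance :: "real \<Rightarrow> real \<Rightarrow> (real \<Rightarrow> real) \<Rightarrow> (real \<Rightarrow> real) \<Rightarrow> real" where
  "entrance s t f1 f2 = (LINT v|lborel. (f1 (sqrt s * v) * kern2 s t f2 (sqrt s * v)) * v * std_normal_density v)"

lemma sgn_borel [measurable]: "sgn \<in> borel_measurable (borel :: real measure)"
  by (rule borel_measurable_sgn)

lemma heat_nonneg_odd:
  assumes f: "f \<in> borel_measurable borel" "\<And>x. \<bar>f x\<bar> \<le> C" "odd_fun f" and h: "0 \<le> h"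
    and nn: "\<And>x. 0 \<le> x \<Longrightarrow> 0 \<le> f x" and y: "0 \<le> y"
  shows "0 \<le> heat h f y"
proof -
  have "heat h (\<lambda>_. 0) y \<le> heat h f y"
    by (rule heat_mono_odd[OF _ f(1) _ f(2) _ f(3) h nn y, of 0]) (auto simp: odd_fun_def)
  then show ?thesis by (simp add: heat_def)
qed

lemma heat_sgn_measurable: "heat h sgn \<in> borel_measurable borel"
  by (rule borel_measurable_heat[OF sgn_borel])

section \<open>Kernels for two fixed times\<close>

locale times =
  fixes s t :: real assumes st: "0 < s" "s < t" "t \<le> 1"
begin

lemma kern2_measurable [measurable]: "f2 \<in> borel_measurable borel \<Longrightarrow> kern2 s t f2 \<in> borel_measurable borel"
  unfolding kern2_def by (intro borel_measurable_heat borel_measurable_times heat_sgn_measurable)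

lemma abs_mult_le_1: "\<bar>a\<bar> \<le> 1 \<Longrightarrow> \<bar>b\<bar> \<le> 1 \<Longrightarrow> \<bar>a * b :: real\<bar> \<le> 1"
  by (simp add: abs_mult mult_le_one)

lemma heat_sgn: "\<bar>heat h sgn x\<bar> \<le> 1" "odd_fun (heat h sgn)"
  by (auto intro!: heat_le odd_heat odd_fun_sgn simp: abs_sgn_le)

lemma heat_sgn_pos: "0 < x \<Longrightarrow> 0 < heat (1 - t) sgn x"
  using st by (intro heat_pos[where C = 1]) (auto simp: abs_sgn_le odd_fun_sgn)

lemma heat_sgn_nonneg: "0 \<le> x \<Longrightarrow> 0 \<le> heat (1 - t) sgn x"
  using heat_sgn_pos[of x] odd_fun_0[OF heat_sgn(2)] by (cases "x = 0") auto

context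
  fixes f2 assumes f2: "test_fun f2"
begin

lemma kern2_integrand:
  "odd_fun (\<lambda>x. f2 x * heat (1 - t) sgn x)" "\<bar>f2 x * heat (1 - t) sgn x\<bar> \<le> 1"
  "(\<lambda>x. f2 x * heat (1 - t) sgn x) \<in> borel_measurable borel"
  using test_funD[OF f2] by (auto intro!: odd_fun_mult heat_sgn abs_mult_le_1 borel_measurable_heat)

lemma kern2: "odd_fun (kern2 s t f2)" "\<bar>kern2 s t f2 x\<bar> \<le> 1" 
  unfolding kern2_def by (auto intro!: odd_heat heat_le kern2_integrand)

lemma kern2_nonneg: "0 \<le> x \<Longrightarrow> 0 \<le> kern2 s t f2 x"
  unfolding kern2_def
  using st test_funD(3)[OF f2] heat_sgn_nonneg
  by (intro heat_nonneg_odd[OF kern2_integrand(3,2,1)]) auto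

lemma kern2_le: 
  assumes "0 \<le> x" shows "kern2 s t f2 x \<le> kern2 s t (\<lambda>_. 1) x"
  unfolding kern2_def
proof (rule heat_mono_odd[OF kern2_integrand(3) _ kern2_integrand(2), where D = 1])
  fix x :: real assume "0 \<le> x"
  then show "f2 x * heat (1 - t) sgn x \<le> 1 * heat (1 - t) sgn x"
    using test_funD(4)[OF f2] heat_sgn_nonneg by (intro mult_right_mono) auto
qed (use st assms in \<open>auto simp: heat_sgn kern2_integrand\<close>)

end

lemma kern2_1_pos: "0 < x \<Longrightarrow> 0 < kern2 s t (\<lambda>_. 1) x"
  unfolding kern2_def using st heat_sgn_pos
  by (intro heat_pos[where C = 1]) (auto simp: heat_sgn)

context
  fixes f1 f2 assumes f1: "test_fun f1" and f2: "test_fun f2"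
begin

lemma kern_integrand:
  "odd_fun (\<lambda>x. f1 x * kern2 s t f2 x)" "\<bar>f1 x * kern2 s t f2 x\<bar> \<le> 1"
  "(\<lambda>x. f1 x * kern2 s t f2 x) \<in> borel_measurable borel"
  using test_funD[OF f1] test_funD(6)[OF f2]
  by (auto intro!: odd_fun_mult kern2[OF f2] abs_mult_le_1 kern2_measurable borel_measurable_times)

lemma kern: "odd_fun (kern s t f1 f2)" "\<bar>kern s t f1 f2 x\<bar> \<le> 1" "kern s t f1 f2 \<in> borel_measurable borel"
  unfolding kern_def by (auto intro!: odd_heat heat_le kern_integrand borel_measurable_heat)

lemma kern_nonneg: "0 \<le> x \<Longrightarrow> 0 \<le> kern s t f1 f2 x"
  unfolding kern_def
  using st test_funD(3)[OF f1] kern2_nonneg[OF f2]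
  by (intro heat_nonneg_odd[OF kern_integrand(3,2,1)]) auto

lemma kern_le: "0 \<le> x \<Longrightarrow> kern s t f1 f2 x \<le> kern s t (\<lambda>_. 1) (\<lambda>_. 1) x"
  unfolding kern_def
proof (rule heat_mono_odd[OF kern_integrand(3) _ kern_integrand(2), where D = 1])
  fix x :: real assume x: "0 \<le> x"
  have "f1 x * kern2 s t f2 x \<le> 1 * kern2 s t (\<lambda>_. 1) x"
    using test_funD[OF f1] kern2_nonneg[OF f2 x] kern2_le[OF f2 x] by (intro mult_mono) auto
  then show "f1 x * kern2 s t f2 x \<le> 1 * kern2 s t (\<lambda>_. 1) x" .
qed (use st in \<open>auto simp: kern2[OF test_fun_1] kern_integrand\<close>)

end

lemma kern_1_pos: "0 < x \<Longrightarrow> 0 < kern s t (\<lambda>_. 1) (\<lambda>_. 1) x"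
  unfolding kern_def using st kern2_1_pos
  by (intro heat_pos[where C = 1]) (auto simp: kern2[OF test_fun_1])

lemma kern_1_eq_0: "kern s t (\<lambda>_. 1) (\<lambda>_. 1) y = 0 \<longleftrightarrow> y = 0"
proof
  assume k: "kern s t (\<lambda>_. 1) (\<lambda>_. 1) y = 0"
  have "y = 0 \<or> kern s t (\<lambda>_. 1) (\<lambda>_. 1) \<bar>y\<bar> = 0"
    using k unfolding odd_fun_mult_sgn[OF kern(1)[OF test_fun_1 test_fun_1], of y] mult_eq_0_iff sgn_0_0 .
  then show "y = 0" using kern_1_pos[of "\<bar>y\<bar>"] by (cases "y = 0") auto
qed (simp add: odd_fun_0[OF kern(1)[OF test_fun_1 test_fun_1]])

lemma integrable_entrance:
  assumes f: "test_fun f1" "test_fun f2"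
  shows "integrable lborel (\<lambda>v. (f1 (sqrt s * v) * kern2 s t f2 (sqrt s * v)) * v * std_normal_density v)"
proof -
  note ki = kern_integrand[OF f]
  note [measurable] = test_funD(6)[OF f(1)] test_funD(6)[OF f(2)]
  have "integrable lborel (\<lambda>v. 1 * (std_normal_density v * exp (1 * \<bar>v\<bar>)))"
    by (intro integrable_mult_right integrable_normal_exp_abs)
  then show ?thesis
  proof (rule Bochner_Integration.integrable_bound)
    show "AE v in lborel. norm (f1 (sqrt s * v) * kern2 s t f2 (sqrt s * v) * v * std_normal_density v) \<le> norm (1 * (std_normal_density v * exp (1 * \<bar>v\<bar>)))"
    proof (rule AE_I2)
      fix v :: real
      have "\<bar>v\<bar> \<le> exp \<bar>v\<bar>" using exp_ge_add_one_self[of "\<bar>v\<bar>"] by linarith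
      then have "\<bar>f1 (sqrt s * v) * kern2 s t f2 (sqrt s * v)\<bar> * \<bar>v\<bar> * std_normal_density v \<le> 1 * exp \<bar>v\<bar> * std_normal_density v"
        using ki(2) by (intro mult_mono) auto
      then show "norm (f1 (sqrt s * v) * kern2 s t f2 (sqrt s * v) * v * std_normal_density v) \<le> norm (1 * (std_normal_density v * exp (1 * \<bar>v\<bar>)))"
        by (simp add: abs_mult mult.commute)
    qed
    have [measurable]: "(\<lambda>x. f1 x * kern2 s t f2 x) \<in> borel_measurable borel" by (rule ki(3))
    show "(\<lambda>v. f1 (sqrt s * v) * kern2 s t f2 (sqrt s * v) * v * std_normal_density v) \<in> borel_measurable lborel"
      using measurable_compose[of "\<lambda>v. sqrt s * v" borel borel "\<lambda>x. f1 x * kern2 s t f2 x", OF _ ki(3)] by measurable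
  qed
qed

lemma entrance_1_pos: "0 < entrance s t (\<lambda>_. 1) (\<lambda>_. 1)"
  unfolding entrance_def
proof (rule integral_pos_of_pos)
  fix v :: real assume v: "v \<noteq> 0"
  have "0 < kern2 s t (\<lambda>_. 1) (sqrt s * \<bar>v\<bar>)" using v st by (intro kern2_1_pos) auto
  then have "0 < kern2 s t (\<lambda>_. 1) (sqrt s * v) * v"
    using v kern2(1)[OF test_fun_1] by (cases "0 < v") (auto simp: odd_fun_def mult_neg_neg)
  then have "0 < kern2 s t (\<lambda>_. 1) (sqrt s * v) * v * std_normal_density v"
    by (rule mult_pos_pos) (simp add: normal_density_pos)
  then show "0 < 1 * kern2 s t (\<lambda>_. 1) (sqrt s * v) * v * std_normal_density v" by simp
qed (use integrable_entrance[OF test_fun_1 test_fun_1] in auto)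

text \<open>For \<open>y > 0\<close> this is the expectation of \<open>f1\<close> and
  \<open>f2\<close> at times \<open>s\<close> and \<open>t\<close> for a Brownian motion from
  \<open>y\<close> conditioned to avoid 0 up to time 1. At \<open>y = 0\<close> both kernels vanish
  and division by zero gives 0.\<close>

definition kern_ratio :: "(real \<Rightarrow> real) \<Rightarrow> (real \<Rightarrow> real) \<Rightarrow> real \<Rightarrow> real" where
  "kern_ratio f1 f2 y = kern s t f1 f2 y / kern s t (\<lambda>_. 1) (\<lambda>_. 1) y"

context
  fixes f1 f2 assumes f: "test_fun f1" "test_fun f2"
begin

lemma kern_ratio_measurable [measurable]: "kern_ratio f1 f2 \<in> borel_measurable borel"
  using kern(3)[OF f] kern(3)[OF test_fun_1 test_fun_1] unfolding kern_ratio_def by measurable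

text \<open>Odd kernels have an even quotient, so their comparison on the positive half-line bounds
  it everywhere.\<close>

lemma kern_ratio_le: "\<bar>kern_ratio f1 f2 y\<bar> \<le> 1"
proof -
  have a: "\<bar>kern s t g1 g2 y\<bar> = kern s t g1 g2 \<bar>y\<bar>" if "test_fun g1" "test_fun g2" for g1 g2
    using odd_fun_mult_sgn[OF kern(1)[OF that], of y] kern_nonneg[OF that, of "\<bar>y\<bar>"] odd_fun_0[OF kern(1)[OF that]]
    by (cases "y = 0") (auto simp: abs_mult abs_sgn_eq)
  show ?thesis unfolding kern_ratio_def abs_divide a[OF f] a[OF test_fun_1 test_fun_1]
    using kern_le[OF f, of "\<bar>y\<bar>"] kern_nonneg[OF test_fun_1 test_fun_1, of "\<bar>y\<bar>"]
    unfolding divide_le_eq_1 by linarith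
qed

lemma kern_eq_ratio: "kern s t f1 f2 y = kern_ratio f1 f2 y * kern s t (\<lambda>_. 1) (\<lambda>_. 1) y"
  using kern_1_eq_0[of y] odd_fun_0[OF kern(1)[OF f]] by (cases "y = 0") (auto simp: kern_ratio_def)

lemma kern_ratio_tendsto:
  assumes y: "y \<longlonglongrightarrow> 0" "\<And>n. y n \<noteq> 0"
  shows "(\<lambda>n. kern_ratio f1 f2 (y n)) \<longlonglongrightarrow> entrance s t f1 f2 / entrance s t (\<lambda>_. 1) (\<lambda>_. 1)"
proof -
  define z where "z n = y n / sqrt s" for n
  have z: "z \<longlonglongrightarrow> 0" "\<And>n. z n \<noteq> 0"
    using tendsto_divide[OF y(1) tendsto_const[of "sqrt s"]] y(2) st by (auto simp: z_def[abs_def])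
  have q: "(\<lambda>n. kern s t g1 g2 (sqrt s * z n) / z n) \<longlonglongrightarrow> entrance s t g1 g2" if g: "test_fun g1" "test_fun g2" for g1 g2
    unfolding kern_def entrance_def
    by (rule heat_quotient_tendsto[OF kern_integrand(3)[OF g] kern_integrand(2)[OF g] kern_integrand(1)[OF g] st(1) z])
  have "(\<lambda>n. (kern s t f1 f2 (sqrt s * z n) / z n) / (kern s t (\<lambda>_. 1) (\<lambda>_. 1) (sqrt s * z n) / z n))
    \<longlonglongrightarrow> entrance s t f1 f2 / entrance s t (\<lambda>_. 1) (\<lambda>_. 1)"
    using entrance_1_pos by (intro tendsto_divide q f test_fun_1) auto
  then show ?thesis using z(2) st by (simp add: kern_ratio_def z_def)
qed

end

end

context brownian begin

text \<open>Dominated convergence carries the identity from the clamped payoffs to their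
  discontinuous limit \<open>sgn\<close>.\<close>

lemma killed_sgn:
  assumes r: "0 \<le> a" "a \<le> r1" "r1 \<le> r2" "r2 \<le> 1"
    and X: "X \<in> borel_measurable (past a)" "\<And>\<omega>. \<bar>X \<omega>\<bar> \<le> C"
    and f: "bounded_lipschitz f1" "bounded_lipschitz f2"
    and even: "\<And>x. f1 (- x) = f1 x" "\<And>x. f2 (- x) = f2 x"
  shows "expectation (\<lambda>\<omega>. X \<omega> * f1 (B r1 \<omega>) * f2 (B r2 \<omega>) * sgn (B 1 \<omega>) * avoids a 1 \<omega>) =
    expectation (\<lambda>\<omega>. X \<omega> * f1 (B r1 \<omega>) * f2 (B r2 \<omega>) * sgn (B 1 \<omega>))" (is "?A = ?B")
proof -
  obtain L1 where b1: "\<And>x. \<bar>f1 x\<bar> \<le> L1" using f unfolding bounded_lipschitz_def by blast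
  obtain L2 where b2: "\<And>x. \<bar>f2 x\<bar> \<le> L2" using f unfolding bounded_lipschitz_def by blast
  note fm [measurable] = f[THEN bounded_lipschitz_measurable]
  have [measurable]: "X \<in> borel_measurable M" "B r1 \<in> borel_measurable M" "B r2 \<in> borel_measurable M"
      "B 1 \<in> borel_measurable M" "hits a 1 \<in> sets M"
    using past_measurable[OF _ X(1)] r by auto
  have nn: "0 \<le> C" "0 \<le> L1" "0 \<le> L2" 
    using order_trans[OF abs_ge_zero X(2)] order_trans[OF abs_ge_zero b1] order_trans[OF abs_ge_zero b2] by auto
  define c where "c m x = max (- 1) (min 1 (real m * x))" for m x
  have c: "\<bar>c m x\<bar> \<le> 1" for m x by (auto simp: c_def)
  have [measurable]: "c m \<in> borel_measurable borel" for m unfolding c_def by measurable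
  have ab: "\<bar>avoids u v \<omega>\<bar> \<le> 1" for u v \<omega> by (simp split: split_indicator)
  have p: "\<bar>X \<omega> * f1 (B r1 \<omega>) * f2 (B r2 \<omega>) * c m (B 1 \<omega>) * avoids a 1 \<omega>\<bar> \<le> C * L1 * L2 * 1 * 1"
     "\<bar>X \<omega> * f1 (B r1 \<omega>) * f2 (B r2 \<omega>) * c m (B 1 \<omega>)\<bar> \<le> C * L1 * L2 * 1" for m \<omega>
    unfolding abs_mult by (intro mult_mono X b1 b2 ab c; use nn in auto)+
  have lim: "(\<lambda>m. c m x) \<longlonglongrightarrow> sgn x" for x unfolding c_def by (rule clamp_tendsto_sgn)
  have A: "(\<lambda>m. expectation (\<lambda>\<omega>. X \<omega> * f1 (B r1 \<omega>) * f2 (B r2 \<omega>) * c m (B 1 \<omega>) * avoids a 1 \<omega>)) \<longlonglongrightarrow> ?A"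
  proof (rule integral_dominated_convergence[where w = "\<lambda>_. C * L1 * L2 * 1 * 1"])
    show "AE \<omega> in M. norm (X \<omega> * f1 (B r1 \<omega>) * f2 (B r2 \<omega>) * c m (B 1 \<omega>) * avoids a 1 \<omega>) \<le> C * L1 * L2 * 1 * 1" for m
      using p(1)[of _ m] by (intro AE_I2) (simp only: real_norm_def)
  qed (auto intro!: AE_I2 tendsto_mult lim)
  have B: "(\<lambda>m. expectation (\<lambda>\<omega>. X \<omega> * f1 (B r1 \<omega>) * f2 (B r2 \<omega>) * c m (B 1 \<omega>))) \<longlonglongrightarrow> ?B"
  proof (rule integral_dominated_convergence[where w = "\<lambda>_. C * L1 * L2 * 1"])
    show "AE \<omega> in M. norm (X \<omega> * f1 (B r1 \<omega>) * f2 (B r2 \<omega>) * c m (B 1 \<omega>)) \<le> C * L1 * L2 * 1" for m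
      using p(2)[of _ m] by (intro AE_I2) (simp only: real_norm_def)
  qed (auto intro!: AE_I2 tendsto_mult lim)
  have "odd_fun (c m)" for m unfolding c_def odd_fun_def by (auto simp: max_def min_def)
  then have "expectation (\<lambda>\<omega>. X \<omega> * f1 (B r1 \<omega>) * f2 (B r2 \<omega>) * c m (B 1 \<omega>) * avoids a 1 \<omega>)
    = expectation (\<lambda>\<omega>. X \<omega> * f1 (B r1 \<omega>) * f2 (B r2 \<omega>) * c m (B 1 \<omega>))" for m
    using bounded_lipschitz_clamp[of m] even unfolding c_def[abs_def]
    by (intro killed_markov3[OF r X f]) auto
  then show ?thesis using LIMSEQ_unique[OF A] B by simp
qed

text \<open>By the intermediate value theorem a path without zeros keeps its sign. The avoidance
  indicator can therefore be multiplied by the odd payoff \<open>sgn (B 1 \<omega>)\<close> at the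
  price of a factor \<open>sgn (B a \<omega>)\<close>, which belongs to the past.\<close>

lemma avoids_sgn:
  assumes "0 \<le> a" "a \<le> 1" "\<omega> \<in> space M"
  shows "sgn (B a \<omega>) * sgn (B 1 \<omega>) * avoids a 1 \<omega> = avoids a 1 \<omega>"
proof (cases "\<omega> \<in> hits a 1")
  case False
  have c: "continuous_on {a..1} (\<lambda>r. B r \<omega>)"
    by (rule continuous_on_subset[OF B_continuous[OF assms(3)]]) (use assms in auto)
  have z: "B v \<omega> \<noteq> 0" if "v \<in> {a..1}" for v using False that assms(3) by (auto simp: hits_def)
  have "\<not> (B a \<omega> \<le> 0 \<and> 0 \<le> B 1 \<omega>)"
  proof
    assume "B a \<omega> \<le> 0 \<and> 0 \<le> B 1 \<omega>"
    then obtain x where "a \<le> x" "x \<le> 1" "B x \<omega> = 0"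
      using IVT'[of "\<lambda>r. B r \<omega>" a 0 1] c assms by auto
    then show False using z by auto
  qed
  moreover have "\<not> (B 1 \<omega> \<le> 0 \<and> 0 \<le> B a \<omega>)"
  proof
    assume "B 1 \<omega> \<le> 0 \<and> 0 \<le> B a \<omega>"
    then obtain x where "a \<le> x" "x \<le> 1" "B x \<omega> = 0"
      using IVT2'[of "\<lambda>r. B r \<omega>" 1 0 a] c assms by auto
    then show False using z by auto
  qed
  ultimately have "sgn (B a \<omega>) * sgn (B 1 \<omega>) = 1" by (auto simp: sgn_if)
  then show ?thesis by simp
qed simp

text \<open>The observation times are those of the meander with its last zero replaced by
  \<open>a\<close>. Once \<open>avoids_sgn\<close> has made the payoff odd the killing drops out,
  and scaling by \<open>sqrt \<Delta>\<close> removes \<open>a\<close> from the kernel, leaving it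
  only in the start value.\<close>

lemma killed_kern:
  assumes st: "times s t" and a: "0 \<le> a" "a < 1" and \<Delta>: "\<Delta> = 1 - a"
    and X: "X \<in> borel_measurable (past a)" "\<And>\<omega>. \<bar>X \<omega>\<bar> \<le> C"
    and f: "test_fun f1" "test_fun f2"
  shows "expectation (\<lambda>\<omega>. X \<omega> * f1 (B (a + s * \<Delta>) \<omega> / sqrt \<Delta>) * f2 (B (a + t * \<Delta>) \<omega> / sqrt \<Delta>) * avoids a 1 \<omega>)
    = expectation (\<lambda>\<omega>. X \<omega> * sgn (B a \<omega>) * kern s t f1 f2 (B a \<omega> / sqrt \<Delta>))"
proof -
  interpret times s t by fact
  have \<Delta>0: "0 < \<Delta>" using a \<Delta> by simp
  define g1 where "g1 x = f1 (x / sqrt \<Delta>)" for x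
  define g2 where "g2 x = f2 (x / sqrt \<Delta>)" for x
  have bl: "bounded_lipschitz (\<lambda>x. f (x / sqrt \<Delta>))" if tf: "test_fun f" for f
  proof -
    obtain L where L: "\<And>x y. \<bar>f x - f y\<bar> \<le> L * \<bar>x - y\<bar>" "\<And>x. \<bar>f x\<bar> \<le> L"
      using test_funD(1)[OF tf] unfolding bounded_lipschitz_def by blast
    have L0: "0 \<le> L" using order_trans[OF abs_ge_zero L(2)] .
    \<comment> \<open>Since \<open>\<Delta> \<le> 1\<close>, division by its root only enlarges the
      constant, so the new one bounds both the slope and the values.\<close>
    have L': "L \<le> L / sqrt \<Delta>"
      using L0 \<Delta> a \<Delta>0 by (simp add: le_divide_eq mult_left_le)
    have "\<bar>f (x / sqrt \<Delta>) - f (y / sqrt \<Delta>)\<bar> \<le> L / sqrt \<Delta> * \<bar>x - y\<bar>" for x y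
      using L(1)[of "x / sqrt \<Delta>" "y / sqrt \<Delta>"] \<Delta>0 by (simp add: diff_divide_distrib[symmetric] abs_divide)
    moreover have "\<bar>f (x / sqrt \<Delta>)\<bar> \<le> L / sqrt \<Delta>" for x
      using L(2) L' order_trans by blast
    ultimately show ?thesis unfolding bounded_lipschitz_def by blast
  qed
  have g: "bounded_lipschitz g1" "bounded_lipschitz g2" using bl[OF f(1)] bl[OF f(2)] by (auto simp: g1_def[abs_def] g2_def[abs_def])
  note gm = g[THEN bounded_lipschitz_measurable]
  have gb: "\<bar>g1 x\<bar> \<le> 1" "\<bar>g2 x\<bar> \<le> 1" for x using test_funD(5)[OF f(1)] test_funD(5)[OF f(2)] by (auto simp: g1_def g2_def)
  have ge: "g1 (- x) = g1 x" "g2 (- x) = g2 x" for x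
    using test_funD(2)[OF f(1), of "x / sqrt \<Delta>"] test_funD(2)[OF f(2), of "x / sqrt \<Delta>"] by (auto simp: g1_def g2_def)
  have r: "0 \<le> a" "a \<le> a + s * \<Delta>" "a + s * \<Delta> \<le> a + t * \<Delta>" "a + t * \<Delta> \<le> 1"
  proof -
    show "a + t * \<Delta> \<le> 1" using mult_right_mono[OF st(3), of \<Delta>] \<Delta>0 \<Delta> by linarith
  qed (use a st \<Delta>0 in \<open>auto intro!: mult_right_mono\<close>)
  define Y where "Y \<omega> = X \<omega> * sgn (B a \<omega>)" for \<omega>
  have Y: "Y \<in> borel_measurable (past a)" "\<And>\<omega>. \<bar>Y \<omega>\<bar> \<le> C"
  proof -
    have [measurable]: "B a \<in> borel_measurable (past a)" using a by (intro B_past) auto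
    show "Y \<in> borel_measurable (past a)" unfolding Y_def using X(1) by measurable
    have "0 \<le> C" using order_trans[OF abs_ge_zero X(2)] .
    then show "\<bar>Y \<omega>\<bar> \<le> C" for \<omega>
      using mult_mono[OF X(2)[of \<omega>] abs_sgn_le[of "B a \<omega>"]] by (simp add: Y_def abs_mult)
  qed
  have "expectation (\<lambda>\<omega>. X \<omega> * g1 (B (a + s * \<Delta>) \<omega>) * g2 (B (a + t * \<Delta>) \<omega>) * avoids a 1 \<omega>)
    = expectation (\<lambda>\<omega>. Y \<omega> * g1 (B (a + s * \<Delta>) \<omega>) * g2 (B (a + t * \<Delta>) \<omega>) * sgn (B 1 \<omega>) * avoids a 1 \<omega>)"
  proof (rule Bochner_Integration.integral_cong[OF refl])
    fix \<omega> assume "\<omega> \<in> space M"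
    then have e: "avoids a 1 \<omega> = sgn (B a \<omega>) * sgn (B 1 \<omega>) * avoids a 1 \<omega>" using avoids_sgn[of a \<omega>] a by simp
    show "X \<omega> * g1 (B (a + s * \<Delta>) \<omega>) * g2 (B (a + t * \<Delta>) \<omega>) * avoids a 1 \<omega> =
      Y \<omega> * g1 (B (a + s * \<Delta>) \<omega>) * g2 (B (a + t * \<Delta>) \<omega>) * sgn (B 1 \<omega>) * avoids a 1 \<omega>"
      unfolding Y_def by (subst e) (simp only: ac_simps)
  qed
  also have "\<dots> = expectation (\<lambda>\<omega>. Y \<omega> * g1 (B (a + s * \<Delta>) \<omega>) * g2 (B (a + t * \<Delta>) \<omega>) * sgn (B 1 \<omega>))"
    by (rule killed_sgn[OF r Y g ge])
  also have "\<dots> = expectation (\<lambda>\<omega>. Y \<omega> * heat (a + s * \<Delta> - a) (\<lambda>x. g1 x * heat (a + t * \<Delta> - (a + s * \<Delta>)) (\<lambda>x. g2 x * heat (1 - (a + t * \<Delta>)) sgn x) x) (B a \<omega>))"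
    by (rule markov3[OF r Y gm _ gb]) (auto simp: abs_sgn_le)
  also have "heat (a + s * \<Delta> - a) (\<lambda>x. g1 x * heat (a + t * \<Delta> - (a + s * \<Delta>)) (\<lambda>x. g2 x * heat (1 - (a + t * \<Delta>)) sgn x) x)
    = (\<lambda>y. kern s t f1 f2 (y / sqrt \<Delta>))"
  proof -
    \<comment> \<open>\<open>sgn\<close> is invariant under positive scaling, so the payoff at time
      1 rescales like the test functions.\<close>
    have "heat (1 - (a + t * \<Delta>)) sgn = heat ((1 - t) * \<Delta>) (\<lambda>x. sgn (x / sqrt \<Delta>))"
      using \<Delta>0 by (simp add: \<Delta> algebra_simps sgn_divide)
    then have h3: "heat (1 - (a + t * \<Delta>)) sgn x = heat (1 - t) sgn (x / sqrt \<Delta>)" for x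
      using heat_scale[OF \<Delta>0, of "1 - t" sgn] by simp
    have e2: "a + t * \<Delta> - (a + s * \<Delta>) = (t - s) * \<Delta>" "a + s * \<Delta> - a = s * \<Delta>" by (auto simp: algebra_simps)
    have h2: "heat ((t - s) * \<Delta>) (\<lambda>x. g2 x * heat (1 - (a + t * \<Delta>)) sgn x) x = kern2 s t f2 (x / sqrt \<Delta>)" for x
      unfolding h3 g2_def kern2_def by (rule heat_scale[OF \<Delta>0])
    show ?thesis
      unfolding e2 h2 g1_def kern_def by (rule ext, rule heat_scale[OF \<Delta>0])
  qed
  finally show ?thesis unfolding g1_def g2_def Y_def .
qed

end

section \<open>The meander as a limit over grid cells\<close>

context brownian begin

text \<open>Continuity makes the zero set closed and \<open>B 0 \<omega> = 0\<close> makes it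
  nonempty, so the supremum is attained.\<close>

lemma last_zero:
  assumes \<omega>: "\<omega> \<in> space M"
  shows "0 \<le> last_zero B \<omega>" "last_zero B \<omega> \<le> 1" "B (last_zero B \<omega>) \<omega> = 0"
    "\<And>v. 0 \<le> v \<Longrightarrow> v \<le> 1 \<Longrightarrow> B v \<omega> = 0 \<Longrightarrow> v \<le> last_zero B \<omega>"
proof -
  define S where "S = {t \<in> {0..1}. B t \<omega> = 0}"
  have "S = {0..1} \<inter> (\<lambda>r. B r \<omega>) -` {0}" by (auto simp: S_def)
  moreover have "closed ({0..1} \<inter> (\<lambda>r. B r \<omega>) -` {0})"
    by (rule continuous_closed_preimage[OF B_continuous[OF \<omega>]]) auto
  ultimately have "closed S" by simp
  moreover have ne: "S \<noteq> {}" using B_0[OF \<omega>] by (auto simp: S_def intro!: exI[of _ 0])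
  moreover have bd: "bdd_above S" by (auto simp: S_def bdd_above_def)
  ultimately have "Sup S \<in> S" using closed_contains_Sup by blast
  then show "0 \<le> last_zero B \<omega>" "last_zero B \<omega> \<le> 1" "B (last_zero B \<omega>) \<omega> = 0"
    unfolding last_zero_def S_def by auto
  show "v \<le> last_zero B \<omega>" if "0 \<le> v" "v \<le> 1" "B v \<omega> = 0" for v
    unfolding last_zero_def S_def[symmetric] by (rule cSup_upper[OF _ bd]) (use that in \<open>auto simp: S_def\<close>)
qed

section \<open>The grid and the cell of the last zero\<close>

definition grid :: "nat \<Rightarrow> nat \<Rightarrow> real" where
  "grid n k = real k / real (Suc n)"

text \<open>\<open>Suc\<close> selects the right end of a cell that is closed on the left: this end
  lies strictly after the last zero, so if it is at most 1 the path is nonzero there. A last zero at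
  1 gets the index n + 2.\<close>

definition cell :: "nat \<Rightarrow> 'a \<Rightarrow> nat" where
  "cell n \<omega> = Suc (nat \<lfloor>real (Suc n) * last_zero B \<omega>\<rfloor>)"

lemma grid_bounds: "0 \<le> grid n k" "k \<le> n \<Longrightarrow> grid n k < 1" "k \<le> l \<Longrightarrow> grid n k \<le> grid n l"
  by (auto simp: grid_def intro!: divide_right_mono)

lemma grid_cell:
  assumes \<omega>: "\<omega> \<in> space M"
  shows "last_zero B \<omega> < grid n (cell n \<omega>)" "grid n (cell n \<omega>) \<le> last_zero B \<omega> + 1 / real (Suc n)"
    "grid n (cell n \<omega> - 1) \<le> last_zero B \<omega>"
proof -
  let ?x = "real (Suc n) * last_zero B \<omega>"
  have nn: "0 \<le> ?x" using last_zero(1)[OF \<omega>] by simp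
  have c: "real (cell n \<omega>) = of_int \<lfloor>?x\<rfloor> + 1" "real (cell n \<omega> - 1) = of_int \<lfloor>?x\<rfloor>"
    using nn by (auto simp: cell_def simp del: of_nat_Suc intro!: of_nat_nat) (simp_all add: of_nat_nat)
  have f: "of_int \<lfloor>?x\<rfloor> \<le> ?x" "?x < of_int \<lfloor>?x\<rfloor> + 1" by linarith+
  show "last_zero B \<omega> < grid n (cell n \<omega>)"
  proof -
    have "?x / real (Suc n) < (of_int \<lfloor>?x\<rfloor> + 1) / real (Suc n)"
      by (rule divide_strict_right_mono[OF f(2)]) simp
    moreover have "?x / real (Suc n) = last_zero B \<omega>" by (simp del: of_nat_Suc)
    ultimately show ?thesis unfolding grid_def c by (simp only:)
  qed
  have "grid n (cell n \<omega>) \<le> (?x + 1) / real (Suc n)"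
    using f(1) unfolding grid_def c by (intro divide_right_mono) auto
  then show "grid n (cell n \<omega>) \<le> last_zero B \<omega> + 1 / real (Suc n)" by (simp add: add_divide_distrib del: of_nat_Suc)
  have "grid n (cell n \<omega> - 1) \<le> ?x / real (Suc n)"
    using f(1) unfolding grid_def c by (intro divide_right_mono) auto
  then show "grid n (cell n \<omega> - 1) \<le> last_zero B \<omega>" by (simp del: of_nat_Suc)
qed

text \<open>One event lies in the past of the right end of the cell and the other in its future,
  which gives each summand of \<open>cell_sum\<close> the form that \<open>killed_kern\<close>
  requires.\<close>

lemma cell_eq_iff:
  assumes \<omega>: "\<omega> \<in> space M" and k: "1 \<le> k" "k \<le> n"
  shows "cell n \<omega> = k \<longleftrightarrow> \<omega> \<in> hits (grid n (k - 1)) (grid n k) \<and> \<omega> \<notin> hits (grid n k) 1"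
proof
  assume c: "cell n \<omega> = k"
  show "\<omega> \<in> hits (grid n (k - 1)) (grid n k) \<and> \<omega> \<notin> hits (grid n k) 1"
  proof
    show "\<omega> \<in> hits (grid n (k - 1)) (grid n k)"
      unfolding hits_def using \<omega> grid_cell[OF \<omega>, of n, unfolded c] last_zero(3)[OF \<omega>]
      by (auto intro!: bexI[of _ "last_zero B \<omega>"])
    show "\<omega> \<notin> hits (grid n k) 1"
    proof
      assume "\<omega> \<in> hits (grid n k) 1"
      then obtain v where "grid n k \<le> v" "v \<le> 1" "B v \<omega> = 0" by (auto simp: hits_def)
      then show False
        using grid_cell(1)[OF \<omega>, of n, unfolded c] last_zero(4)[OF \<omega>, of v] grid_bounds(1)[of n k] by linarith
    qed
  qed
next
  assume h: "\<omega> \<in> hits (grid n (k - 1)) (grid n k) \<and> \<omega> \<notin> hits (grid n k) 1"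
  then obtain v where v: "grid n (k - 1) \<le> v" "v \<le> grid n k" "B v \<omega> = 0" by (auto simp: hits_def)
  have "v \<le> last_zero B \<omega>"
    using last_zero(4)[OF \<omega>, of v] v grid_bounds(1)[of n "k - 1"] grid_bounds(2)[OF k(2)] by linarith
  then have l: "grid n (k - 1) \<le> last_zero B \<omega>" using v by linarith
  have u: "last_zero B \<omega> < grid n k"
  proof (rule ccontr)
    assume "\<not> last_zero B \<omega> < grid n k"
    then have "\<omega> \<in> hits (grid n k) 1" unfolding hits_def using \<omega> last_zero[OF \<omega>] by (auto intro!: bexI[of _ "last_zero B \<omega>"])
    then show False using h by simp
  qed
  have "grid n (k - 1) < grid n (cell n \<omega>)" "grid n (cell n \<omega> - 1) < grid n k"
    using l u grid_cell[OF \<omega>, of n] by linarith+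
  then have "k - 1 < cell n \<omega>" "cell n \<omega> - 1 < k" 
    using grid_bounds(3)[of "cell n \<omega>" "k - 1" n] grid_bounds(3)[of k "cell n \<omega> - 1" n] by linarith+
  moreover have "1 \<le> cell n \<omega>" by (simp add: cell_def)
  ultimately show "cell n \<omega> = k" using k by linarith
qed

lemma grid_cell_tendsto:
  assumes \<omega>: "\<omega> \<in> space M"
  shows "(\<lambda>n. grid n (cell n \<omega>)) \<longlonglongrightarrow> last_zero B \<omega>"
proof (rule tendsto_sandwich)
  show "\<forall>\<^sub>F n in sequentially. last_zero B \<omega> \<le> grid n (cell n \<omega>)" by (intro always_eventually allI less_imp_le grid_cell(1)[OF \<omega>])
  show "\<forall>\<^sub>F n in sequentially. grid n (cell n \<omega>) \<le> last_zero B \<omega> + 1 / real (Suc n)" by (intro always_eventually allI grid_cell(2)[OF \<omega>])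
  show "(\<lambda>n. last_zero B \<omega> + 1 / real (Suc n)) \<longlonglongrightarrow> last_zero B \<omega>"
    using tendsto_add[OF tendsto_const LIMSEQ_Suc[OF lim_1_over_n]] by simp
qed simp

lemma eventually_cell_le:
  assumes \<omega>: "\<omega> \<in> space M" and "last_zero B \<omega> < 1"
  shows "\<forall>\<^sub>F n in sequentially. cell n \<omega> \<le> n"
proof -
  have "\<forall>\<^sub>F n in sequentially. grid n (cell n \<omega>) < 1"
    by (rule order_tendstoD(2)[OF grid_cell_tendsto[OF \<omega>] assms(2)])
  then show ?thesis by (rule eventually_mono) (simp add: grid_def divide_less_eq)
qed

lemma not_cell_le:
  assumes \<omega>: "\<omega> \<in> space M" and "last_zero B \<omega> = 1"
  shows "\<not> cell n \<omega> \<le> n"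
  using grid_cell(1)[OF \<omega>, of n] grid_bounds(2)[of "cell n \<omega>" n] assms(2) by linarith

text \<open>The summand at \<open>k\<close> is supported on the event that the last zero lies in the \<open>k\<close>-th cell; the last
  cell is left out because its right end is time 1.\<close>

definition cell_sum :: "nat \<Rightarrow> (real \<Rightarrow> 'a \<Rightarrow> real) \<Rightarrow> 'a \<Rightarrow> real" where
  "cell_sum n g \<omega> = (\<Sum>k=1..n. indicator (hits (grid n (k - 1)) (grid n k)) \<omega> * g (grid n k) \<omega> * avoids (grid n k) 1 \<omega>)"

lemma cell_sum_eq:
  assumes \<omega>: "\<omega> \<in> space M"
  shows "cell_sum n g \<omega> = (if cell n \<omega> \<le> n then g (grid n (cell n \<omega>)) \<omega> else 0)"
proof -
  have "cell_sum n g \<omega> = (\<Sum>k=1..n. if k = cell n \<omega> then g (grid n k) \<omega> else 0)"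
    unfolding cell_sum_def
  proof (rule sum.cong[OF refl])
    fix k assume "k \<in> {1..n}"
    then have "cell n \<omega> = k \<longleftrightarrow> \<omega> \<in> hits (grid n (k - 1)) (grid n k) \<and> \<omega> \<notin> hits (grid n k) 1"
      by (intro cell_eq_iff[OF \<omega>]) auto
    then show "indicator (hits (grid n (k - 1)) (grid n k)) \<omega> * g (grid n k) \<omega> * avoids (grid n k) 1 \<omega> =
         (if k = cell n \<omega> then g (grid n k) \<omega> else 0)"
      by (auto split: split_indicator)
  qed
  also have "\<dots> = (if cell n \<omega> \<in> {1..n} then g (grid n (cell n \<omega>)) \<omega> else 0)" by (simp add: sum.delta)
  finally show ?thesis by (simp add: cell_def)
qed

lemma grid_hits [measurable]: "k \<le> n \<Longrightarrow> hits (grid n (k - 1)) (grid n k) \<in> sets M" "k \<le> n \<Longrightarrow> hits (grid n k) 1 \<in> sets M"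
  using grid_bounds(1)[of n k] grid_bounds(2)[of k n] grid_bounds(1)[of n "k-1"] grid_bounds(3)[of "k-1" k n] by (auto intro!: hits_measurable)

lemma cell_sum_measurable:
  assumes "\<And>a. 0 \<le> a \<Longrightarrow> a < 1 \<Longrightarrow> g a \<in> borel_measurable M"
  shows "cell_sum n g \<in> borel_measurable M"
  unfolding cell_sum_def
proof (rule borel_measurable_sum)
  fix k assume "k \<in> {1..n}"
  then have [measurable]: "hits (grid n (k - 1)) (grid n k) \<in> sets M" "hits (grid n k) 1 \<in> sets M" "g (grid n k) \<in> borel_measurable M"
    using grid_hits grid_bounds assms by auto
  show "(\<lambda>\<omega>. indicat_real (hits (grid n (k - 1)) (grid n k)) \<omega> * g (grid n k) \<omega> * avoids (grid n k) 1 \<omega>) \<in> borel_measurable M"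
    by measurable
qed

text \<open>The meander with an arbitrary time \<open>a\<close> in place of the last zero and
  without the absolute value, which even test functions ignore. At \<open>u = 0\<close> it is the
  rescaled start value fed to the kernels.\<close>

definition post_zero :: "real \<Rightarrow> real \<Rightarrow> 'a \<Rightarrow> real" where
  "post_zero u a \<omega> = B (a + u * (1 - a)) \<omega> / sqrt (1 - a)"

lemma post_zero_time: "0 \<le> u \<Longrightarrow> u \<le> 1 \<Longrightarrow> 0 \<le> a \<Longrightarrow> a \<le> 1 \<Longrightarrow> a + u * (1 - a) \<in> {0..1::real}"
  using mult_right_mono[of u 1 "1 - a"] by auto

lemma post_zero_measurable: "0 \<le> u \<Longrightarrow> u \<le> 1 \<Longrightarrow> 0 \<le> a \<Longrightarrow> a < 1 \<Longrightarrow> post_zero u a \<in> borel_measurable M"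
  unfolding post_zero_def using post_zero_time[of u a] by (intro borel_measurable_divide borel_measurable_const B_measurable) auto

lemma meander_eq: "meander B u \<omega> = \<bar>post_zero u (last_zero B \<omega>) \<omega>\<bar>" if "\<omega> \<in> space M"
  using last_zero(2)[OF that] by (simp add: meander_def post_zero_def Let_def abs_divide)

lemma post_zero_tendsto:
  assumes \<omega>: "\<omega> \<in> space M" and \<tau>: "last_zero B \<omega> < 1" and u: "0 \<le> u" "u \<le> 1"
  shows "(\<lambda>n. post_zero u (grid n (cell n \<omega>)) \<omega>) \<longlonglongrightarrow> post_zero u (last_zero B \<omega>) \<omega>"
proof -
  let ?T = "\<lambda>a. a + u * (1 - a)"
  have T: "(\<lambda>n. ?T (grid n (cell n \<omega>))) \<longlonglongrightarrow> ?T (last_zero B \<omega>)"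
    by (intro tendsto_intros grid_cell_tendsto \<omega>)
  have "\<forall>\<^sub>F n in sequentially. ?T (grid n (cell n \<omega>)) \<in> {0..1}"
    using eventually_cell_le[OF \<omega> \<tau>] 
    by (rule eventually_mono) (use grid_bounds u in \<open>auto intro!: post_zero_time less_imp_le[OF grid_bounds(2)] simp del: atLeastAtMost_iff\<close>)
  then have "(\<lambda>n. B (?T (grid n (cell n \<omega>))) \<omega>) \<longlonglongrightarrow> B (?T (last_zero B \<omega>)) \<omega>"
    by (intro continuous_on_tendsto_compose[OF B_continuous[OF \<omega>] T] post_zero_time u last_zero \<omega>)
  then show ?thesis unfolding post_zero_def
    using \<tau> by (intro tendsto_divide tendsto_real_sqrt tendsto_diff tendsto_const grid_cell_tendsto \<omega>) auto
qed

text \<open>A pointwise limit of finite sums in which the random time is replaced by grid times. If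
  the last zero is 1, no cell is counted and the meander is 0 through division by zero, so the limit
  holds at every point of the space.\<close>

lemma meander_measurable:
  assumes u: "0 \<le> u" "u \<le> 1"
  shows "meander B u \<in> borel_measurable M"
proof (rule borel_measurable_LIMSEQ_real[where u = "\<lambda>n. cell_sum n (\<lambda>a \<omega>. \<bar>post_zero u a \<omega>\<bar>)"])
  show "cell_sum n (\<lambda>a \<omega>. \<bar>post_zero u a \<omega>\<bar>) \<in> borel_measurable M" for n
    by (intro cell_sum_measurable borel_measurable_abs post_zero_measurable u)
  fix \<omega> assume \<omega>: "\<omega> \<in> space M"
  show "(\<lambda>n. cell_sum n (\<lambda>a \<omega>. \<bar>post_zero u a \<omega>\<bar>) \<omega>) \<longlonglongrightarrow> meander B u \<omega>"
  proof (cases "last_zero B \<omega> = 1")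
    case True
    then show ?thesis using not_cell_le[OF \<omega> True] by (simp add: cell_sum_eq[OF \<omega>] meander_def)
  next
    case False
    then have \<tau>: "last_zero B \<omega> < 1" using last_zero(2)[OF \<omega>] by simp
    have "\<forall>\<^sub>F n in sequentially. \<bar>post_zero u (grid n (cell n \<omega>)) \<omega>\<bar> = cell_sum n (\<lambda>a \<omega>. \<bar>post_zero u a \<omega>\<bar>) \<omega>"
      using eventually_cell_le[OF \<omega> \<tau>] by (rule eventually_mono) (simp add: cell_sum_eq[OF \<omega>])
    with tendsto_rabs[OF post_zero_tendsto[OF \<omega> \<tau> u]] show ?thesis
      unfolding meander_eq[OF \<omega>] by (rule Lim_transform_eventually)
  qed
qed

lemma AE_last_zero: "AE \<omega> in M. last_zero B \<omega> < 1"
proof -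
  define I where "I = (\<lambda>\<omega>. B 1 \<omega> - B 0 \<omega>)"
  have "distributed M lborel I (normal_density 0 (sqrt (1 - 0)))"
  proof -
    have "\<forall>r u. 0 \<le> r \<and> r < u \<and> u \<le> 1 \<longrightarrow>
        distributed M lborel (\<lambda>\<omega>. B u \<omega> - B r \<omega>) (normal_density 0 (sqrt (u - r)))"
      using brownian unfolding brownian_motion_def by blast
    from this[rule_format, of 0 1] show ?thesis by (simp add: I_def)
  qed
  then have "distr M lborel I = density lborel (normal_density 0 (sqrt (1 - 0)))"
    by (rule distributed_distr_eq_density)
  moreover have "AE x in density lborel (normal_density 0 (sqrt (1 - 0))). x \<noteq> (0::real)"
    using AE_lborel_singleton[of "0::real"] by (subst AE_density) auto
  ultimately have "AE x in distr M lborel I. x \<noteq> 0" by (simp only:)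
  moreover have "I \<in> measurable M lborel" unfolding I_def by simp
  ultimately have "AE \<omega> in M. I \<omega> \<noteq> 0" by (rule AE_distrD[rotated])
  then show ?thesis
  proof (rule AE_mp, intro AE_I2 impI)
    fix \<omega> assume \<omega>: "\<omega> \<in> space M" "I \<omega> \<noteq> 0"
    then have "B 1 \<omega> \<noteq> 0" using B_0 by (simp add: I_def)
    then show "last_zero B \<omega> < 1" using last_zero(2,3)[OF \<omega>(1)] by (cases "last_zero B \<omega> = 1") auto
  qed
qed

text \<open>Two cell sums have equal expectation for every \<open>n\<close>: that of
  \<open>g\<close>, the test functions along the path after the grid time, and that of
  \<open>h\<close>, the kernel quotient at the start value. The first tends to the functional of the
  meander, the second to a constant.\<close>

lemma meander_test_fun:
  assumes "times s t" and f: "test_fun f1" "test_fun f2"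
  shows "expectation (\<lambda>\<omega>. f1 (meander B s \<omega>) * f2 (meander B t \<omega>)) = entrance s t f1 f2 / entrance s t (\<lambda>_. 1) (\<lambda>_. 1)"
proof -
  interpret times s t by fact
  note fm [measurable] = test_funD(6)[OF f(1)] test_funD(6)[OF f(2)]
  note [measurable] = kern_ratio_measurable[OF f]
  define g where "g a \<omega> = f1 (post_zero s a \<omega>) * f2 (post_zero t a \<omega>)" for a \<omega>
  define h where "h a \<omega> = kern_ratio f1 f2 (post_zero 0 a \<omega>)" for a \<omega>
  let ?q = "entrance s t f1 f2 / entrance s t (\<lambda>_. 1) (\<lambda>_. 1)"
  have gb: "\<bar>g a \<omega>\<bar> \<le> 1" and hb: "\<bar>h a \<omega>\<bar> \<le> 1" for a \<omega>
    using test_funD(5)[OF f(1)] test_funD(5)[OF f(2)] kern_ratio_le[OF f] by (auto simp: g_def h_def intro!: abs_mult_le_1)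
  have gm: "g a \<in> borel_measurable M" and hm: "h a \<in> borel_measurable M" if "0 \<le> a" "a < 1" for a
  proof -
    have [measurable]: "post_zero s a \<in> borel_measurable M" "post_zero t a \<in> borel_measurable M" "post_zero 0 a \<in> borel_measurable M"
      using that st by (auto intro!: post_zero_measurable)
    show "g a \<in> borel_measurable M" "h a \<in> borel_measurable M" unfolding g_def h_def by measurable
  qed
  have sb: "\<bar>cell_sum n k \<omega>\<bar> \<le> 1" if "\<And>a. \<bar>k a \<omega>\<bar> \<le> 1" "\<omega> \<in> space M" for n k \<omega>
    using that by (simp add: cell_sum_eq)
  have "expectation (cell_sum n g) = expectation (cell_sum n h)" for n
  proof -
    have "expectation (\<lambda>\<omega>. indicator (hits (grid n (k - 1)) (grid n k)) \<omega> * g (grid n k) \<omega> * avoids (grid n k) 1 \<omega>)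
      = expectation (\<lambda>\<omega>. indicator (hits (grid n (k - 1)) (grid n k)) \<omega> * h (grid n k) \<omega> * avoids (grid n k) 1 \<omega>)"
      if k: "k \<in> {1..n}" for k
    proof -
      define a where "a = grid n k"
      have a: "0 \<le> a" "a < 1" using grid_bounds k by (auto simp: a_def)
      define X where "X \<omega> = (indicator (hits (grid n (k - 1)) a) \<omega> :: real)" for \<omega>
      have X: "X \<in> borel_measurable (past a)" "\<bar>X \<omega>\<bar> \<le> 1" for \<omega>
        unfolding X_def a_def using grid_bounds(1)[of n "k-1"] grid_bounds(2)[of k n] grid_bounds(3)[of "k-1" k n] k
        by (auto intro!: borel_measurable_indicator hits_past split: split_indicator)
      \<comment> \<open>\<open>H\<close> depends on the path at \<open>a\<close> only and can be
        moved into the past weight. This trades the kernel for \<open>f1\<close>, \<open>f2\<close>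
        against the one for the constants, and \<open>killed_kern\<close> read backwards then
        restores the avoidance event.\<close>
      define H where "H \<omega> = kern_ratio f1 f2 (B a \<omega> / sqrt (1 - a))" for \<omega>
      have hH: "h a = H" by (auto simp: h_def H_def post_zero_def)
      have [measurable]: "B a \<in> borel_measurable (past a)" using a by (intro B_past) auto
      have XH: "(\<lambda>\<omega>. X \<omega> * H \<omega>) \<in> borel_measurable (past a)" "\<bar>X \<omega> * H \<omega>\<bar> \<le> 1" for \<omega>
        using X hb[of a] by (auto simp: hH H_def intro!: abs_mult_le_1)
      have "expectation (\<lambda>\<omega>. X \<omega> * g a \<omega> * avoids a 1 \<omega>)
        = expectation (\<lambda>\<omega>. X \<omega> * sgn (B a \<omega>) * kern s t f1 f2 (B a \<omega> / sqrt (1 - a)))"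
        using killed_kern[OF assms(1) a refl X f] by (simp add: g_def post_zero_def mult.assoc)
      also have "\<dots> = expectation (\<lambda>\<omega>. X \<omega> * H \<omega> * sgn (B a \<omega>) * kern s t (\<lambda>_. 1) (\<lambda>_. 1) (B a \<omega> / sqrt (1 - a)))"
        unfolding H_def by (subst kern_eq_ratio[OF f]) (simp only: mult.assoc mult.commute mult.left_commute)
      also have "\<dots> = expectation (\<lambda>\<omega>. X \<omega> * h a \<omega> * avoids a 1 \<omega>)"
        using killed_kern[OF assms(1) a refl XH test_fun_1 test_fun_1] by (simp add: hH)
      finally show ?thesis by (simp only: X_def a_def)
    qed
    moreover have "expectation (cell_sum n k) = (\<Sum>j=1..n. expectation (\<lambda>\<omega>. indicator (hits (grid n (j - 1)) (grid n j)) \<omega> * k (grid n j) \<omega> * avoids (grid n j) 1 \<omega>))"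
      if k: "\<And>a \<omega>. \<bar>k a \<omega>\<bar> \<le> 1" "\<And>a. 0 \<le> a \<Longrightarrow> a < 1 \<Longrightarrow> k a \<in> borel_measurable M" for k
      unfolding cell_sum_def
    proof (intro Bochner_Integration.integral_sum integrable_bounded[where C = 1])
      fix j assume "j \<in> {1..n}"
      then have [measurable]: "hits (grid n (j - 1)) (grid n j) \<in> sets M" "hits (grid n j) 1 \<in> sets M" "k (grid n j) \<in> borel_measurable M"
        using grid_hits grid_bounds k(2) by auto
      show "(\<lambda>\<omega>. indicator (hits (grid n (j - 1)) (grid n j)) \<omega> * k (grid n j) \<omega> * avoids (grid n j) 1 \<omega>) \<in> borel_measurable M"
        by measurable
    qed (use k(1) in \<open>auto intro!: abs_mult_le_1 split: split_indicator\<close>)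
    ultimately show ?thesis using gb hb gm hm by simp
  qed
  moreover have "(\<lambda>n. expectation (cell_sum n g)) \<longlonglongrightarrow> expectation (\<lambda>\<omega>. f1 (meander B s \<omega>) * f2 (meander B t \<omega>))"
  proof (rule integral_dominated_convergence[where w = "\<lambda>_. 1"])
    show "(\<lambda>\<omega>. f1 (meander B s \<omega>) * f2 (meander B t \<omega>)) \<in> borel_measurable M"
      using st by (intro borel_measurable_times measurable_compose[OF meander_measurable] fm) auto
    show "cell_sum n g \<in> borel_measurable M" for n by (intro cell_sum_measurable gm)
    show "AE \<omega> in M. norm (cell_sum n g \<omega>) \<le> 1" for n using sb[OF gb] by (intro AE_I2) auto
    show "AE \<omega> in M. (\<lambda>n. cell_sum n g \<omega>) \<longlonglongrightarrow> f1 (meander B s \<omega>) * f2 (meander B t \<omega>)"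
      using AE_last_zero
    proof (rule AE_mp, intro AE_I2 impI)
      fix \<omega> assume \<omega>: "\<omega> \<in> space M" and \<tau>: "last_zero B \<omega> < 1"
      have ev: "\<forall>\<^sub>F n in sequentially. g (grid n (cell n \<omega>)) \<omega> = cell_sum n g \<omega>"
        using eventually_cell_le[OF \<omega> \<tau>] by (rule eventually_mono) (simp add: cell_sum_eq[OF \<omega>])
      have c: "f (meander B u \<omega>) = f (post_zero u (last_zero B \<omega>) \<omega>)" if "test_fun f" for f u
        using test_funD(2)[OF that] by (simp add: meander_eq[OF \<omega>] abs_if)
      have "(\<lambda>n. g (grid n (cell n \<omega>)) \<omega>) \<longlonglongrightarrow> f1 (meander B s \<omega>) * f2 (meander B t \<omega>)"
      proof -
        have "(\<lambda>n. f (post_zero u (grid n (cell n \<omega>)) \<omega>)) \<longlonglongrightarrow> f (meander B u \<omega>)" if "test_fun f" "0 \<le> u" "u \<le> 1" for f u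
          unfolding c[OF that(1)]
          by (rule isCont_tendsto_compose[OF bounded_lipschitz_isCont[OF test_funD(1)[OF that(1)]] post_zero_tendsto[OF \<omega> \<tau> that(2,3)]])
        then show ?thesis unfolding g_def using st by (intro tendsto_mult) (auto simp: f)
      qed
      then show "(\<lambda>n. cell_sum n g \<omega>) \<longlonglongrightarrow> f1 (meander B s \<omega>) * f2 (meander B t \<omega>)"
        using ev by (rule Lim_transform_eventually)
    qed
  qed auto
  moreover have "(\<lambda>n. expectation (cell_sum n h)) \<longlonglongrightarrow> expectation (\<lambda>\<omega>. ?q)"
  proof (rule integral_dominated_convergence[where w = "\<lambda>_. 1"])
    show "cell_sum n h \<in> borel_measurable M" for n by (intro cell_sum_measurable hm)
    show "AE \<omega> in M. norm (cell_sum n h \<omega>) \<le> 1" for n using sb[OF hb] by (intro AE_I2) auto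
    show "AE \<omega> in M. (\<lambda>n. cell_sum n h \<omega>) \<longlonglongrightarrow> ?q"
      using AE_last_zero
    proof (rule AE_mp, intro AE_I2 impI)
      fix \<omega> assume \<omega>: "\<omega> \<in> space M" and \<tau>: "last_zero B \<omega> < 1"
      have ev: "\<forall>\<^sub>F n in sequentially. h (grid n (cell n \<omega>)) \<omega> = cell_sum n h \<omega>"
        using eventually_cell_le[OF \<omega> \<tau>] by (rule eventually_mono) (simp add: cell_sum_eq[OF \<omega>])
      \<comment> \<open>The index is shifted by \<open>N\<close> so that every right end is below 1
        and every start value nonzero, as the limit of the quotient demands of all terms.\<close>
      obtain N where N: "\<And>n. N \<le> n \<Longrightarrow> cell n \<omega> \<le> n"
        using eventually_cell_le[OF \<omega> \<tau>] by (auto simp: eventually_sequentially)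
      define y where "y n = post_zero 0 (grid (n + N) (cell (n + N) \<omega>)) \<omega>" for n
      have "y \<longlonglongrightarrow> 0"
        using LIMSEQ_ignore_initial_segment[OF post_zero_tendsto[OF \<omega> \<tau>, of 0], of N] last_zero(3)[OF \<omega>]
        by (simp add: y_def[abs_def] post_zero_def)
      moreover have "y n \<noteq> 0" for n
      proof -
        let ?a = "grid (n + N) (cell (n + N) \<omega>)"
        have a: "last_zero B \<omega> < ?a" "0 \<le> ?a" "?a < 1"
          using grid_cell(1)[OF \<omega>] grid_bounds N[of "n + N"] by auto
        then have "B ?a \<omega> \<noteq> 0" using last_zero(4)[OF \<omega>, of ?a] by auto
        then show ?thesis using a by (simp add: y_def post_zero_def)
      qed
      ultimately have "(\<lambda>n. kern_ratio f1 f2 (y n)) \<longlonglongrightarrow> ?q" by (rule kern_ratio_tendsto[OF f])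
      then have "(\<lambda>n. h (grid n (cell n \<omega>)) \<omega>) \<longlonglongrightarrow> ?q"
        unfolding y_def h_def by (rule LIMSEQ_offset)
      then show "(\<lambda>n. cell_sum n h \<omega>) \<longlonglongrightarrow> ?q"
        using ev by (rule Lim_transform_eventually)
    qed
  qed auto
  ultimately show ?thesis using LIMSEQ_unique by (simp add: prob_space) blast
qed

end

section \<open>Gaussian moments on the half-line\<close>

lemma erf_has_derivative: "(erf has_real_derivative 2 / sqrt pi * exp (- z\<^sup>2)) (at z)"
proof -
  \<comment> \<open>An interval with 0 and \<open>z\<close> in its interior, so that the derivative
    within it is the full derivative.\<close>
  define a b where "a = min 0 z - 1" and "b = max 0 z + 1"
  have ab: "a < 0" "0 < b" "a < z" "z < b" by (auto simp: a_def b_def)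
  have "((\<lambda>z. LBINT u=0..z. exp (- u\<^sup>2)) has_vector_derivative exp (- z\<^sup>2)) (at z within {a..b})"
    unfolding zero_ereal_def
    by (rule interval_integral_FTC2) (use ab in \<open>auto intro!: continuous_intros\<close>)
  then have "((\<lambda>z. LBINT u=0..z. exp (- u\<^sup>2)) has_real_derivative exp (- z\<^sup>2)) (at z)"
    using ab at_within_interior[of z "{a..b}"] by (simp add: has_real_derivative_iff_has_vector_derivative)
  then show ?thesis unfolding erf_def[abs_def] by (rule DERIV_cmult)
qed

lemma erf_0 [simp]: "erf 0 = 0"
  by (simp add: erf_def zero_ereal_def interval_integral_Icc[of 0 0])

lemma erf_minus [simp]: "erf (- z) = - erf z"
proof -
  have "((\<lambda>x. erf (- x) + erf x) has_real_derivative 0) (at x)" for x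
    by (auto intro!: derivative_eq_intros DERIV_chain2[OF erf_has_derivative])
  then have "erf (- z) + erf z = erf (- 0) + erf 0" by (intro DERIV_isconst_all) auto
  then show ?thesis by simp
qed

lemma erf_tendsto: "(erf \<longlongrightarrow> 1) at_top"
proof -
  define g where "g = (\<lambda>x::real. indicator {0..} x *\<^sub>R exp (- x\<^sup>2))"
  have g: "has_bochner_integral lborel g (sqrt pi / 2)" unfolding g_def by (rule gaussian_moment_0)
  have "((\<lambda>y. LINT x|lborel. indicator {..y} x *\<^sub>R g x) \<longlongrightarrow> sqrt pi / 2) at_top"
    unfolding has_bochner_integral_integral_eq[OF g, symmetric]
    by (rule tendsto_integral_at_top[OF _ integrable.intros[OF g]]) simp
  moreover have "\<forall>\<^sub>F y in at_top. (LINT x|lborel. indicator {..y} x *\<^sub>R g x) = (LBINT u=0..y. exp (- u\<^sup>2))"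
    using eventually_ge_at_top[of 0]
  proof eventually_elim
    fix y :: real assume "0 \<le> y"
    then have "(LBINT u=0..y. exp (- u\<^sup>2)) = (LINT u:{0..y}|lborel. exp (- u\<^sup>2))"
      unfolding zero_ereal_def by (rule interval_integral_Icc)
    also have "\<dots> = (LINT x|lborel. indicator {..y} x *\<^sub>R g x)"
      unfolding set_lebesgue_integral_def g_def by (intro Bochner_Integration.integral_cong) (auto split: split_indicator)
    finally show "(LINT x|lborel. indicator {..y} x *\<^sub>R g x) = (LBINT u=0..y. exp (- u\<^sup>2))" ..
  qed
  ultimately have "((\<lambda>y::real. LBINT u=0..y. exp (- u\<^sup>2)) \<longlongrightarrow> sqrt pi / 2) at_top"
    by (rule Lim_transform_eventually)
  from tendsto_mult[OF tendsto_const[of "2 / sqrt pi"] this] show ?thesis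
    unfolding erf_def[abs_def] by simp
qed

section \<open>Powers integrated against shifted Gaussians\<close>

definition weight :: "real \<Rightarrow> real \<Rightarrow> real \<Rightarrow> real" where
  "weight m v x = exp (- x\<^sup>2 / (2 * v)) * sinh (m * x / v)"

text \<open>On \<open>x > 0\<close> this is the density of the length of a Gaussian vector in three
  dimensions whose mean has length \<open>m\<close> and whose coordinates are independent with
  variance \<open>v\<close>. The denominator is the integral of the numerator over the positive
  half-line, as \<open>nn_integral_weight_1\<close> shows.\<close>

definition conditional :: "real \<Rightarrow> real \<Rightarrow> real \<Rightarrow> real" where
  "conditional m v x = x * weight m v x / (exp (m\<^sup>2 / (2 * v)) / 2 * (m * sqrt (2 * pi * v)))"

locale gauss =
  fixes m v :: real assumes v: "0 < v" and m: "0 < m"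
begin

definition E1 :: "real \<Rightarrow> real" where "E1 x = exp (- (x - m)\<^sup>2 / (2 * v))"
definition E2 :: "real \<Rightarrow> real" where "E2 x = exp (- (x + m)\<^sup>2 / (2 * v))"
text \<open>The odd antiderivative of \<open>exp (- x\<^sup>2 / (2 * v))\<close>; the factor
  \<open>sqrt (pi * v / 2)\<close> is its limit at infinity.\<close>

definition \<Phi> :: "real \<Rightarrow> real" where "\<Phi> x = sqrt (pi * v / 2) * erf (x / sqrt (2 * v))"

lemma E_deriv [derivative_intros]:
  "(E1 has_real_derivative - ((x - m) / v) * E1 x) (at x)"
  "(E2 has_real_derivative - ((x + m) / v) * E2 x) (at x)"
  unfolding E1_def[abs_def] E2_def[abs_def] using v by (auto intro!: derivative_eq_intros simp: field_simps)

lemma \<Phi>_deriv: "(\<Phi> has_real_derivative exp (- x\<^sup>2 / (2 * v))) (at x)"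
proof -
  have s: "sqrt (pi * v / 2) * (2 / sqrt pi) / sqrt (2 * v) = 1"
  proof -
    have "sqrt (pi * v / 2) * (2 / sqrt pi) / sqrt (2 * v) = sqrt pi * (sqrt v / sqrt 2) * 2 / sqrt pi / (sqrt 2 * sqrt v)"
      by (simp add: real_sqrt_mult real_sqrt_divide)
    also have "\<dots> = 2 / (sqrt 2 * sqrt 2)" using v by (simp add: field_simps del: real_sqrt_mult_self)
    finally show ?thesis by simp
  qed
  have "(\<Phi> has_real_derivative sqrt (pi * v / 2) * (2 / sqrt pi * exp (- (x / sqrt (2 * v))\<^sup>2) * (1 / sqrt (2 * v)))) (at x)"
    unfolding \<Phi>_def[abs_def] using v
    by (intro DERIV_cmult DERIV_chain2[OF erf_has_derivative] DERIV_cdivide DERIV_ident)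
  also have "sqrt (pi * v / 2) * (2 / sqrt pi * exp (- (x / sqrt (2 * v))\<^sup>2) * (1 / sqrt (2 * v)))
    = (sqrt (pi * v / 2) * (2 / sqrt pi) / sqrt (2 * v)) * exp (- (x / sqrt (2 * v))\<^sup>2)" by simp
  also have "\<dots> = exp (- x\<^sup>2 / (2 * v))" unfolding s using v by (simp add: power_divide)
  finally show ?thesis .
qed

lemma \<Phi>_shift_deriv [derivative_intros]:
  "((\<lambda>x. \<Phi> (x - m)) has_real_derivative E1 x) (at x)"
  "((\<lambda>x. \<Phi> (x + m)) has_real_derivative E2 x) (at x)"
proof -
  have d: "((\<lambda>x. x - m) has_real_derivative 1) (at x)" "((\<lambda>x. x + m) has_real_derivative 1) (at x)"
    by (auto intro!: derivative_eq_intros)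
  show "((\<lambda>x. \<Phi> (x - m)) has_real_derivative E1 x) (at x)" "((\<lambda>x. \<Phi> (x + m)) has_real_derivative E2 x) (at x)"
    using DERIV_chain2[OF \<Phi>_deriv d(1)] DERIV_chain2[OF \<Phi>_deriv d(2)] by (simp_all add: E1_def E2_def)
qed

lemma \<Phi>_minus: "\<Phi> (- x) = - \<Phi> x"
  by (simp add: \<Phi>_def)

lemma \<Phi>_tendsto: "((\<lambda>x. \<Phi> (x + a)) \<longlongrightarrow> sqrt (pi * v / 2)) at_top"
proof -
  have "filterlim (\<lambda>x. (x + a) / sqrt (2 * v)) at_top at_top"
    using v by real_asymp
  from filterlim_compose[OF erf_tendsto this] show ?thesis
    unfolding \<Phi>_def by (auto intro!: tendsto_eq_intros)
qed

text \<open>Antiderivatives of x^k (E1 - E2), obtained by integration by parts; the last branch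
  serves k = 3. The coefficients m, m^2 + v and m^3 + 3 m v of the \<Phi> terms are the moments of a
  normal law with mean m and variance v. For \<open>E2\<close> the mean is -m, so the two terms add
  for odd k and subtract for k = 2.\<close>

definition F :: "nat \<Rightarrow> real \<Rightarrow> real" where
  "F k x = (if k = 1 then - v * E1 x + v * E2 x + m * (\<Phi> (x - m) + \<Phi> (x + m))
    else if k = 2 then - v * (x + m) * E1 x + v * (x - m) * E2 x + (m\<^sup>2 + v) * (\<Phi> (x - m) - \<Phi> (x + m))
    else - v * (x\<^sup>2 + m * x + m\<^sup>2 + 2 * v) * E1 x + v * (x\<^sup>2 - m * x + m\<^sup>2 + 2 * v) * E2 x
      + (m ^ 3 + 3 * m * v) * (\<Phi> (x - m) + \<Phi> (x + m)))"

lemma F_deriv: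
  assumes "k \<in> {1, 2, 3}" shows "(F k has_real_derivative x ^ k * (E1 x - E2 x)) (at x)"
proof -
  have "(F 1 has_real_derivative x ^ 1 * (E1 x - E2 x)) (at x)"
    unfolding F_def[abs_def] using v
    by (auto intro!: derivative_eq_intros simp: field_simps)
  moreover have "(F 2 has_real_derivative x ^ 2 * (E1 x - E2 x)) (at x)"
    unfolding F_def[abs_def] using v
    by (auto intro!: derivative_eq_intros simp: field_simps power2_eq_square)
  moreover have "(F 3 has_real_derivative x ^ 3 * (E1 x - E2 x)) (at x)"
    unfolding F_def[abs_def] using v
    by (auto intro!: derivative_eq_intros simp: field_simps power2_eq_square power3_eq_cube)
  ultimately show ?thesis using assms by auto
qed

lemma F_0: "F 1 0 = 0" "F 2 0 = - (2 * v * m * exp (- m\<^sup>2 / (2 * v)) + 2 * (m\<^sup>2 + v) * \<Phi> m)" "F 3 0 = 0"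
  by (auto simp: F_def E1_def E2_def \<Phi>_minus algebra_simps)

text \<open>Gaussian tails kill the polynomial terms. For odd \<open>k\<close> the \<Phi> terms add,
  and the whole integral comes from infinity; for \<open>k = 2\<close> they cancel there, and it
  comes from the end 0. This is why the error function appears in the first conditional moment and
  not in the second.\<close>

lemma F_tendsto:
  "(F 1 \<longlongrightarrow> m * sqrt (2 * pi * v)) at_top" "(F 2 \<longlongrightarrow> 0) at_top" "(F 3 \<longlongrightarrow> (m ^ 3 + 3 * m * v) * sqrt (2 * pi * v)) at_top"
proof -
  have s: "2 * sqrt (pi * v / 2) = sqrt (2 * pi * v)"
    using real_sqrt_mult[of 4 "pi * v / 2"] by (simp add: mult.assoc)
  have E: "((\<lambda>x. - v * E1 x + v * E2 x) \<longlongrightarrow> 0) at_top"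
    "((\<lambda>x. - v * (x + m) * E1 x + v * (x - m) * E2 x) \<longlongrightarrow> 0) at_top"
    "((\<lambda>x. - v * (x\<^sup>2 + m * x + m\<^sup>2 + 2 * v) * E1 x + v * (x\<^sup>2 - m * x + m\<^sup>2 + 2 * v) * E2 x) \<longlongrightarrow> 0) at_top"
    unfolding E1_def E2_def using v m by real_asymp+
  have P: "((\<lambda>x. \<Phi> (x - m) + \<Phi> (x + m)) \<longlongrightarrow> sqrt (2 * pi * v)) at_top" "((\<lambda>x. \<Phi> (x - m) - \<Phi> (x + m)) \<longlongrightarrow> 0) at_top"
    using tendsto_add[OF \<Phi>_tendsto[of "- m"] \<Phi>_tendsto[of m]] tendsto_diff[OF \<Phi>_tendsto[of "- m"] \<Phi>_tendsto[of m]] s by auto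
  show "(F 1 \<longlongrightarrow> m * sqrt (2 * pi * v)) at_top"
    unfolding F_def[abs_def] using tendsto_add[OF E(1) tendsto_mult[OF tendsto_const[of m] P(1)]] by simp
  show "(F 2 \<longlongrightarrow> 0) at_top"
    unfolding F_def[abs_def] using tendsto_add[OF E(2) tendsto_mult[OF tendsto_const[of "m\<^sup>2 + v"] P(2)]] by simp
  show "(F 3 \<longlongrightarrow> (m ^ 3 + 3 * m * v) * sqrt (2 * pi * v)) at_top"
    unfolding F_def[abs_def] using tendsto_add[OF E(3) tendsto_mult[OF tendsto_const[of "m ^ 3 + 3 * m * v"] P(1)]] by simp
qed

lemma weight_nonneg: "0 \<le> x \<Longrightarrow> 0 \<le> weight m v x"
  using m v by (simp add: weight_def)

lemma weight_eq: "weight m v x = exp (m\<^sup>2 / (2 * v)) / 2 * (E1 x - E2 x)"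
proof -
  have "exp (m\<^sup>2 / (2 * v)) * E1 x = exp (- x\<^sup>2 / (2 * v)) * exp (m * x / v)"
    "exp (m\<^sup>2 / (2 * v)) * E2 x = exp (- x\<^sup>2 / (2 * v)) * exp (- (m * x / v))"
    unfolding E1_def E2_def exp_add[symmetric] using v by (simp_all add: field_simps power2_eq_square)
  then show ?thesis unfolding weight_def sinh_def by (simp add: algebra_simps diff_divide_distrib)
qed

lemma nn_integral_weight:
  assumes k: "k \<in> {1, 2, 3}" and T: "(F k \<longlongrightarrow> T) at_top"
  shows "(\<integral>\<^sup>+x. ennreal (x ^ k * weight m v x) * indicator {0<..} x \<partial>lborel) = ennreal (exp (m\<^sup>2 / (2 * v)) / 2 * (T - F k 0))"
proof -
  let ?c = "exp (m\<^sup>2 / (2 * v)) / 2"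
  have w: "x ^ k * weight m v x = ?c * (x ^ k * (E1 x - E2 x))" for x by (simp add: weight_eq)
  \<comment> \<open>The point 0 is adjoined, where x^k vanishes, because the fundamental theorem is
    applied on the closed half-line.\<close>
  have "(\<integral>\<^sup>+x. ennreal (x ^ k * weight m v x) * indicator {0<..} x \<partial>lborel) = (\<integral>\<^sup>+x. ennreal (x ^ k * weight m v x) * indicator {0..} x \<partial>lborel)"
    using k by (intro nn_integral_cong) (auto split: split_indicator)
  also have "\<dots> = ennreal (?c * T - ?c * F k 0)"
  proof (rule nn_integral_FTC_atLeast)
    show "(\<lambda>x. x ^ k * weight m v x) \<in> borel_measurable borel" unfolding weight_def by measurable
    show "((\<lambda>x. ?c * F k x) has_real_derivative x ^ k * weight m v x) (at x)" for x
      unfolding w by (intro DERIV_cmult F_deriv k)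
    show "0 \<le> x ^ k * weight m v x" if "0 \<le> x" for x using that m v by (simp add: weight_def)
    show "((\<lambda>x. ?c * F k x) \<longlongrightarrow> ?c * T) at_top" by (intro tendsto_intros T)
  qed
  finally show ?thesis by (simp add: right_diff_distrib)
qed

lemma nn_integral_weight_1: 
  "(\<integral>\<^sup>+x. ennreal (x * weight m v x) * indicator {0<..} x \<partial>lborel) = ennreal (exp (m\<^sup>2 / (2 * v)) / 2 * (m * sqrt (2 * pi * v)))"
  using nn_integral_weight[of 1] F_tendsto(1) F_0(1) by simp

lemma integral_weight:
  assumes k: "k \<in> {1, 2, 3}" and T: "(F k \<longlongrightarrow> T) at_top" and nn: "0 \<le> T - F k 0"
  shows "(LINT x:{0<..}|lborel. x ^ k * weight m v x) = exp (m\<^sup>2 / (2 * v)) / 2 * (T - F k 0)"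
proof -
  have "has_bochner_integral lborel (\<lambda>x. indicator {0<..} x * (x ^ k * weight m v x)) (exp (m\<^sup>2 / (2 * v)) / 2 * (T - F k 0))"
  proof (rule has_bochner_integral_nn_integral)
    show "(\<lambda>x. indicator {0<..} x * (x ^ k * weight m v x)) \<in> borel_measurable lborel" unfolding weight_def by measurable
    show "AE x in lborel. 0 \<le> indicator {0<..} x * (x ^ k * weight m v x)"
      using m v by (intro AE_I2) (auto simp: weight_def split: split_indicator)
    show "0 \<le> exp (m\<^sup>2 / (2 * v)) / 2 * (T - F k 0)" using nn by simp
    have "ennreal (indicator {0<..} x * (x ^ k * weight m v x)) = ennreal (x ^ k * weight m v x) * indicator {0<..} x" for x
      by (auto split: split_indicator)
    then show "(\<integral>\<^sup>+x. ennreal (indicator {0<..} x * (x ^ k * weight m v x)) \<partial>lborel) = ennreal (exp (m\<^sup>2 / (2 * v)) / 2 * (T - F k 0))"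
      using nn_integral_weight[OF k T] by simp
  qed
  then show ?thesis by (simp add: set_lebesgue_integral_def has_bochner_integral_iff)
qed

text \<open>\<open>conditional\<close> carries a factor x of its own, so its moments 1 and 2 come
  from the powers 2 and 3 of \<open>weight\<close>. The second is the mean square length of the
  three-dimensional vector: squared mean plus one variance per coordinate.\<close>

lemma conditional_moments:
  "(LINT x:{0<..}|lborel. x * conditional m v x) = (m + v / m) * erf (m / sqrt (2 * v)) + sqrt (2 * v / pi) * exp (- m\<^sup>2 / (2 * v))"
  "(LINT x:{0<..}|lborel. x\<^sup>2 * conditional m v x) = m\<^sup>2 + 3 * v"
proof -
  define c where "c = exp (m\<^sup>2 / (2 * v)) / 2"
  define r where "r = sqrt (2 * pi * v)"
  have c: "c > 0" by (simp add: c_def)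
  have r: "r > 0" using v by (simp add: r_def)
  have D: "conditional m v x = x * weight m v x / (c * (m * r))" for x by (simp add: conditional_def c_def r_def)
  \<comment> \<open>This serves the sign condition of \<open>integral_weight\<close>, since
    \<open>F 2 0\<close> contains the error function.\<close>
  have erf_nn: "0 \<le> erf z" if "0 \<le> z" for z
    using DERIV_nonneg_imp_nondecreasing[of 0 z erf] that erf_has_derivative by fastforce
  have \<Phi>m: "\<Phi> m = r / 2 * erf (m / sqrt (2 * v))"
  proof -
    have "2 * sqrt (pi * v / 2) = r" unfolding r_def using real_sqrt_mult[of 4 "pi * v / 2"] by (simp add: mult.assoc)
    then show ?thesis by (simp add: \<Phi>_def)
  qed
  have "(LINT x:{0<..}|lborel. x * conditional m v x) = (LINT x:{0<..}|lborel. x ^ 2 * weight m v x) / (c * (m * r))"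
    unfolding D set_integral_divide_zero[symmetric] by (simp add: power2_eq_square mult.assoc)
  also have "(LINT x:{0<..}|lborel. x ^ 2 * weight m v x) = c * (0 - F 2 0)"
    unfolding c_def by (rule integral_weight[OF _ F_tendsto(2)]) (use erf_nn m v in \<open>auto simp: F_0 \<Phi>_def\<close>)
  also have "c * (0 - F 2 0) / (c * (m * r)) = - F 2 0 / (m * r)" using c by simp
  also have "\<dots> = 2 * v / r * exp (- m\<^sup>2 / (2 * v)) + (m\<^sup>2 + v) / m * erf (m / sqrt (2 * v))"
    unfolding F_0 \<Phi>m using m r by (simp add: field_simps)
  also have "(m\<^sup>2 + v) / m = m + v / m" using m by (simp add: field_simps power2_eq_square)
  also have "2 * v / r = sqrt (2 * v / pi)"
  proof -
    have "sqrt (2 * v / pi) * r = sqrt ((2 * v)\<^sup>2)" unfolding r_def real_sqrt_mult[symmetric] by (simp add: power2_eq_square)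
    then have "sqrt (2 * v / pi) * r = 2 * v" using v by (simp only: real_sqrt_abs)
    then show ?thesis using r by (simp add: divide_eq_eq)
  qed
  finally show "(LINT x:{0<..}|lborel. x * conditional m v x) = (m + v / m) * erf (m / sqrt (2 * v)) + sqrt (2 * v / pi) * exp (- m\<^sup>2 / (2 * v))"
    by simp
  have "(LINT x:{0<..}|lborel. x\<^sup>2 * conditional m v x) = (LINT x:{0<..}|lborel. x ^ 3 * weight m v x) / (c * (m * r))"
    unfolding D set_integral_divide_zero[symmetric] by (simp add: power2_eq_square power3_eq_cube mult.assoc)
  also have "(LINT x:{0<..}|lborel. x ^ 3 * weight m v x) = c * ((m ^ 3 + 3 * m * v) * r - F 3 0)"
    unfolding c_def r_def by (rule integral_weight[OF _ F_tendsto(3)]) (use m v in \<open>auto simp: F_0\<close>)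
  also have "\<dots> / (c * (m * r)) = m\<^sup>2 + 3 * v"
    unfolding F_0 using c m r by (simp add: field_simps power2_eq_square power3_eq_cube)
  finally show "(LINT x:{0<..}|lborel. x\<^sup>2 * conditional m v x) = m\<^sup>2 + 3 * v" .
qed

end

section \<open>The joint law of the meander at two times\<close>

text \<open>Folding at the origin gives the factor 2 and the substitution \<open>x = a * v\<close>
  the factor \<open>1 / a\<close>.\<close>

lemma nn_integral_even:
  fixes G :: "real \<Rightarrow> ennreal"
  assumes [measurable]: "G \<in> borel_measurable borel" and even: "\<And>x. G (- x) = G x" and a: "0 < a"
  shows "(\<integral>\<^sup>+v. G (a * v) \<partial>lborel) = ennreal (2 / a) * (\<integral>\<^sup>+x. G x * indicator {0<..} x \<partial>lborel)"
proof -
  let ?P = "\<integral>\<^sup>+x. G x * indicator {0<..} x \<partial>lborel"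
  have "(\<integral>\<^sup>+x. G x * indicator {..<0} x \<partial>lborel) = (\<integral>\<^sup>+x. G (0 + (-1) * x) * indicator {..<0} (0 + (-1) * x) \<partial>lborel)"
    by (subst nn_integral_real_affine[where c = "-1" and t = 0]) auto
  also have "\<dots> = ?P" by (intro nn_integral_cong) (auto simp: even split: split_indicator)
  finally have neg: "(\<integral>\<^sup>+x. G x * indicator {..<0} x \<partial>lborel) = ?P" .
  have "(\<integral>\<^sup>+x. G x \<partial>lborel) = (\<integral>\<^sup>+x. G x * indicator {0<..} x + G x * indicator {..<0} x \<partial>lborel)"
    using AE_lborel_singleton[of "0::real"]
    by (intro nn_integral_cong_AE) (auto split: split_indicator elim!: eventually_mono)
  also have "\<dots> = ?P + ?P" by (subst nn_integral_add) (auto simp: neg)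
  also have "\<dots> = 2 * ?P" by (simp add: mult_2)
  finally have G: "(\<integral>\<^sup>+x. G x \<partial>lborel) = 2 * ?P" .
  have "(\<integral>\<^sup>+x. G x \<partial>lborel) = ennreal a * (\<integral>\<^sup>+v. G (a * v) \<partial>lborel)"
    using nn_integral_real_affine[of G a 0] a by simp
  then have "ennreal (1 / a) * (ennreal a * (\<integral>\<^sup>+v. G (a * v) \<partial>lborel)) = ennreal (1 / a) * (2 * ?P)"
    using G by simp
  then show ?thesis using a
    by (simp add: mult.assoc[symmetric] ennreal_mult[symmetric] ennreal_numeral[symmetric] del: ennreal_numeral)
qed

context times begin

text \<open>The unnormalised joint density of the meander at times \<open>s\<close> and \<open>t\<close>: the two Gaussian densities
  in \<open>g_{t-s}(x, c)\<close> combine to a hyperbolic sine, and \<open>heat (1 - t) sgn c\<close> is the probability of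
  avoiding 0 up to time 1 from \<open>c\<close>; the latter cancels in the conditional density.\<close>

definition joint_x :: "real \<Rightarrow> real \<Rightarrow> real" where
  "joint_x x c = x * exp (- x\<^sup>2 / (2 * s)) * exp (- x\<^sup>2 / (2 * (t - s))) * sinh (x * c / (t - s))"

definition joint_c :: "real \<Rightarrow> real" where
  "joint_c c = heat (1 - t) sgn c * exp (- c\<^sup>2 / (2 * (t - s)))"

definition joint :: "real \<Rightarrow> real \<Rightarrow> real" where
  "joint x c = indicator {0<..} x * indicator {0<..} c * (2 / (pi * s * sqrt (t - s)) * joint_x x c * joint_c c)"

lemma joint_measurable [measurable]:
  assumes [measurable]: "f \<in> borel_measurable M" "g \<in> borel_measurable M"
  shows "(\<lambda>z. joint (f z) (g z)) \<in> borel_measurable M"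
  unfolding joint_def joint_x_def joint_c_def by measurable

lemma joint_nonneg: "0 \<le> joint x c"
  unfolding joint_def joint_x_def joint_c_def using st heat_sgn_nonneg[of c] by (auto split: split_indicator)

text \<open>The sinh formula folded onto \<open>c > 0\<close>: the integrand is even in
  \<open>c\<close> because \<open>heat (1 - t) sgn\<close> and sinh are both odd. The nonnegative
  integral is used so that iterated integrals can later be treated without integrability
  arguments.\<close>

lemma kern2_nn_integral:
  assumes f2: "test_fun f2" and x: "0 \<le> x"
  shows "ennreal (kern2 s t f2 x) = (\<integral>\<^sup>+c. ennreal (exp (- x\<^sup>2 / (2 * (t - s))) * (2 / sqrt (t - s)) *
    (f2 c * heat (1 - t) sgn c * sinh (x * c / (t - s)) * std_normal_density (c / sqrt (t - s)))) * indicator {0<..} c \<partial>lborel)"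
proof -
  define h where "h = t - s"
  have h: "0 < h" using st by (simp add: h_def)
  have [measurable]: "f2 \<in> borel_measurable borel" by (rule test_funD(6)[OF f2])
  define R where "R = heat (1 - t) sgn"
  have [measurable]: "R \<in> borel_measurable borel" unfolding R_def by (rule heat_sgn_measurable)
  have Rodd: "R (- c) = - R c" for c using heat_sgn(2)[of "1 - t"] by (simp add: R_def odd_fun_def)
  define G where "G c = f2 c * R c * sinh (x * c / h) * std_normal_density (c / sqrt h)" for c
  have [measurable]: "G \<in> borel_measurable borel" unfolding G_def by measurable
  have Geven: "G (- c) = G c" for c
    using test_funD(2)[OF f2] by (simp add: G_def Rodd std_normal_density_def)
  have Gnn: "0 \<le> G c" for c
  proof -
    have p: "0 \<le> G c" if "0 \<le> c" for c
      unfolding G_def using that x h test_funD(3)[OF f2] heat_sgn_nonneg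
      by (intro mult_nonneg_nonneg) (auto simp: R_def)
    show ?thesis using p[of c] p[of "- c"] Geven[of c] by (cases "0 \<le> c") auto
  qed
  have sq: "c / sqrt h * (x / sqrt h) = x * c / h" for c using h by simp
  have i: "integrable lborel (\<lambda>v. G (sqrt h * v))"
  proof -
    have "integrable lborel (\<lambda>v. (f2 (sqrt h * v) * R (sqrt h * v)) * sinh (v * (x / sqrt h)) * std_normal_density v)"
      by (rule integrable_heat_sinh[where C = 1]) (auto simp: R_def kern2_integrand[OF f2])
    moreover have "x * (sqrt h * v) / h = v * (x / sqrt h)" for v using sq[of "sqrt h * v"] h by simp
    ultimately show ?thesis using h by (simp add: G_def)
  qed
  have "kern2 s t f2 x = exp (- (x / sqrt h)\<^sup>2 / 2) *
     (LINT v|lborel. (f2 (sqrt h * v) * R (sqrt h * v)) * sinh (v * (x / sqrt h)) * std_normal_density v)"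
    unfolding kern2_def R_def h_def[symmetric]
    by (rule heat_sinh[OF kern2_integrand(3)[OF f2] kern2_integrand(2)[OF f2] kern2_integrand(1)[OF f2] h])
  also have "\<dots> = exp (- x\<^sup>2 / (2 * h)) * (LINT v|lborel. G (sqrt h * v))"
  proof -
    have "x * (sqrt h * v) / h = v * (x / sqrt h)" for v using sq[of "sqrt h * v"] h by simp
    then show ?thesis using h by (simp add: G_def power_divide)
  qed
  finally have "ennreal (kern2 s t f2 x) = ennreal (exp (- x\<^sup>2 / (2 * h))) * ennreal (LINT v|lborel. G (sqrt h * v))"
    using Gnn by (simp add: ennreal_mult)
  also have "ennreal (LINT v|lborel. G (sqrt h * v)) = (\<integral>\<^sup>+v. ennreal (G (sqrt h * v)) \<partial>lborel)"
    using i Gnn by (intro nn_integral_eq_integral[symmetric]) auto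
  also have "\<dots> = ennreal (2 / sqrt h) * (\<integral>\<^sup>+c. ennreal (G c) * indicator {0<..} c \<partial>lborel)"
    using h Geven by (intro nn_integral_even[of "\<lambda>c. ennreal (G c)"]) auto
  also have "ennreal (exp (- x\<^sup>2 / (2 * h))) * (ennreal (2 / sqrt h) * (\<integral>\<^sup>+c. ennreal (G c) * indicator {0<..} c \<partial>lborel))
    = (\<integral>\<^sup>+c. ennreal (exp (- x\<^sup>2 / (2 * h)) * (2 / sqrt h)) * (ennreal (G c) * indicator {0<..} c) \<partial>lborel)"
  proof -
    have "ennreal (exp (- x\<^sup>2 / (2 * h)) * (2 / sqrt h)) = ennreal (exp (- x\<^sup>2 / (2 * h))) * ennreal (2 / sqrt h)"
      using h by (intro ennreal_mult) auto
    then show ?thesis by (subst nn_integral_cmult) (auto simp only: mult.assoc, measurable)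
  qed
  also have "\<dots> = (\<integral>\<^sup>+c. ennreal (exp (- x\<^sup>2 / (2 * h)) * (2 / sqrt h) * G c) * indicator {0<..} c \<partial>lborel)"
  proof (rule nn_integral_cong)
    fix c
    have "ennreal (exp (- x\<^sup>2 / (2 * h)) * (2 / sqrt h) * G c) = ennreal (exp (- x\<^sup>2 / (2 * h)) * (2 / sqrt h)) * ennreal (G c)"
      using h Gnn by (intro ennreal_mult) auto
    then show "ennreal (exp (- x\<^sup>2 / (2 * h)) * (2 / sqrt h)) * (ennreal (G c) * indicator {0<..} c)
      = ennreal (exp (- x\<^sup>2 / (2 * h)) * (2 / sqrt h) * G c) * indicator {0<..} c"
      by (simp only: mult.assoc)
  qed
  finally show ?thesis unfolding G_def R_def h_def .
qed

lemma entrance_nonneg: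
  assumes f: "test_fun f1" "test_fun f2" shows "0 \<le> entrance s t f1 f2"
  unfolding entrance_def
proof (intro integral_nonneg_AE AE_I2)
  fix v :: real
  have "0 \<le> kern2 s t f2 (sqrt s * v) * v"
  proof (cases "0 \<le> v")
    case True then show ?thesis using kern2_nonneg[OF f(2)] st by simp
  next
    case False
    then have "0 \<le> kern2 s t f2 (sqrt s * - v) * - v" using st by (intro mult_nonneg_nonneg kern2_nonneg[OF f(2)]) auto
    then show ?thesis using kern2(1)[OF f(2)] by (simp add: odd_fun_def)
  qed
  from mult_nonneg_nonneg[OF test_funD(3)[OF f(1)] this]
  have "0 \<le> f1 (sqrt s * v) * (kern2 s t f2 (sqrt s * v) * v) * std_normal_density v"
    by (rule mult_nonneg_nonneg) simp
  then show "0 \<le> f1 (sqrt s * v) * kern2 s t f2 (sqrt s * v) * v * std_normal_density v" by (simp only: mult.assoc)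
qed

text \<open>Folding the outer integral onto \<open>x > 0\<close> as well, and inserting the inner
  one, writes the derivative at the origin as an integral of the test functions against one density
  in the plane.\<close>

lemma entrance_nn_integral:
  assumes f: "test_fun f1" "test_fun f2"
  shows "ennreal (entrance s t f1 f2) = (\<integral>\<^sup>+x. \<integral>\<^sup>+c. ennreal (f1 x * f2 c * joint x c) \<partial>lborel \<partial>lborel)"
proof -
  have [measurable]: "f1 \<in> borel_measurable borel" "f2 \<in> borel_measurable borel" using f test_funD(6) by auto
  have [measurable]: "kern2 s t f2 \<in> borel_measurable borel" by (rule kern2_measurable) measurable
  define G where "G x = f1 x * kern2 s t f2 x * (x / sqrt s) * std_normal_density (x / sqrt s)" for x
  have [measurable]: "G \<in> borel_measurable borel" unfolding G_def by measurable
  have Geven: "G (- x) = G x" for x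
    using test_funD(2)[OF f(1)] kern2(1)[OF f(2)] by (simp add: G_def odd_fun_def std_normal_density_def)
  have Gnn: "0 \<le> G c" for c
  proof -
    have p: "0 \<le> G c" if "0 \<le> c" for c
      unfolding G_def using that st test_funD(3)[OF f(1)] kern2_nonneg[OF f(2)]
      by (intro mult_nonneg_nonneg) auto
    show ?thesis using p[of c] p[of "- c"] Geven[of c] by (cases "0 \<le> c") auto
  qed
  have e: "entrance s t f1 f2 = (LINT v|lborel. G (sqrt s * v))"
    unfolding entrance_def G_def using st by simp
  have i: "integrable lborel (\<lambda>v. G (sqrt s * v))"
    using integrable_entrance[OF f] st by (simp add: G_def)
  have "ennreal (entrance s t f1 f2) = (\<integral>\<^sup>+v. ennreal (G (sqrt s * v)) \<partial>lborel)"
    unfolding e using i Gnn by (intro nn_integral_eq_integral[symmetric]) auto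
  also have "\<dots> = ennreal (2 / sqrt s) * (\<integral>\<^sup>+x. ennreal (G x) * indicator {0<..} x \<partial>lborel)"
    using st Geven by (intro nn_integral_even[of "\<lambda>c. ennreal (G c)"]) auto
  also have "\<dots> = (\<integral>\<^sup>+x. ennreal (2 / sqrt s) * (ennreal (G x) * indicator {0<..} x) \<partial>lborel)"
    by (rule nn_integral_cmult[symmetric]) measurable
  also have "\<dots> = (\<integral>\<^sup>+x. \<integral>\<^sup>+c. ennreal (f1 x * f2 c * joint x c) \<partial>lborel \<partial>lborel)"
  proof (rule nn_integral_cong)
    fix x :: real
    show "ennreal (2 / sqrt s) * (ennreal (G x) * indicator {0<..} x) = (\<integral>\<^sup>+c. ennreal (f1 x * f2 c * joint x c) \<partial>lborel)"
    proof (cases "0 < x")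
      case x: True
      define a where "a = 2 / sqrt s * (f1 x * (x / sqrt s) * std_normal_density (x / sqrt s))"
      have a: "0 \<le> a" unfolding a_def using x st test_funD(3)[OF f(1)] by simp
      have "ennreal (2 / sqrt s) * (ennreal (G x) * indicator {0<..} x) = ennreal (2 / sqrt s * G x)"
      proof -
        have "ennreal (2 / sqrt s * G x) = ennreal (2 / sqrt s) * ennreal (G x)"
          using st Gnn by (intro ennreal_mult) auto
        then show ?thesis using x by (simp only: indicator_simps greaterThan_iff mult_1_right)
      qed
      also have "2 / sqrt s * G x = a * kern2 s t f2 x" by (simp add: a_def G_def)
      also have "ennreal (a * kern2 s t f2 x) = ennreal a * ennreal (kern2 s t f2 x)"
        using a kern2_nonneg[OF f(2)] x by (simp add: ennreal_mult)
      also have "\<dots> = (\<integral>\<^sup>+c. ennreal a * (ennreal (exp (- x\<^sup>2 / (2 * (t - s))) * (2 / sqrt (t - s)) *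
        (f2 c * heat (1 - t) sgn c * sinh (x * c / (t - s)) * std_normal_density (c / sqrt (t - s)))) * indicator {0<..} c) \<partial>lborel)"
        using kern2_nn_integral[OF f(2), of x] x by (simp add: nn_integral_cmult)
      also have "\<dots> = (\<integral>\<^sup>+c. ennreal (f1 x * f2 c * joint x c) \<partial>lborel)"
      proof (rule nn_integral_cong)
        fix c :: real
        show "ennreal a * (ennreal (exp (- x\<^sup>2 / (2 * (t - s))) * (2 / sqrt (t - s)) *
          (f2 c * heat (1 - t) sgn c * sinh (x * c / (t - s)) * std_normal_density (c / sqrt (t - s)))) * indicator {0<..} c)
          = ennreal (f1 x * f2 c * joint x c)"
        proof (cases "0 < c")
          case c: True
          \<comment> \<open>The constant in \<open>joint\<close>: the two foldings give
            \<open>2 / sqrt s\<close> and \<open>2 / sqrt (t - s)\<close>, the two normal densities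
            give 1 / (2 pi), and \<open>x / sqrt s\<close> is the factor left by differentiating
            sinh at the origin.\<close>
          have H: "2 / sqrt s * ((x / sqrt s) * std_normal_density (x / sqrt s)) * (2 / sqrt (t - s)) * std_normal_density (c / sqrt (t - s))
            = 2 / (pi * s * sqrt (t - s)) * (x * exp (- x\<^sup>2 / (2 * s)) * exp (- c\<^sup>2 / (2 * (t - s))))"
            using st unfolding std_normal_density_def
            by (simp add: real_sqrt_mult power_divide field_simps)
          have "a * (exp (- x\<^sup>2 / (2 * (t - s))) * (2 / sqrt (t - s)) *
            (f2 c * heat (1 - t) sgn c * sinh (x * c / (t - s)) * std_normal_density (c / sqrt (t - s))))
            = f1 x * f2 c * (exp (- x\<^sup>2 / (2 * (t - s))) * heat (1 - t) sgn c * sinh (x * c / (t - s))) *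
              (2 / sqrt s * ((x / sqrt s) * std_normal_density (x / sqrt s)) * (2 / sqrt (t - s)) * std_normal_density (c / sqrt (t - s)))"
            unfolding a_def by (simp only: mult.assoc mult.commute mult.left_commute)
          also have "\<dots> = f1 x * f2 c * (exp (- x\<^sup>2 / (2 * (t - s))) * heat (1 - t) sgn c * sinh (x * c / (t - s))) *
              (2 / (pi * s * sqrt (t - s)) * (x * exp (- x\<^sup>2 / (2 * s)) * exp (- c\<^sup>2 / (2 * (t - s)))))"
            by (simp only: H)
          also have "\<dots> = f1 x * f2 c * joint x c"
            using x c by (simp add: joint_def joint_x_def joint_c_def mult.assoc mult.commute mult.left_commute)
          finally show ?thesis using a c by (simp add: ennreal_mult'[symmetric])
        qed (simp add: joint_def)
      qed
      finally show ?thesis .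
    qed (simp add: joint_def)
  qed
  finally show ?thesis .
qed

end

section \<open>Identification of laws in the plane\<close>

lemma measure_eq_rectangles:
  fixes M N :: "(real \<times> real) measure"
  assumes "sets M = sets borel" "sets N = sets borel" "finite_measure M"
    and eq: "\<And>a b. emeasure M ({..a} \<times> {..b}) = emeasure N ({..a} \<times> {..b})"
  shows "M = N"
proof (rule measure_eqI_generator_eq[where E = "range (\<lambda>z::real \<times> real. {..z})" and \<Omega> = UNIV and A = "\<lambda>n. {..(real n, real n)}"])
  have r: "{..z} = {..fst z} \<times> {..snd z}" for z :: "real \<times> real" by (auto simp: less_eq_prod_def)
  show "Int_stable (range (\<lambda>z::real \<times> real. {..z}))"
  proof (rule Int_stableI, safe)
    fix a b c d :: real
    have "{..(a, b)} \<inter> {..(c, d)} = {..(min a c, min b d)}" by (auto simp: r)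
    then show "{..(a, b)} \<inter> {..(c, d)} \<in> range (\<lambda>z. {..z})" by blast
  qed
  show "emeasure M X = emeasure N X" if "X \<in> range (\<lambda>z::real \<times> real. {..z})" for X
    using that eq by (auto simp: r)
  show "sets M = sigma_sets UNIV (range (\<lambda>z::real \<times> real. {..z}))" "sets N = sigma_sets UNIV (range (\<lambda>z::real \<times> real. {..z}))"
  proof -
    have "sets (borel :: (real \<times> real) measure) = sigma_sets UNIV (range (\<lambda>z. {..z}))"
      by (subst borel_eq_atMost) (rule sets_measure_of, simp)
    then show "sets M = sigma_sets UNIV (range (\<lambda>z::real \<times> real. {..z}))" "sets N = sigma_sets UNIV (range (\<lambda>z::real \<times> real. {..z}))"
      using assms(1,2) by auto
  qed
  show "(\<Union>n. {..(real n, real n)}) = UNIV"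
  proof safe
    fix x y :: real
    obtain n :: nat where "max x y \<le> real n" using real_arch_simple by blast
    then show "(x, y) \<in> (\<Union>n. {..(real n, real n)})" by (auto simp: r)
  qed simp
  show "emeasure M {..(real n, real n)} \<noteq> \<infinity>" for n
    using finite_measure.emeasure_finite[OF assms(3)] by simp
qed auto

lemma fst_borel: "fst \<in> borel_measurable (borel :: (real \<times> real) measure)"
  and snd_borel: "snd \<in> borel_measurable (borel :: (real \<times> real) measure)"
  by (auto intro!: borel_measurable_continuous_onI continuous_intros)

text \<open>Even by construction and, on the nonnegative half-line, an approximation from above of
  the indicator of \<open>{..a}\<close>, also for negative \<open>a\<close>. At negative arguments
  the limit can differ from that indicator, so it is used only where both coordinates are
  nonnegative.\<close>

definition cutoff :: "real \<Rightarrow> nat \<Rightarrow> real \<Rightarrow> real" where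
  "cutoff a n x = max 0 (min 1 (1 - real n * (\<bar>x\<bar> - a)))"

lemma test_fun_cutoff: "test_fun (cutoff a n)"
proof -
  have "\<bar>cutoff a n x - cutoff a n y\<bar> \<le> (real n + 1) * \<bar>x - y\<bar>" for x y
  proof -
    have "\<bar>cutoff a n x - cutoff a n y\<bar> \<le> \<bar>real n * \<bar>y\<bar> - real n * \<bar>x\<bar>\<bar>"
    proof -
      have "\<bar>max 0 (min 1 (1 - u)) - max 0 (min 1 (1 - w))\<bar> \<le> \<bar>w - u\<bar>" for u w :: real
        by (auto simp: max_def min_def abs_if)
      from this[of "real n * (\<bar>x\<bar> - a)" "real n * (\<bar>y\<bar> - a)"] show ?thesis
        unfolding cutoff_def by (simp add: right_diff_distrib)
    qed
    also have "\<dots> = real n * \<bar>\<bar>y\<bar> - \<bar>x\<bar>\<bar>" by (metis abs_mult abs_of_nat right_diff_distrib)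
    also have "\<dots> \<le> real n * \<bar>x - y\<bar>" by (intro mult_left_mono) auto
    finally show ?thesis using abs_ge_zero[of "x - y"] unfolding distrib_right mult_1 by linarith
  qed
  moreover have "\<bar>cutoff a n x\<bar> \<le> real n + 1" for x by (auto simp: cutoff_def)
  ultimately have "bounded_lipschitz (cutoff a n)" unfolding bounded_lipschitz_def by blast
  then show ?thesis by (auto simp: test_fun_def cutoff_def)
qed

lemma cutoff_tendsto:
  assumes "0 \<le> x" shows "(\<lambda>n. cutoff a n x) \<longlonglongrightarrow> indicator {..a} x"
proof (cases "x \<le> a")
  case True
  have "1 \<le> 1 - real n * (\<bar>x\<bar> - a)" for n using True assms by (simp add: mult_nonneg_nonpos)
  then show ?thesis using True by (simp add: cutoff_def)
next
  case False
  then obtain N :: nat where N: "1 / (x - a) < real N" using reals_Archimedean2 by blast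
  have "cutoff a n x = 0" if "N \<le> n" for n
  proof -
    have "1 / (x - a) < real n" using N that by linarith
    then have "1 < real n * (x - a)" using False by (simp add: divide_less_eq)
    then show ?thesis using assms by (simp add: cutoff_def)
  qed
  then show ?thesis using False by (intro tendsto_eventually) (auto simp: eventually_sequentially)
qed

context brownian begin

text \<open>Products of cutoffs have the same integral under both measures and converge to
  indicators of lower quadrants, which determine a law in the plane.\<close>

lemma meander_joint_law:
  assumes "times s t"
  shows "distr M borel (\<lambda>\<omega>. (meander B s \<omega>, meander B t \<omega>)) =
    density lborel (\<lambda>z. ennreal (times.joint s t (fst z) (snd z) / entrance s t (\<lambda>_. 1) (\<lambda>_. 1)))" (is "?J = ?D")
proof -
  interpret times s t by fact
  define Z where "Z = entrance s t (\<lambda>_. 1) (\<lambda>_. 1)"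
  have Z: "0 < Z" unfolding Z_def by (rule entrance_1_pos)
  have [measurable]: "meander B s \<in> borel_measurable M" "meander B t \<in> borel_measurable M"
    using st by (auto intro!: meander_measurable)
  note [measurable] = joint_measurable[OF fst_borel snd_borel]
  have nn: "(\<integral>\<^sup>+z. ennreal (f1 (fst z) * f2 (snd z)) \<partial>?D) = ennreal (entrance s t f1 f2 / Z)"
    if f: "test_fun f1" "test_fun f2" for f1 f2
  proof -
    have f': "f1 \<in> borel_measurable borel" "f2 \<in> borel_measurable borel" using f test_funD(6) by auto
    note [measurable] = f' measurable_compose[OF fst_borel f'(1)] measurable_compose[OF snd_borel f'(2)]
    have "(\<integral>\<^sup>+z. ennreal (f1 (fst z) * f2 (snd z)) \<partial>?D)
      = (\<integral>\<^sup>+z. ennreal (joint (fst z) (snd z) / Z) * ennreal (f1 (fst z) * f2 (snd z)) \<partial>lborel)"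
      unfolding Z_def by (subst nn_integral_density) auto
    also have "\<dots> = (\<integral>\<^sup>+z. ennreal (1 / Z) * ennreal (f1 (fst z) * f2 (snd z) * joint (fst z) (snd z)) \<partial>(lborel \<Otimes>\<^sub>M lborel))"
      unfolding lborel_prod using Z joint_nonneg test_funD(3)[OF f(1)] test_funD(3)[OF f(2)]
      by (intro nn_integral_cong) (simp add: ennreal_mult[symmetric] mult.commute)
    also have "\<dots> = (\<integral>\<^sup>+x. \<integral>\<^sup>+c. ennreal (1 / Z) * ennreal (f1 x * f2 c * joint x c) \<partial>lborel \<partial>lborel)"
      by (subst lborel.nn_integral_fst[symmetric]) auto
    also have "\<dots> = ennreal (1 / Z) * ennreal (entrance s t f1 f2)"
      unfolding entrance_nn_integral[OF f] by (simp add: nn_integral_cmult)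
    also have "\<dots> = ennreal (entrance s t f1 f2 / Z)"
      using Z by (simp add: ennreal_mult'[symmetric])
    finally show ?thesis .
  qed
  \<comment> \<open>The constant test functions give the total mass, which explains the normalising
    constant.\<close>
  have "emeasure ?D (space ?D) = 1"
    using nn[OF test_fun_1 test_fun_1] Z by (simp add: Z_def one_ennreal_def[symmetric])
  then interpret D: prob_space ?D by (rule prob_spaceI)
  interpret J: prob_space ?J by (rule prob_space_distr) measurable
  \<comment> \<open>The cutoffs have the desired limit at nonnegative coordinates, so the density
    must put no mass elsewhere; the meander is nonnegative by definition.\<close>
  have pos: "AE z in ?D. 0 < fst z \<and> 0 < snd z"
  proof -
    have "AE z in lborel. 0 < ennreal (joint (fst z) (snd z) / entrance s t (\<lambda>_. 1) (\<lambda>_. 1)) \<longrightarrow> 0 < fst z \<and> 0 < snd z"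
      by (auto simp: joint_def intro!: AE_I2 split: split_indicator_asm)
    then show ?thesis by (subst AE_density) auto
  qed
  show ?thesis
  proof (rule measure_eq_rectangles)
    show "finite_measure ?J" by (rule J.finite_measure_axioms)
    fix a b :: real
    define F where "F n z = cutoff a n (fst z) * cutoff b n (snd z)" for n and z :: "real \<times> real"
    let ?I = "\<lambda>z. indicator ({..a} \<times> {..b}) z :: real"
    have cm [measurable]: "cutoff a n \<in> borel_measurable borel" for a n by (rule test_funD(6)[OF test_fun_cutoff])
    have Fm [measurable]: "F n \<in> borel_measurable borel" for n 
      unfolding F_def borel_prod[symmetric] by measurable
    have F01: "0 \<le> F n z" "\<bar>F n z\<bar> \<le> 1" for n z
      unfolding F_def by (intro mult_nonneg_nonneg abs_mult_le_1 test_funD(3,5)[OF test_fun_cutoff])+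
    have lim: "(\<lambda>n. F n z) \<longlonglongrightarrow> ?I z" if "0 \<le> fst z" "0 \<le> snd z" for z
      using tendsto_mult[OF cutoff_tendsto[OF that(1), of a] cutoff_tendsto[OF that(2), of b]]
      unfolding F_def indicator_times by (simp add: split_beta)
    have Im: "{..a} \<times> {..b} \<in> sets borel" unfolding borel_prod[symmetric] by auto
    have [measurable]: "?I \<in> borel_measurable borel" using Im by (rule borel_measurable_indicator)
    have "integral\<^sup>L ?J (F n) = integral\<^sup>L ?D (F n)" for n
    proof -
      have "integral\<^sup>L ?J (F n) = entrance s t (cutoff a n) (cutoff b n) / Z"
        unfolding Z_def meander_test_fun[OF assms test_fun_cutoff test_fun_cutoff, symmetric]
        by (subst integral_distr) (auto simp: F_def)
      also have "\<dots> = integral\<^sup>L ?D (F n)"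
        using nn[OF test_fun_cutoff test_fun_cutoff, of a n b n] F01(1) Z
          entrance_nonneg[OF test_fun_cutoff test_fun_cutoff, of a n b n]
        by (subst integral_eq_nn_integral) (auto simp: F_def)
      finally show ?thesis .
    qed
    moreover have "(\<lambda>n. integral\<^sup>L ?J (F n)) \<longlonglongrightarrow> integral\<^sup>L ?J ?I"
    proof (rule integral_dominated_convergence[where w = "\<lambda>_. 1"])
      show "AE z in ?J. (\<lambda>n. F n z) \<longlonglongrightarrow> ?I z"
      proof (rule AE_distr_iff[THEN iffD2])
        show "AE \<omega> in M. (\<lambda>n. F n (meander B s \<omega>, meander B t \<omega>)) \<longlonglongrightarrow> ?I (meander B s \<omega>, meander B t \<omega>)"
          by (intro AE_I2 lim) (auto simp: meander_eq)
      qed measurable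
    qed (use F01 in auto)
    moreover have "(\<lambda>n. integral\<^sup>L ?D (F n)) \<longlonglongrightarrow> integral\<^sup>L ?D ?I"
    proof (rule integral_dominated_convergence[where w = "\<lambda>_. 1"])
      show "AE z in ?D. (\<lambda>n. F n z) \<longlonglongrightarrow> ?I z"
        using pos by (rule AE_mp) (auto intro!: AE_I2 lim)
    qed (use F01 in auto)
    ultimately have "integral\<^sup>L ?J ?I = integral\<^sup>L ?D ?I" using LIMSEQ_unique by simp
    then show "emeasure ?J ({..a} \<times> {..b}) = emeasure ?D ({..a} \<times> {..b})"
      using Im by (simp add: J.emeasure_eq_measure D.emeasure_eq_measure)
  qed auto
qed

end

section \<open>From almost everywhere to every point: the conditional density\<close>

lemma AE_eq_imp_eq_on_open:
  fixes f g :: "'a::euclidean_space \<Rightarrow> real"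
  assumes S: "open S" and f: "continuous_on S f" and g: "continuous_on S g"
    and ae: "AE z in lborel. z \<in> S \<longrightarrow> f z = g z" and z: "z \<in> S"
  shows "f z = g z"
proof (rule ccontr)
  assume ne: "f z \<noteq> g z"
  \<comment> \<open>The set of disagreement is open by continuity, and a nonempty open set is not
    null.\<close>
  define U where "U = S \<inter> (\<lambda>z. f z - g z) -` (- {0})"
  have "open U" unfolding U_def
    by (rule continuous_open_preimage[OF continuous_on_diff[OF f g] S]) auto
  moreover have "z \<in> U" using z ne by (auto simp: U_def)
  ultimately have n: "\<not> negligible U" using open_not_negligible by blast
  have "AE z in lborel. z \<notin> U" using ae by (rule AE_mp) (auto simp: U_def)
  moreover have "U \<in> sets lborel" using \<open>open U\<close> by simp
  ultimately have "U \<in> null_sets lborel" by (subst AE_iff_null_sets) auto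
  then have "U \<in> null_sets lebesgue" by (rule null_sets_completionI)
  then show False using n negligible_iff_null_sets by blast
qed

lemma (in times) gauss: "0 < c \<Longrightarrow> gauss (c * s / t) (s * (t - s) / t)"
  using st by unfold_locales auto

text \<open>The rates 1 / s and 1 / (t - s) of the two Gaussian factors add up to t / (s (t - s)),
  the reciprocal of the bridge variance, and c / (t - s) is the bridge mean divided by that
  variance.\<close>

lemma (in times) joint_x_eq: "joint_x x c = x * weight (c * s / t) (s * (t - s) / t) x"
proof -
  have "- x\<^sup>2 / (2 * s) + - x\<^sup>2 / (2 * (t - s)) = - x\<^sup>2 / (2 * (s * (t - s) / t))"
    using st by (simp add: divide_simps) (simp add: algebra_simps)
  moreover have "c * s / t * x / (s * (t - s) / t) = x * c / (t - s)" using st by (simp add: field_simps)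
  ultimately show ?thesis unfolding joint_x_def weight_def by (simp only: mult.assoc exp_add[symmetric] add.assoc[symmetric])
qed

lemma (in times) continuous_on_conditional:
  "continuous_on ({0<..} \<times> {0<..}) (\<lambda>(x, c). conditional (c * s / t) (s * (t - s) / t) x)"
  unfolding conditional_def weight_def split_beta
  using st by (intro continuous_intros) auto

text \<open>\<open>joint\<close>, normalised, and \<open>p\<close> times the density of the meander
  at time \<open>t\<close> are densities of the same law, hence agree almost everywhere. Dividing by
  the marginal, which is positive for \<open>c > 0\<close>, removes all factors in \<open>c\<close>
  alone; continuity of both sides then gives equality at every point of the quadrant.\<close>

lemma (in brownian) meander_density_eq:
  assumes "times s t" and p: "meander_conditional_density M B s t p" and x: "0 < x" and c: "0 < c"
  shows "p x c = conditional (c * s / t) (s * (t - s) / t) x"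
proof -
  interpret times s t by fact
  define Z where "Z = entrance s t (\<lambda>_. 1) (\<lambda>_. 1)"
  have Z: "0 < Z" unfolding Z_def by (rule entrance_1_pos)
  have [measurable]: "meander B s \<in> borel_measurable M" "meander B t \<in> borel_measurable M"
    using st by (auto intro!: meander_measurable)
  have pm [measurable]: "(\<lambda>(x, c). p x c) \<in> borel_measurable (borel \<Otimes>\<^sub>M borel)"
    and pnn: "\<And>x c. 0 \<le> p x c"
    and pd: "\<And>A C. A \<in> sets borel \<Longrightarrow> C \<in> sets borel \<Longrightarrow> emeasure M {\<omega> \<in> space M. meander B s \<omega> \<in> A \<and> meander B t \<omega> \<in> C} =
          (\<integral>\<^sup>+c\<in>C. (\<integral>\<^sup>+x\<in>A. ennreal (p x c) \<partial>lborel) \<partial>distr M borel (meander B t))"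
    and pc: "continuous_on ({0<..} \<times> {0<..}) (\<lambda>(x, c). p x c)"
    using p unfolding meander_conditional_density_def conditional_density_def by auto
  have pm' [measurable]: "(\<lambda>z. p (f z) (g z)) \<in> borel_measurable N" if "f \<in> borel_measurable N" "g \<in> borel_measurable N" for f g and N :: "'z measure"
    using measurable_compose[OF measurable_Pair[OF that] pm] by simp
  define J where "J = distr M borel (\<lambda>\<omega>. (meander B s \<omega>, meander B t \<omega>))"
  interpret J: prob_space J unfolding J_def by (rule prob_space_distr) measurable
  define j where "j x c = ennreal (joint x c / Z)" for x c
  have jm [measurable]: "(\<lambda>z. j (f z) (g z)) \<in> borel_measurable N" if "f \<in> borel_measurable N" "g \<in> borel_measurable N" for f g and N :: "'z measure"
    using joint_measurable[OF that] unfolding j_def by measurable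
  have J: "J = density lborel (\<lambda>z. j (fst z) (snd z))"
    unfolding J_def j_def Z_def by (rule meander_joint_law[OF assms(1)])
  have JAC: "emeasure J (A \<times> C) = emeasure M {\<omega> \<in> space M. meander B s \<omega> \<in> A \<and> meander B t \<omega> \<in> C}"
    if "A \<in> sets borel" "C \<in> sets borel" for A C
  proof -
    have "A \<times> C \<in> sets borel" using that unfolding borel_prod[symmetric] by auto
    then show ?thesis unfolding J_def by (subst emeasure_distr) (auto intro!: arg_cong[where f = "emeasure M"])
  qed
  define \<rho> where "\<rho> c = (\<integral>\<^sup>+x. j x c \<partial>lborel)" for c
  have \<rho> [measurable]: "\<rho> \<in> borel_measurable borel" unfolding \<rho>_def by measurable
  \<comment> \<open>The order with the x-integral inside is the one in which
    \<open>conditional_density\<close> is stated.\<close>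
  have swap: "emeasure (density lborel (\<lambda>z. k (fst z) (snd z))) (A \<times> C) = (\<integral>\<^sup>+c. (\<integral>\<^sup>+x. k x c * indicator A x \<partial>lborel) * indicator C c \<partial>lborel)"
    if A [measurable]: "A \<in> sets borel" and C [measurable]: "C \<in> sets borel"
      and k [measurable]: "(\<lambda>z. k (fst z) (snd z)) \<in> borel_measurable (borel \<Otimes>\<^sub>M borel)" for A C :: "real set" and k :: "real \<Rightarrow> real \<Rightarrow> ennreal"
  proof -
    have k1 [measurable]: "(\<lambda>x. k x c) \<in> borel_measurable borel" for c
      using measurable_compose[OF _ k, of "\<lambda>x. (x, c)" borel] by simp
    have "emeasure (density lborel (\<lambda>z. k (fst z) (snd z))) (A \<times> C) = (\<integral>\<^sup>+z. k (fst z) (snd z) * indicator (A \<times> C) z \<partial>(lborel \<Otimes>\<^sub>M lborel))"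
      unfolding lborel_prod by (rule emeasure_density) (use k A C in \<open>auto simp: borel_prod[symmetric]\<close>)
    also have "\<dots> = (\<integral>\<^sup>+c. (\<integral>\<^sup>+x. k (fst (x, c)) (snd (x, c)) * indicator (A \<times> C) (x, c) \<partial>lborel) \<partial>lborel)"
      by (rule lborel_pair.nn_integral_snd[symmetric]) measurable
    also have "\<dots> = (\<integral>\<^sup>+c. (\<integral>\<^sup>+x. (k x c * indicator A x) * indicator C c \<partial>lborel) \<partial>lborel)"
      by (simp add: indicator_times mult.assoc)
    also have "\<dots> = (\<integral>\<^sup>+c. (\<integral>\<^sup>+x. k x c * indicator A x \<partial>lborel) * indicator C c \<partial>lborel)"
      by (intro nn_integral_cong nn_integral_multc) measurable
    finally show ?thesis .
  qed
  have Y: "distr M borel (meander B t) = density lborel \<rho>"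
  proof (rule measure_eqI)
    fix C assume "C \<in> sets (distr M borel (meander B t))"
    then have C [measurable]: "C \<in> sets borel" by simp
    have "emeasure (distr M borel (meander B t)) C = emeasure J (UNIV \<times> C)"
      unfolding JAC[OF sets.top[of borel, unfolded space_borel] C] by (subst emeasure_distr) (auto intro!: arg_cong[where f = "emeasure M"])
    also have "\<dots> = (\<integral>\<^sup>+c. \<rho> c * indicator C c \<partial>lborel)"
      unfolding J by (subst swap) (auto simp: \<rho>_def)
    finally show "emeasure (distr M borel (meander B t)) C = emeasure (density lborel \<rho>) C"
      by (simp add: emeasure_density)
  qed simp
  \<comment> \<open>The identity defining \<open>p\<close>, with the law of the conditioning
    variable replaced by its density \<rho>, exhibits a second density of \<open>J\<close>.\<close>
  have "J = density lborel (\<lambda>z. ennreal (p (fst z) (snd z)) * \<rho> (snd z))"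
  proof (rule measure_eq_rectangles)
    show "finite_measure J" by (rule J.finite_measure_axioms)
    fix a b :: real
    have "emeasure J ({..a} \<times> {..b}) = (\<integral>\<^sup>+c\<in>{..b}. (\<integral>\<^sup>+x\<in>{..a}. ennreal (p x c) \<partial>lborel) \<partial>density lborel \<rho>)"
      unfolding Y[symmetric] using JAC[of "{..a}" "{..b}"] pd[of "{..a}" "{..b}"] by simp
    also have "\<dots> = (\<integral>\<^sup>+c. \<rho> c * ((\<integral>\<^sup>+x\<in>{..a}. ennreal (p x c) \<partial>lborel) * indicator {..b} c) \<partial>lborel)"
      by (rule nn_integral_density) measurable
    also have "\<dots> = (\<integral>\<^sup>+c. (\<integral>\<^sup>+x. ennreal (p x c) * \<rho> c * indicator {..a} x \<partial>lborel) * indicator {..b} c \<partial>lborel)"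
    proof (rule nn_integral_cong)
      fix c
      have "(\<integral>\<^sup>+x. ennreal (p x c) * \<rho> c * indicator {..a} x \<partial>lborel) = (\<integral>\<^sup>+x. \<rho> c * (ennreal (p x c) * indicator {..a} x) \<partial>lborel)"
        by (intro nn_integral_cong) (simp only: mult.assoc mult.commute mult.left_commute)
      also have "\<dots> = \<rho> c * (\<integral>\<^sup>+x\<in>{..a}. ennreal (p x c) \<partial>lborel)"
        by (rule nn_integral_cmult) measurable
      finally show "\<rho> c * ((\<integral>\<^sup>+x\<in>{..a}. ennreal (p x c) \<partial>lborel) * indicator {..b} c)
        = (\<integral>\<^sup>+x. ennreal (p x c) * \<rho> c * indicator {..a} x \<partial>lborel) * indicator {..b} c" by (simp only: mult.assoc)
    qed
    also have "\<dots> = emeasure (density lborel (\<lambda>z. ennreal (p (fst z) (snd z)) * \<rho> (snd z))) ({..a} \<times> {..b})"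
      by (rule swap[symmetric]) measurable
    finally show "emeasure J ({..a} \<times> {..b}) = emeasure (density lborel (\<lambda>z. ennreal (p (fst z) (snd z)) * \<rho> (snd z))) ({..a} \<times> {..b})" .
  qed (simp_all add: J)
  then have ae: "AE z in lborel. j (fst z) (snd z) = ennreal (p (fst z) (snd z)) * \<rho> (snd z)"
    unfolding J
    by (intro sigma_finite_measure.density_unique[OF sigma_finite_lborel])
      (auto intro!: jm pm' fst_borel snd_borel borel_measurable_times_ennreal measurable_compose[OF pm' measurable_ennreal] measurable_compose[OF snd_borel \<rho>])
  let ?q = "\<lambda>x c. conditional (c * s / t) (s * (t - s) / t) x"
  have eq: "p x c = ?q x c" if xc: "0 < x" "0 < c" and e: "j x c = ennreal (p x c) * \<rho> c" for x c
  proof -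
    interpret gauss "c * s / t" "s * (t - s) / t" by (rule gauss[OF xc(2)])
    define D where "D = exp ((c * s / t)\<^sup>2 / (2 * (s * (t - s) / t))) / 2 * (c * s / t * sqrt (2 * pi * (s * (t - s) / t)))"
    have "0 < 2 * pi * (s * (t - s) / t)" by (intro mult_pos_pos v) auto
    then have D: "0 < D" unfolding D_def using m by (intro mult_pos_pos) (auto simp only: real_sqrt_gt_0_iff divide_pos_pos exp_gt_zero zero_less_numeral)
    \<comment> \<open>All factors of the joint density that depend on \<open>c\<close> alone,
      including the probability of survival from time \<open>t\<close> to 1. Its positivity permits
      the cancellation between the joint density and the marginal.\<close>
    define K where "K = 2 / (pi * s * sqrt (t - s)) * joint_c c / Z"
    have K: "0 < K" unfolding K_def joint_c_def using Z st heat_sgn_pos[OF xc(2)] by simp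
    have w: "0 \<le> x * weight (c * s / t) (s * (t - s) / t) x" if "0 < x" for x
      using that weight_nonneg[of x] by (intro mult_nonneg_nonneg) auto
    have jx: "j x c = ennreal K * (ennreal (x * weight (c * s / t) (s * (t - s) / t) x) * indicator {0<..} x)" for x
    proof (cases "0 < x")
      case True
      have "joint x c / Z = K * (x * weight (c * s / t) (s * (t - s) / t) x)"
        using True xc by (simp add: joint_def K_def joint_x_eq)
      then show ?thesis using True K w[OF True] by (simp add: j_def ennreal_mult')
    qed (simp add: j_def joint_def)
    have wm [measurable]: "weight (c * s / t) (s * (t - s) / t) \<in> borel_measurable borel" unfolding weight_def by measurable
    have "\<rho> c = ennreal K * ennreal D"
      unfolding \<rho>_def jx D_def nn_integral_weight_1[symmetric] by (rule nn_integral_cmult) measurable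
    then have "ennreal (K * (x * weight (c * s / t) (s * (t - s) / t) x)) = ennreal (p x c * (K * D))"
      using e xc K D pnn w[OF xc(1)] by (simp add: jx ennreal_mult)
    then have "K * (x * weight (c * s / t) (s * (t - s) / t) x) = p x c * (K * D)"
      using K D pnn w[OF xc(1)] by (subst (asm) ennreal_inj) auto
    then have "x * weight (c * s / t) (s * (t - s) / t) x = p x c * D" using K by simp
    then show ?thesis using D unfolding conditional_def D_def[symmetric] by (simp add: eq_divide_eq)
  qed
  have "(\<lambda>(x, c). p x c) (x, c) = (\<lambda>(x, c). ?q x c) (x, c)"
  proof (rule AE_eq_imp_eq_on_open[OF _ pc continuous_on_conditional])
    show "open ({0<..} \<times> {0<..} :: (real \<times> real) set)" by (intro open_Times) auto
    show "AE z in lborel. z \<in> {0<..} \<times> {0<..} \<longrightarrow> (\<lambda>(x, c). p x c) z = (\<lambda>(x, c). ?q x c) z"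
      using ae by (rule AE_mp) (auto intro!: AE_I2 eq)
  qed (use x c in auto)
  then show ?thesis by simp
qed

theorem theorem3p3:
  fixes M :: "'a measure" and B :: "real \<Rightarrow> 'a \<Rightarrow> real"
    and s t c :: real and p :: "real \<Rightarrow> real \<Rightarrow> real"
  assumes "brownian_motion M B"
    and "0 < s" and "s < t" and "t \<le> 1" and "0 < c"
    and "meander_conditional_density M B s t p"
  shows "conditional_moment 1 p c =
           1 / c * (t - s + s * c\<^sup>2 / t) * erf (c * sqrt s / sqrt (2 * t * (t - s)))
           + sqrt (2 * s * (t - s)) / sqrt (pi * t) * exp (- (s * c\<^sup>2 / (2 * t * (t - s))))
         \<and> conditional_moment 2 p c = 3 * s * (t - s) / t + c\<^sup>2 * s\<^sup>2 / t\<^sup>2"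
proof -
  interpret prob_space M using assms(1) by (simp add: brownian_motion_def)
  interpret brownian M B by unfold_locales (rule assms(1))
  interpret times s t by unfold_locales (use assms in auto)
  \<comment> \<open>The mean, and below it the variance, of the Brownian bridge from 0 to
    \<open>c\<close> over \<open>[0, t]\<close> at time \<open>s\<close>.\<close>
  define m where "m = c * s / t"
  define v where "v = s * (t - s) / t"
  interpret gauss m v unfolding m_def v_def by (rule gauss[OF assms(5)])
  have moment: "conditional_moment k p c = (LINT x:{0<..}|lborel. x ^ k * conditional m v x)" for k
    unfolding conditional_moment_def m_def v_def
    \<comment> \<open>Only \<open>x > 0\<close> enters the integral, and there \<open>p\<close> is
      determined at this very \<open>c\<close>, not merely for almost every one.\<close>
    by (intro set_lebesgue_integral_cong) (auto simp: meander_density_eq[OF times_axioms assms(6) _ assms(5)])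
  have 1: "m + v / m = 1 / c * (t - s + s * c\<^sup>2 / t)"
    using assms unfolding m_def v_def by (simp add: field_simps power2_eq_square)
  have 2: "m / sqrt (2 * v) = c * sqrt s / sqrt (2 * t * (t - s))"
  proof -
    \<comment> \<open>Both sides are nonnegative, so it suffices to compare squares, which contain
      no roots.\<close>
    have "(m / sqrt (2 * v))\<^sup>2 = (c * sqrt s / sqrt (2 * t * (t - s)))\<^sup>2"
      using assms v unfolding power_divide power_mult_distrib
      by (simp add: m_def v_def field_simps power2_eq_square)
    then show ?thesis by (rule power2_eq_imp_eq) (use assms m v in auto)
  qed
  have 3: "sqrt (2 * v / pi) = sqrt (2 * s * (t - s)) / sqrt (pi * t)"
    unfolding v_def real_sqrt_divide[symmetric] by (simp add: field_simps)
  have 4: "- m\<^sup>2 / (2 * v) = - (s * c\<^sup>2 / (2 * t * (t - s)))"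
    using assms unfolding m_def v_def by (simp add: field_simps power2_eq_square)
  have 5: "m\<^sup>2 + 3 * v = 3 * s * (t - s) / t + c\<^sup>2 * s\<^sup>2 / t\<^sup>2"
    using assms unfolding m_def v_def by (simp add: power_divide power_mult_distrib)
  show ?thesis
    using conditional_moments(1) conditional_moments(2) unfolding moment power_one_right 1 2 3 4 5 by simp
qed



end
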